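(* For all $N\ge1$ and $m_1,m_2,m_3\in\mathbb{N}$, the arrangement $cBCCat$ in $\mathbb{C}^{N+1}$ (the coning of the extended Catalan arrangement of the root system $BC_N$) is free.
   Context: $\mathbb{N}=\{0,1,2,\dots\}$. The numbers $m_1=m(e_i)$, $m_2=m(2e_i)$, $m_3=m(e_i\pm e_j)$ are the values of a multiplicity function on the root system $BC_N$ invariant under the reflection group of type $B_N$. $cBCCat$ is the central arrangement of hyperplanes in $\mathbb{C}^{N+1}$, with coordinates $x_1,\dots,x_N,z$, with defining polynomial $$P_c(x,z)=z\prod_{i=1}^N\Big(x_i\prod_{j=1}^{m_1}(x_i^2-j^2z^2)\prod_{j=1}^{m_2}(4x_i^2-(2j-1)^2z^2)\Big)\prod_{i<j}\prod_{\epsilon\in\{\pm1\}}\Big((x_i-\epsilon x_j)\prod_{k=1}^{m_3}((x_i-\epsilon x_j)^2-k^2z^2)\Big).$$ An arrangement is free if its module of logarithmic vector fields is free over the polynomial ring $R=\mathbb{C}[x_1,\dots,x_N,z]$; here the module $D(cBCCat)$ consists of derivations $L$ of $R$ such that $L(\ell)\in\ell R$ for every linear factor $\ell$ of $P_c$. *)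

theory Defs
  imports "HOL-Analysis.Analysis" "HOL-Library.Poly_Mapping" "HOL-Library.Function_Algebras"
begin

text \<open>
  The coordinates of complex \<open>(N+1)\<close>-space are indexed by \<open>'n option\<close> with \<open>N = CARD('n)\<close>:
  \<open>Some i\<close> stands for \<open>x\<^sub>i\<close> and \<open>None\<close> for the coning variable \<open>z\<close>. A polynomial in variables
  indexed by \<open>'v\<close> is a finitely supported map from exponent vectors to coefficients.
\<close>

type_synonym 'v cpoly = "('v \<Rightarrow>\<^sub>0 nat) \<Rightarrow>\<^sub>0 complex"

definition pconst :: "complex \<Rightarrow> 'v cpoly" where
  "pconst c = Poly_Mapping.single 0 c"

definition pvar :: "'v \<Rightarrow> 'v cpoly" where
  "pvar v = Poly_Mapping.single (Poly_Mapping.single v 1) 1"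

definition derivation :: "('v cpoly \<Rightarrow> 'v cpoly) \<Rightarrow> bool" where
  "derivation L \<longleftrightarrow>
     (\<forall>p q. L (p + q) = L p + L q) \<and>
     (\<forall>c p. L (pconst c * p) = pconst c * L p) \<and>
     (\<forall>p q. L (p * q) = L p * q + p * L q)"

text \<open>
  All maps from the polynomial ring to itself form a module over it under \<open>pscale\<close>; modules of
  derivations are submodules of this one.
\<close>

definition pscale :: "'v cpoly \<Rightarrow> ('v cpoly \<Rightarrow> 'v cpoly) \<Rightarrow> ('v cpoly \<Rightarrow> 'v cpoly)" where
  "pscale p L = (\<lambda>f. p * L f)"

global_interpretation pmod: module "pscale :: 'v cpoly \<Rightarrow> _"
  by unfold_locales (auto simp: pscale_def algebra_simps)

definition linform :: "complex ^ 'v \<Rightarrow> 'v::finite cpoly" where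
  "linform a = (\<Sum>v\<in>UNIV. pconst (a $ v) * pvar v)"

definition hyperplane :: "complex ^ 'v \<Rightarrow> (complex ^ 'v::finite) set" where
  "hyperplane a = {y. (\<Sum>v\<in>UNIV. a $ v * y $ v) = 0}"

definition arrangement_of :: "'v cpoly \<Rightarrow> (complex ^ 'v::finite) set set" where
  "arrangement_of Q = {hyperplane a |a. a \<noteq> 0 \<and> linform a dvd Q}"

definition log_derivations :: "(complex ^ 'v::finite) set set \<Rightarrow> ('v cpoly \<Rightarrow> 'v cpoly) set" where
  "log_derivations A =
     {L. derivation L \<and>
         (\<forall>a. a \<noteq> 0 \<longrightarrow> hyperplane a \<in> A \<longrightarrow> linform a dvd L (linform a))}"

definition free_arrangement :: "(complex ^ 'v::finite) set set \<Rightarrow> bool" where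
  "free_arrangement A \<longleftrightarrow> (\<exists>B. pmod.independent B \<and> pmod.span B = log_derivations A)"

definition BC_poly :: "nat \<Rightarrow> nat \<Rightarrow> nat \<Rightarrow> 'n::{finite,linorder} option cpoly" where
  "BC_poly m1 m2 m3 =
     (let x = (\<lambda>i. pvar (Some i)); z = pvar None in
      z * (\<Prod>i\<in>UNIV. x i *
             (\<Prod>j=1..m1. (x i)\<^sup>2 - (of_nat j)\<^sup>2 * z\<^sup>2) *
             (\<Prod>j=1..m2. 4 * (x i)\<^sup>2 - (2 * of_nat j - 1)\<^sup>2 * z\<^sup>2)) *
      (\<Prod>(i, j)\<in>{(i, j). i < j}. \<Prod>\<epsilon>\<in>{1, -1}.
             (x i - \<epsilon> * x j) *
             (\<Prod>k=1..m3. (x i - \<epsilon> * x j)\<^sup>2 - (of_nat k)\<^sup>2 * z\<^sup>2)))"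

definition cBCCat :: "nat \<Rightarrow> nat \<Rightarrow> nat \<Rightarrow> (complex ^ 'n::{finite,linorder} option) set set" where
  "cBCCat m1 m2 m3 = arrangement_of (BC_poly m1 m2 m3)"

text \<open>
  The logarithmic derivations form a submodule, and membership can be tested on the linear
  factors of a defining polynomial: the choice of the linear form of a hyperplane is irrelevant.
\<close>

lemma pconst_mult: "pconst c * pconst d = pconst (c * d)"
  by (simp add: pconst_def mult_single)

lemma linform_scale: "linform (\<chi> v. c * a $ v) = pconst c * linform a"
  by (simp add: linform_def sum_distrib_left pconst_mult[symmetric] mult.assoc)

lemma derivation_pscale: "derivation L \<Longrightarrow> derivation (pscale p L)"
  by (auto simp: derivation_def pscale_def algebra_simps)

lemma derivation_plus:
  assumes "derivation L" "derivation M"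
  shows "derivation (L + M)"
  unfolding derivation_def plus_fun_def
proof (intro conjI allI)
  fix p q :: "'a cpoly" and c
  have L: "L (p + q) = L p + L q" "L (pconst c * p) = pconst c * L p" "L (p * q) = L p * q + p * L q"
    using assms(1) unfolding derivation_def by blast+
  have M: "M (p + q) = M p + M q" "M (pconst c * p) = pconst c * M p" "M (p * q) = M p * q + p * M q"
    using assms(2) unfolding derivation_def by blast+
  show "L (p + q) + M (p + q) = L p + M p + (L q + M q)"
    unfolding L(1) M(1) by (simp add: add_ac)
  show "L (pconst c * p) + M (pconst c * p) = pconst c * (L p + M p)"
    unfolding L(2) M(2) by (simp add: distrib_left)
  show "L (p * q) + M (p * q) = (L p + M p) * q + p * (L q + M q)"
    unfolding L(3) M(3) by (simp add: distrib_left distrib_right add_ac)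
qed

lemma subspace_log_derivations: "pmod.subspace (log_derivations A)"
proof (rule pmod.subspaceI)
  show "0 \<in> log_derivations A"
    by (simp add: log_derivations_def derivation_def)
next
  fix L M assume "L \<in> log_derivations A" "M \<in> log_derivations A"
  then show "L + M \<in> log_derivations A"
    by (auto simp: log_derivations_def derivation_plus)
next
  fix p L assume L: "L \<in> log_derivations A"
  then show "pscale p L \<in> log_derivations A"
    by (simp add: log_derivations_def derivation_pscale) (simp add: pscale_def)
qed

lemma hyperplane_eqD:
  fixes a b :: "complex ^ 'v::finite"
  assumes "hyperplane a = hyperplane b" "a \<noteq> 0" "b \<noteq> 0"
  obtains c where "a = (\<chi> v. c * b $ v)"
proof -
  obtain w where w: "b $ w \<noteq> 0"
    using assms(3) by (auto simp: vec_eq_iff)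
  have "a $ u = a $ w / b $ w * b $ u" for u
  proof (cases "u = w")
    case False
    let ?y = "(\<chi> v. if v = u then b $ w else if v = w then - b $ u else 0) :: complex ^ 'v"
    have s: "(\<Sum>v\<in>UNIV. d $ v * ?y $ v) = d $ u * b $ w - d $ w * b $ u" for d :: "complex ^ 'v"
    proof -
      have "(\<Sum>v\<in>UNIV. d $ v * ?y $ v) = (\<Sum>v\<in>{u, w}. d $ v * ?y $ v)"
        by (rule sum.mono_neutral_right) auto
      also have "\<dots> = d $ u * b $ w - d $ w * b $ u"
        using False by simp
      finally show ?thesis .
    qed
    have "?y \<in> hyperplane b"
      unfolding hyperplane_def mem_Collect_eq s by simp
    then have "?y \<in> hyperplane a"
      using assms(1) by simp
    then have "a $ u * b $ w - a $ w * b $ u = 0"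
      unfolding hyperplane_def mem_Collect_eq s .
    then show ?thesis
      using w by (simp add: field_simps)
  qed (use w in simp)
  then have "a = (\<chi> v. a $ w / b $ w * b $ v)"
    unfolding vec_eq_iff vec_lambda_beta by blast
  then show ?thesis
    by (rule that)
qed

lemma log_derivations_arrangement_of:
  "L \<in> log_derivations (arrangement_of Q) \<longleftrightarrow>
     derivation L \<and> (\<forall>a. a \<noteq> 0 \<longrightarrow> linform a dvd Q \<longrightarrow> linform a dvd L (linform a))"
    (is "_ \<longleftrightarrow> ?R")
proof
  show ?R if "L \<in> log_derivations (arrangement_of Q)"
    using that unfolding log_derivations_def arrangement_of_def by blast
  show "L \<in> log_derivations (arrangement_of Q)" if R: ?R
  proof -
    have "linform a dvd L (linform a)"
      if a: "a \<noteq> 0" and h: "hyperplane a = hyperplane b" and b: "b \<noteq> 0" "linform b dvd Q" for a b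
    proof -
      obtain c where c: "a = (\<chi> v. c * b $ v)"
        using hyperplane_eqD[OF h a b(1)] .
      have la: "linform a = pconst c * linform b"
        unfolding c by (rule linform_scale)
      have La: "L (linform a) = pconst c * L (linform b)"
        unfolding la using R unfolding derivation_def by blast
      have "linform b dvd L (linform b)"
        using R b by blast
      then show ?thesis
        unfolding La unfolding la by (rule mult_dvd_mono[OF dvd_refl])
    qed
    then show ?thesis
      using R unfolding log_derivations_def arrangement_of_def by blast
  qed
qed

end

(* The exponents are 1 (Euler derivation) and 2 m1 + 2 m2 + 2 m3 (N - 1) + 2 l + 1 for l < N, and the
   derivation for l has the components F (x_i + m3 z / 2), where F is the odd discrete antiderivative,
   F (t + z/2) - F (t - z/2) = z w(t) t^(2l) PROD_k PROD_s (t^2 - (x_k + s z)^2), with s running through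
   the m3 numbers -(m3 - 1)/2, ..., (m3 - 1)/2. The product vanishes on x_i + s z, so F is constant on
   the m3 + 1 points x_i - m3 z / 2, ..., x_i + m3 z / 2; when x_i - x_j or x_i + x_j is one of the
   multiples k z with |k| <= m3, two of these windows (up to sign) overlap, and oddness of F gives the
   tangency conditions for x_i - x_j and x_i + x_j. The zeros of the even weight w bring in the
   conditions x_i = k z and x_i = (k - 1/2) z.

   For small m1, m2 the weight has poles and F is only a rational function of t. Polynomial components
   are then obtained by descending induction on m1 and m2: a contiguity relation expresses the
   derivation for a weight w, multiplied by PROD_k (c^2 z^2 - x_k^2), through derivations for
   (t^2 - s^2 z^2) w, and the resulting numerator is divisible by this product, because on
   x_k = c z or x_k = - c z the underlying function is odd, rational and periodic, hence zero.
   The degrees add up to the number of hyperplanes, so Saito's criterion applies once the determinant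
   is known to be nonzero, which is checked at a point with purely imaginary coordinates. *)
theory Submission
  imports Defs
begin

section \<open>Polynomials as functions\<close>

text \<open>Why the zeros of w work, in units z = 1: for x_i = K/2, oddness makes F(x_i + m3/2) half
  of a sum of K + m3 consecutive differences. The product kills the m3 terms at either end, and w
  has to kill those in the middle. The obstacle is a weight with poles: then F can be compared with
  other functions only at nonreal points, and vanishing is carried from there to a whole hyperplane
  by continuity and scaling. The contiguity relation comes from the product for m3 + 1. Since w
  satisfies a first-order difference equation, a suitable multiple H of that product is odd; H
  vanishes at all x_k + m3/2, and its difference is w(t) P(t^2) times the product for m3. So the
  weight w P belongs to the zero derivation, and dividing P by t^2 - s^2 gives the relation. The
  remainder is an odd integer times the removed factors, and the leading coefficient of P is a
  positive integer. Because both are nonzero, the same relation carries the determinant condition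
  back and forth between all weights, and it has to be checked only for w = 1, by counting
  roots.\<close>

definition eval :: "'v::finite cpoly \<Rightarrow> complex ^ 'v \<Rightarrow> complex" where
  "eval p y = (\<Sum>k\<in>Poly_Mapping.keys p. Poly_Mapping.lookup p k * (\<Prod>v\<in>UNIV. y $ v ^ Poly_Mapping.lookup k v))"

lemma eval_superset:
  assumes "finite A" "Poly_Mapping.keys p \<subseteq> A"
  shows "eval p y = (\<Sum>k\<in>A. Poly_Mapping.lookup p k * (\<Prod>v\<in>UNIV. y $ v ^ Poly_Mapping.lookup k v))"
  unfolding eval_def using assms
  by (intro sum.mono_neutral_left) (auto simp: in_keys_iff)

lemma eval_add [simp]: "eval (p + q) y = eval p y + eval q y"
proof -
  let ?A = "Poly_Mapping.keys p \<union> Poly_Mapping.keys q"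
  have *: "finite ?A" "Poly_Mapping.keys (p + q) \<subseteq> ?A" "Poly_Mapping.keys p \<subseteq> ?A" "Poly_Mapping.keys q \<subseteq> ?A"
    using Poly_Mapping.keys_add[of p q] by auto
  show ?thesis
    unfolding eval_superset[OF *(1,2)] eval_superset[OF *(1,3)] eval_superset[OF *(1,4)]
    by (simp add: lookup_add distrib_right sum.distrib)
qed

lemma eval_single: "eval (Poly_Mapping.single k c) y = c * (\<Prod>v\<in>UNIV. y $ v ^ Poly_Mapping.lookup k v)"
  by (subst eval_superset[of "{k}"]) auto

lemma eval_0 [simp]: "eval 0 y = 0"
  by (simp add: eval_def)

lemma cpoly_sum_singles: "p = (\<Sum>k\<in>Poly_Mapping.keys p. Poly_Mapping.single k (Poly_Mapping.lookup p k))"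
  by (rule poly_mapping_eqI) (auto simp: lookup_sum lookup_single when_def in_keys_iff)

lemma cpoly_single_induct [case_names single add]:
  assumes "\<And>k c. P (Poly_Mapping.single k c)" "\<And>p q. P p \<Longrightarrow> P q \<Longrightarrow> P (p + q)"
  shows "P (p :: 'v cpoly)"
proof -
  have "P (\<Sum>k\<in>A. Poly_Mapping.single k (Poly_Mapping.lookup p k))" if "finite A" for A
    using that
  proof induction
    case empty
    show ?case using assms(1)[of 0 0] by simp
  qed (auto intro: assms)
  then show ?thesis
    using cpoly_sum_singles[of p] finite_keys[of p] by metis
qed

lemma eval_mult_single: "eval (Poly_Mapping.single k c * q) y = eval (Poly_Mapping.single k c) y * eval q y"
  by (induction q rule: cpoly_single_induct)
     (auto simp: mult_single eval_single lookup_add power_add prod.distrib distrib_left)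

lemma eval_mult [simp]: "eval (p * q) y = eval p y * eval q y"
  by (induction p rule: cpoly_single_induct) (auto simp: eval_mult_single distrib_right)

lemma eval_pconst [simp]: "eval (pconst c) y = c"
  by (simp add: pconst_def eval_single)

lemma eval_pvar [simp]: "eval (pvar v) y = y $ v"
proof -
  have "(\<Prod>u\<in>UNIV. y $ u ^ Poly_Mapping.lookup (Poly_Mapping.single v 1) u) = (\<Prod>u\<in>{v}. y $ u ^ Poly_Mapping.lookup (Poly_Mapping.single v 1) u)"
    by (rule prod.mono_neutral_right) (auto simp: lookup_single when_def)
  then show ?thesis
    by (simp add: pvar_def eval_single)
qed

lemma pconst_0 [simp]: "pconst 0 = 0" and pconst_1 [simp]: "pconst 1 = 1"
  by (simp_all add: pconst_def)

lemma eval_1 [simp]: "eval 1 y = 1"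
  using eval_pconst[of 1 y] by simp

lemma eval_uminus [simp]: "eval (- p) y = - eval p y"
  using eval_add[of p "- p" y] by (simp add: add_eq_0_iff)

lemma eval_diff [simp]: "eval (p - q) y = eval p y - eval q y"
  using eval_add[of p "- q" y] by simp

lemma eval_sum [simp]: "eval (\<Sum>i\<in>A. f i) y = (\<Sum>i\<in>A. eval (f i) y)"
  by (induction A rule: infinite_finite_induct) auto

lemma eval_prod [simp]: "eval (\<Prod>i\<in>A. f i) y = (\<Prod>i\<in>A. eval (f i) y)"
  by (induction A rule: infinite_finite_induct) auto

lemma eval_power [simp]: "eval (p ^ n) y = eval p y ^ n"
  by (induction n) auto

lemma eval_of_nat [simp]: "eval (of_nat n) y = of_nat n"
  by (induction n) auto

lemma eval_numeral [simp]: "eval (numeral n) y = numeral n"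
  using eval_of_nat[of "numeral n" y] by simp

lemma eval_linform: "eval (linform a) y = (\<Sum>v\<in>UNIV. a $ v * y $ v)"
  by (simp add: linform_def)

text \<open>A monomial is its coefficient times powers of variables, so these closure properties
  reach every polynomial. Division by a form, directional derivatives and the uniqueness of
  derivations are proved by this induction.\<close>

lemma cpoly_induct [case_names const var add mult]:
  assumes "\<And>c. P (pconst c)" "\<And>v. P (pvar v)" "\<And>p q. P p \<Longrightarrow> P q \<Longrightarrow> P (p + q)" "\<And>p q. P p \<Longrightarrow> P q \<Longrightarrow> P (p * q)"
  shows "P (p :: 'v::finite cpoly)"
proof (induction p rule: cpoly_single_induct)
  case (single k c)
  have pow: "P (pvar v ^ n)" for v n
    using assms(1)[of 1] by (induction n) (auto intro: assms)
  have pr: "P (\<Prod>v\<in>A. pvar v ^ Poly_Mapping.lookup k v)" if "finite A" for A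
    using that assms(1)[of 1] by induction (auto intro: assms pow)
  have e: "(\<Prod>v\<in>A. pvar v ^ Poly_Mapping.lookup k v) =
      Poly_Mapping.single (\<Sum>v\<in>A. Poly_Mapping.single v (Poly_Mapping.lookup k v)) (1 :: complex)" if "finite A" for A
    using that
  proof induction
    case (insert v A)
    have "pvar v ^ n = Poly_Mapping.single (Poly_Mapping.single v n) (1 :: complex)" for n
    proof (induction n)
      case (Suc n)
      show ?case unfolding power_Suc Suc by (simp add: pvar_def mult_single flip: single_add)
    qed simp
    then show ?case using insert by (simp add: mult_single)
  qed simp
  have k: "(\<Sum>v\<in>UNIV. Poly_Mapping.single v (Poly_Mapping.lookup k v)) = k"
    by (rule poly_mapping_eqI) (simp add: lookup_sum lookup_single when_def)
  have "Poly_Mapping.single k c = pconst c * (\<Prod>v\<in>UNIV. pvar v ^ Poly_Mapping.lookup k v)"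
    by (simp add: e k pconst_def mult_single)
  then show ?case
    using pr[of UNIV] by (auto intro: assms)
qed (rule assms)

text \<open>Linear independence of the monomials is Dedekind's independence of characters.\<close>

lemma monomials_independent:
  fixes K :: "('v::finite \<Rightarrow>\<^sub>0 nat) set"
  assumes "finite K"
    and "\<And>y :: complex ^ 'v. (\<Sum>k\<in>K. c k * (\<Prod>v\<in>UNIV. y $ v ^ Poly_Mapping.lookup k v)) = 0" "k \<in> K"
  shows "c k = 0"
  using assms
proof (induction K arbitrary: c k)
  case (insert k0 K)
  define X where "X k y = (\<Prod>v\<in>UNIV. (y :: complex ^ 'v) $ v ^ Poly_Mapping.lookup k v)" for k y
  have X_mult: "X k (\<chi> v. y $ v * u $ v) = X k y * X k u" for k y u
    by (simp add: X_def power_mult_distrib prod.distrib)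
  have s: "c k0 * X k0 y + (\<Sum>k\<in>K. c k * X k y) = 0" for y
    using insert.prems(1)[of y] insert.hyps by (simp add: X_def)
  have c0: "c k = 0" if k: "k \<in> K" for k
  proof -
    obtain w where w: "Poly_Mapping.lookup k w \<noteq> Poly_Mapping.lookup k0 w"
    proof (rule ccontr)
      assume "\<not> thesis"
      with that have "Poly_Mapping.lookup k v = Poly_Mapping.lookup k0 v" for v by blast
      then have "k = k0" by (rule poly_mapping_eqI)
      with k insert.hyps show False by simp
    qed
    \<comment> \<open>Doubling the one coordinate in which \<open>k\<close> and \<open>k0\<close>
      differ separates the two monomials by different powers of 2; subtracting the scaled relation
      then removes \<open>k0\<close>.\<close>
    let ?u = "(\<chi> v. if v = w then 2 else 1) :: complex ^ 'v"
    have Xu: "X k ?u = 2 ^ Poly_Mapping.lookup k w" for k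
    proof -
      have "X k ?u = (\<Prod>v\<in>UNIV. if v = w then 2 ^ Poly_Mapping.lookup k w else 1)"
        unfolding X_def by (rule prod.cong) auto
      then show ?thesis by simp
    qed
    have "(\<Sum>k\<in>K. (c k * (X k ?u - X k0 ?u)) * X k y) = 0" for y
    proof -
      have "(\<Sum>k\<in>K. (c k * (X k ?u - X k0 ?u)) * X k y) =
          (c k0 * X k0 (\<chi> v. y $ v * ?u $ v) + (\<Sum>k\<in>K. c k * X k (\<chi> v. y $ v * ?u $ v)))
          - X k0 ?u * (c k0 * X k0 y + (\<Sum>k\<in>K. c k * X k y))"
        unfolding X_mult distrib_left sum_distrib_left add_diff_eq sum_subtractf[symmetric] right_diff_distrib left_diff_distrib
        by (simp add: mult_ac flip: sum_subtractf)
      then show ?thesis unfolding s by simp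
    qed
    then have "c k * (X k ?u - X k0 ?u) = 0"
      using insert.IH[of "\<lambda>k. c k * (X k ?u - X k0 ?u)" k] k by (simp add: X_def)
    moreover have "X k ?u \<noteq> X k0 ?u"
    proof
      assume "X k ?u = X k0 ?u"
      then have "complex_of_real (2 ^ Poly_Mapping.lookup k w) = complex_of_real (2 ^ Poly_Mapping.lookup k0 w)"
        unfolding Xu by simp
      then have "(2::real) ^ Poly_Mapping.lookup k w = 2 ^ Poly_Mapping.lookup k0 w"
        by (rule of_real_eq_iff[THEN iffD1])
      with w show False by simp
    qed
    ultimately show ?thesis by simp
  qed
  have "c k0 = 0"
    using s[of "\<chi> v. 1"] c0 by (simp add: X_def)
  with c0 insert.prems(2) show ?case by auto
qed simp

lemma eval_eq_0D:
  assumes "\<And>y. eval p y = 0" shows "p = 0"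
proof (rule poly_mapping_eqI)
  fix k
  show "Poly_Mapping.lookup p k = Poly_Mapping.lookup 0 k"
    using monomials_independent[OF finite_keys assms[unfolded eval_def], of k]
    by (cases "k \<in> Poly_Mapping.keys p") (auto simp: in_keys_iff)
qed

lemma eval_eqD: "(\<And>y. eval p y = eval q y) \<Longrightarrow> p = q"
  using eval_eq_0D[of "p - q"] by simp

definition polyfun :: "(complex ^ 'v::finite \<Rightarrow> complex) \<Rightarrow> bool" where
  "polyfun f \<longleftrightarrow> (\<exists>p. f = eval p)"

lemma polyfun_eval [simp]: "polyfun (eval p)"
  by (auto simp: polyfun_def)

lemma polyfun_const [simp]: "polyfun (\<lambda>y. c)"
  unfolding polyfun_def by (rule exI[of _ "pconst c"]) auto

lemma polyfun_var [simp]: "polyfun (\<lambda>y. y $ v)"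
  unfolding polyfun_def by (rule exI[of _ "pvar v"]) auto

lemma polyfun_add [simp]: "polyfun f \<Longrightarrow> polyfun g \<Longrightarrow> polyfun (\<lambda>y. f y + g y)"
  by (auto simp: polyfun_def fun_eq_iff simp flip: eval_add)

lemma polyfun_mult [simp]: "polyfun f \<Longrightarrow> polyfun g \<Longrightarrow> polyfun (\<lambda>y. f y * g y)"
  by (auto simp: polyfun_def fun_eq_iff simp flip: eval_mult)

lemma polyfun_diff [simp]: "polyfun f \<Longrightarrow> polyfun g \<Longrightarrow> polyfun (\<lambda>y. f y - g y)"
  by (auto simp: polyfun_def fun_eq_iff simp flip: eval_diff)

lemma polyfun_sum [simp]: "(\<And>i. i \<in> A \<Longrightarrow> polyfun (f i)) \<Longrightarrow> polyfun (\<lambda>y. \<Sum>i\<in>A. f i y)"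
  by (induction A rule: infinite_finite_induct) auto

lemma polyfun_prod [simp]: "(\<And>i. i \<in> A \<Longrightarrow> polyfun (f i)) \<Longrightarrow> polyfun (\<lambda>y. \<Prod>i\<in>A. f i y)"
  by (induction A rule: infinite_finite_induct) auto

lemma polyfun_power [simp]: "polyfun f \<Longrightarrow> polyfun (\<lambda>y. f y ^ n)"
  by (induction n) auto

lemma polyfun_continuous: "polyfun f \<Longrightarrow> continuous_on UNIV f"
  by (auto simp: polyfun_def eval_def intro!: continuous_intros)

lemma polyfun_isCont: "polyfun f \<Longrightarrow> isCont f y"
  using polyfun_continuous by (auto simp: continuous_on_eq_continuous_at)

text \<open>Takes the place of density arguments: it is enough to leave the bad set along one
  direction \<open>u\<close>, since continuity brings the value back to \<open>y\<close>.\<close>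

lemma polyfun_eq_0_on_line:
  assumes "polyfun f" "\<forall>\<^sub>F s in at_right (0::real). f (y + complex_of_real s *s u) = 0"
  shows "f y = 0"
proof -
  have "((\<lambda>s. y + complex_of_real s *s u) \<longlongrightarrow> y + complex_of_real 0 *s u) (at_right 0)"
    unfolding vector_scalar_mult_def
    by (intro vec_tendstoI) (auto intro!: tendsto_eq_intros)
  then have "((\<lambda>s. f (y + complex_of_real s *s u)) \<longlongrightarrow> f y) (at_right 0)"
    by (intro isCont_tendsto_compose[OF polyfun_isCont[OF assms(1)]]) simp
  moreover have "((\<lambda>s. f (y + complex_of_real s *s u)) \<longlongrightarrow> 0) (at_right 0)"
    using assms(2) by (rule tendsto_eventually)
  ultimately show ?thesis
    using tendsto_unique trivial_limit_at_right_real by blast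
qed

section \<open>Linear forms: cancellation, division and divisibility\<close>

definition dotp :: "complex ^ 'v::finite \<Rightarrow> complex ^ 'v \<Rightarrow> complex" where
  "dotp a y = (\<Sum>v\<in>UNIV. a $ v * y $ v)"

lemma eval_linform_dotp: "eval (linform a) y = dotp a y"
  by (simp add: eval_linform dotp_def)

lemma polyfun_dotp [simp]: "polyfun (dotp a)"
  by (simp add: dotp_def[abs_def])

lemma dotp_add: "dotp a (y + u) = dotp a y + dotp a u"
  by (simp add: dotp_def algebra_simps sum.distrib)

lemma dotp_scale: "dotp a (c *s y) = c * dotp a y"
  by (simp add: dotp_def algebra_simps sum_distrib_left)

text \<open>Linear forms are prime; \<open>V\<close> is a linear subspace, in practice a hyperplane or the whole space.\<close>

lemma linform_cancel_on:
  assumes V: "\<And>y u c. y \<in> V \<Longrightarrow> u \<in> V \<Longrightarrow> y + c *s u \<in> V"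
    and f: "polyfun f" and u: "u \<in> V" "dotp b u \<noteq> 0"
    and z: "\<And>y. y \<in> V \<Longrightarrow> dotp b y * f y = 0" and y: "y \<in> V"
  shows "f y = 0"
proof (cases "dotp b y = 0")
  case True
  have "f (y + complex_of_real s *s u) = 0" if "s > 0" for s
    using z[OF V[OF y u(1), of "complex_of_real s"]] that True u(2) by (auto simp: dotp_add dotp_scale)
  then show ?thesis
    by (intro polyfun_eq_0_on_line[OF f, of y u]) (auto simp: eventually_at_right_less intro: eventually_mono[OF eventually_at_right_less])
qed (use z[OF y] in auto)

lemma prod_linform_cancel_on:
  assumes V: "\<And>y u c. y \<in> V \<Longrightarrow> u \<in> V \<Longrightarrow> y + c *s u \<in> V"
    and "finite I" and f: "polyfun f" and u: "\<And>i. i \<in> I \<Longrightarrow> \<exists>u\<in>V. dotp (b i) u \<noteq> 0"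
    and z: "\<And>y. y \<in> V \<Longrightarrow> (\<Prod>i\<in>I. dotp (b i) y) * f y = 0" and y: "y \<in> V"
  shows "f y = 0"
  using assms(2) f u z y
proof (induction I arbitrary: f y)
  case (insert i I)
  obtain u where u: "u \<in> V" "dotp (b i) u \<noteq> 0" using insert.prems(2)[of i] by auto
  have "(\<Prod>i\<in>I. dotp (b i) y) * f y = 0" if "y \<in> V" for y
  proof (rule linform_cancel_on[OF V _ u _ that, of "\<lambda>y. (\<Prod>i\<in>I. dotp (b i) y) * f y"])
    show "polyfun (\<lambda>y. (\<Prod>i\<in>I. dotp (b i) y) * f y)" using insert.prems(1) by simp
    show "dotp (b i) y * ((\<Prod>i\<in>I. dotp (b i) y) * f y) = 0" if "y \<in> V" for y
      using insert.prems(3)[OF that] insert.hyps by (simp add: mult.assoc)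
  qed
  then show ?case
    using insert.IH[OF insert.prems(1)] insert.prems(2,4) by blast
qed simp

lemma dotp_nonzero: "a \<noteq> 0 \<Longrightarrow> \<exists>u. dotp a u \<noteq> 0"
proof -
  assume "a \<noteq> 0"
  then obtain w where w: "a $ w \<noteq> 0" by (auto simp: vec_eq_iff)
  have "dotp a (\<chi> v. if v = w then 1 else 0) = a $ w"
    by (simp add: dotp_def if_distrib cong: if_cong)
  then show ?thesis using w by metis
qed

lemma hyperplane_closed: "dotp a y = 0 \<Longrightarrow> dotp a u = 0 \<Longrightarrow> dotp a (y + c *s u) = 0"
  by (simp add: dotp_add dotp_scale)

text \<open>Division with remainder in the single variable \<open>w\<close>, whose coefficient in
  the form is a unit. That the remainder is free of \<open>w\<close> is expressed through its
  values, as \<open>linform_dvd_iff\<close> uses it.\<close>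

lemma linform_division:
  assumes w: "a $ w \<noteq> 0"
  shows "\<exists>q r. p = linform a * q + r \<and> (\<forall>y y'. (\<forall>v. v \<noteq> w \<longrightarrow> y $ v = y' $ v) \<longrightarrow> eval r y = eval r y')"
proof (induction p rule: cpoly_induct)
  case (const c)
  show ?case by (rule exI[of _ 0], rule exI[of _ "pconst c"]) auto
next
  case (var v)
  show ?case
  proof (cases "v = w")
    case False
    then show ?thesis by (intro exI[of _ 0] exI[of _ "pvar v"]) auto
  next
    case True
    let ?r = "- pconst (1 / a $ w) * (\<Sum>v\<in>UNIV - {w}. pconst (a $ v) * pvar v)"
    have "linform a = pconst (a $ w) * pvar w + (\<Sum>v\<in>UNIV - {w}. pconst (a $ v) * pvar v)"
      unfolding linform_def by (simp add: sum.remove[of UNIV w])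
    then have "pvar w = linform a * pconst (1 / a $ w) + ?r"
      using w by (intro eval_eqD) (simp add: field_simps)
    moreover have "\<forall>y y'. (\<forall>v. v \<noteq> w \<longrightarrow> y $ v = y' $ v) \<longrightarrow> eval ?r y = eval ?r y'"
      by auto
    ultimately show ?thesis using True by blast
  qed
next
  case (add p p')
  then obtain q r q' r' where *: "p = linform a * q + r" "p' = linform a * q' + r'"
    and r: "\<forall>y y'. (\<forall>v. v \<noteq> w \<longrightarrow> y $ v = y' $ v) \<longrightarrow> eval r y = eval r y'"
      "\<forall>y y'. (\<forall>v. v \<noteq> w \<longrightarrow> y $ v = y' $ v) \<longrightarrow> eval r' y = eval r' y'" by blast
  have "p + p' = linform a * (q + q') + (r + r')" by (simp add: * algebra_simps)
  moreover have "eval (r + r') y = eval (r + r') y'" if "\<forall>v. v \<noteq> w \<longrightarrow> y $ v = y' $ v" for y y'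
    using r(1)[rule_format, of y y'] r(2)[rule_format, of y y'] that by simp
  ultimately show ?case by blast
next
  case (mult p p')
  then obtain q r q' r' where *: "p = linform a * q + r" "p' = linform a * q' + r'"
    and r: "\<forall>y y'. (\<forall>v. v \<noteq> w \<longrightarrow> y $ v = y' $ v) \<longrightarrow> eval r y = eval r y'"
      "\<forall>y y'. (\<forall>v. v \<noteq> w \<longrightarrow> y $ v = y' $ v) \<longrightarrow> eval r' y = eval r' y'" by blast
  have "p * p' = linform a * (linform a * q * q' + q * r' + r * q') + r * r'"
    by (simp add: * algebra_simps)
  moreover have "eval (r * r') y = eval (r * r') y'" if "\<forall>v. v \<noteq> w \<longrightarrow> y $ v = y' $ v" for y y'
    using r(1)[rule_format, of y y'] r(2)[rule_format, of y y'] that by simp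
  ultimately show ?case by blast
qed

lemma linform_dvd_iff:
  assumes "a \<noteq> 0"
  shows "linform a dvd p \<longleftrightarrow> (\<forall>y. dotp a y = 0 \<longrightarrow> eval p y = 0)"
proof
  assume R: "\<forall>y. dotp a y = 0 \<longrightarrow> eval p y = 0"
  obtain w where w: "a $ w \<noteq> 0" using assms by (auto simp: vec_eq_iff)
  obtain q r where p: "p = linform a * q + r"
    and r: "\<And>y y'. (\<forall>v. v \<noteq> w \<longrightarrow> y $ v = y' $ v) \<Longrightarrow> eval r y = eval r y'"
    using linform_division[of a w p] w by blast
  have "eval r y = 0" for y
  proof -
    \<comment> \<open>Changing only the coordinate \<open>w\<close> moves \<open>y\<close> into the
      hyperplane, where \<open>p\<close> vanishes, and leaves the remainder unchanged.\<close>
    define d where "d = (\<chi> v. if v = w then - dotp a y / a $ w else 0)"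
    have "dotp a d = - dotp a y"
      using w by (simp add: d_def dotp_def if_distrib cong: if_cong)
    then have d: "dotp a (y + d) = 0" by (simp add: dotp_add)
    then have "eval p (y + d) = 0" using R by simp
    then have "eval r (y + d) = 0" using d by (simp add: p eval_linform_dotp)
    then show ?thesis using r[of y "y + d"] by (simp add: d_def)
  qed
  then have "r = 0" by (rule eval_eq_0D)
  then show "linform a dvd p" using p by simp
qed (auto simp: eval_linform_dotp elim!: dvdE)

lemma polyfun_linform_factor:
  assumes "a \<noteq> 0" "polyfun f" "\<And>y. dotp a y = 0 \<Longrightarrow> f y = 0"
  obtains q where "polyfun q" "\<And>y. f y = dotp a y * q y"
proof -
  obtain p where p: "f = eval p" using assms(2) by (auto simp: polyfun_def)
  then have "linform a dvd p" using assms linform_dvd_iff by blast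
  then obtain q where "p = linform a * q" by (elim dvdE)
  then show ?thesis using that[of "eval q"] p by (simp add: eval_linform_dotp)
qed

text \<open>Forms are split off one at a time. By the last assumption the earlier forms are not
  identically zero on the hyperplane of the new one, so they can be cancelled there and the earlier
  quotient vanishes on it.\<close>

lemma polyfun_prod_linform_factor:
  assumes "finite I" "polyfun f" "\<And>i. i \<in> I \<Longrightarrow> b i \<noteq> 0"
    and "\<And>i y. i \<in> I \<Longrightarrow> dotp (b i) y = 0 \<Longrightarrow> f y = 0"
    and "\<And>i j. i \<in> I \<Longrightarrow> j \<in> I \<Longrightarrow> i \<noteq> j \<Longrightarrow> \<exists>u. dotp (b i) u = 0 \<and> dotp (b j) u \<noteq> 0"
  shows "\<exists>q. polyfun q \<and> (\<forall>y. f y = (\<Prod>i\<in>I. dotp (b i) y) * q y)"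
  using assms
proof (induction I)
  case empty
  then show ?case by auto
next
  case (insert i I)
  obtain q where q: "polyfun q" "\<And>y. f y = (\<Prod>i\<in>I. dotp (b i) y) * q y"
  proof -
    have "\<exists>q. polyfun q \<and> (\<forall>y. f y = (\<Prod>i\<in>I. dotp (b i) y) * q y)"
      using insert.prems(2-4) by (intro insert.IH[OF insert.prems(1)]) auto
    then show ?thesis using that by blast
  qed
  have "q y = 0" if "dotp (b i) y = 0" for y
  proof (rule prod_linform_cancel_on[of "{y. dotp (b i) y = 0}" I q b])
    show "\<exists>u\<in>{y. dotp (b i) y = 0}. dotp (b j) u \<noteq> 0" if "j \<in> I" for j
      using insert.prems(4)[of i j] insert.hyps that by auto
    show "(\<Prod>i\<in>I. dotp (b i) y) * q y = 0" if "y \<in> {y. dotp (b i) y = 0}" for y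
      using insert.prems(3)[of i y] that q by auto
  qed (use that q insert.hyps hyperplane_closed in auto)
  then obtain q' where "polyfun q'" "\<And>y. q y = dotp (b i) y * q' y"
    using polyfun_linform_factor[of "b i" q] q(1) insert.prems(2)[of i] by blast
  then show ?case using q insert.hyps by (intro exI[of _ q']) (auto simp: mult_ac)
qed

section \<open>Homogeneous polynomial functions and their quotients\<close>

definition homog :: "nat \<Rightarrow> (complex ^ 'v::finite \<Rightarrow> complex) \<Rightarrow> bool" where
  "homog d f \<longleftrightarrow> polyfun f \<and> (\<forall>c y. f (c *s y) = c ^ d * f y)"

lemma homog_polyfun: "homog d f \<Longrightarrow> polyfun f"
  by (simp add: homog_def)

lemma homog_scale: "homog d f \<Longrightarrow> f (c *s y) = c ^ d * f y"
  by (simp add: homog_def)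

lemma homog_zero [simp]: "homog d (\<lambda>y. 0)"
  by (simp add: homog_def)

lemma homog_const [simp]: "homog 0 (\<lambda>y. c)"
  by (simp add: homog_def)

lemma homog_var [simp]: "homog (Suc 0) (\<lambda>y. y $ v)"
  by (simp add: homog_def)

lemma homog_add: "homog d f \<Longrightarrow> homog d g \<Longrightarrow> homog d (\<lambda>y. f y + g y)"
  by (simp add: homog_def distrib_left)

lemma homog_diff: "homog d f \<Longrightarrow> homog d g \<Longrightarrow> homog d (\<lambda>y. f y - g y)"
  by (simp add: homog_def right_diff_distrib)

lemma homog_cmult: "homog d f \<Longrightarrow> homog d (\<lambda>y. c * f y)"
  by (simp add: homog_def)

lemma homog_mult: "homog d f \<Longrightarrow> homog e g \<Longrightarrow> homog (d + e) (\<lambda>y. f y * g y)"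
  by (simp add: homog_def power_add mult_ac)

lemma homog_power: "homog d f \<Longrightarrow> homog (d * n) (\<lambda>y. f y ^ n)"
  by (simp add: homog_def power_mult power_mult_distrib)

lemma homog_prod: "(\<And>i. i \<in> A \<Longrightarrow> homog (d i) (f i)) \<Longrightarrow> homog (\<Sum>i\<in>A. d i) (\<lambda>y. \<Prod>i\<in>A. f i y)"
  by (induction A rule: infinite_finite_induct) (auto intro: homog_mult)

lemma homog_dotp: "homog 1 (dotp a)"
  by (simp add: homog_def dotp_scale)

lemma homog_prod_dotp: "homog (card I) (\<lambda>y. \<Prod>i\<in>I. dotp (b i) y)"
  using homog_prod[of I "\<lambda>_. 1" "\<lambda>i. dotp (b i)"] by (simp add: homog_dotp[unfolded One_nat_def])

text \<open>Away from the zeros of the denominator the quotient is constant along punctured lines through the origin.\<close>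

lemma homog_quotient_const:
  assumes I: "finite I" "\<And>i. i \<in> I \<Longrightarrow> b i \<noteq> 0"
    and f: "homog (card I) f" and q: "polyfun q" "\<And>y. f y = (\<Prod>i\<in>I. dotp (b i) y) * q y"
  shows "q y = q 0"
proof -
  let ?Q = "\<lambda>y. \<Prod>i\<in>I. dotp (b i) y"
  have Q: "homog (card I) ?Q"
    by (rule homog_prod_dotp)
  have "?Q y * (q y - q 0) = 0" for y
  proof (cases "?Q y = 0")
    case False
    have *: "q (complex_of_real s *s y) = q y" if "s > 0" for s
    proof -
      have "?Q (complex_of_real s *s y) * q (complex_of_real s *s y) = complex_of_real s ^ card I * (?Q y * q y)"
        using homog_scale[OF f, of "complex_of_real s" y] q(2) by simp
      then show ?thesis
        unfolding homog_scale[OF Q] using False that by (simp add: mult_ac)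
    qed
    have "q 0 - q y = 0"
    proof (rule polyfun_eq_0_on_line[of "\<lambda>x. q x - q y" 0 y])
      show "\<forall>\<^sub>F s in at_right 0. q (0 + complex_of_real s *s y) - q y = 0"
        using * by (intro eventually_mono[OF eventually_at_right_less]) auto
    qed (use q in simp)
    then show ?thesis by simp
  qed simp
  then have "q y - q 0 = 0"
    using q(1) I by (intro prod_linform_cancel_on[of UNIV I "\<lambda>y. q y - q 0" b y])
      (use dotp_nonzero in auto)
  then show ?thesis by simp
qed

lemma homog_quotient:
  assumes I: "finite I" "\<And>i. i \<in> I \<Longrightarrow> b i \<noteq> 0"
    and f: "homog (d + card I) f" and q: "polyfun q" "\<And>y. f y = (\<Prod>i\<in>I. dotp (b i) y) * q y"
  shows "homog d q"
proof -
  let ?Q = "\<lambda>y. \<Prod>i\<in>I. dotp (b i) y"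
  have Q: "homog (card I) ?Q"
    by (rule homog_prod_dotp)
  have q0: "q (c *s y) = c ^ d * q y" if c: "c \<noteq> 0" for c y
  proof -
    have "?Q y * (q (c *s y) - c ^ d * q y) = 0" for y
    proof -
      have "c ^ card I * (?Q y * q (c *s y)) = c ^ (d + card I) * (?Q y * q y)"
        using homog_scale[OF f, of c y] q(2) homog_scale[OF Q, of c y] by simp
      then show ?thesis using c by (simp add: power_add mult_ac right_diff_distrib)
    qed
    moreover have "polyfun (\<lambda>y. q (c *s y))"
    proof -
      obtain p where "q = eval p" using q by (auto simp: polyfun_def)
      moreover have "polyfun (\<lambda>y. eval p (c *s y))"
        by (simp add: eval_def)
      ultimately show ?thesis by simp
    qed
    ultimately have "q (c *s y) - c ^ d * q y = 0"
      using q(1) I by (intro prod_linform_cancel_on[of UNIV I "\<lambda>y. q (c *s y) - c ^ d * q y" b y])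
        (use dotp_nonzero in auto)
    then show ?thesis by simp
  qed
  \<comment> \<open>Cancellation says nothing about the scalar 0. For \<open>d = 0\<close> the law
    follows by continuity along a ray; for \<open>d > 0\<close>, scaling the origin by 2 forces
    \<open>q 0 = 0\<close>.\<close>
  have "q (0 *s y) = 0 ^ d * q y" for y
  proof (cases "d = 0")
    case True
    have "q 0 - q y = 0"
    proof (rule polyfun_eq_0_on_line[of "\<lambda>x. q x - q y" 0 y])
      show "\<forall>\<^sub>F s in at_right 0. q (0 + complex_of_real s *s y) - q y = 0"
        using q0 True by (intro eventually_mono[OF eventually_at_right_less]) auto
    qed (use q in simp)
    then show ?thesis using True by simp
  next
    case False
    have "q (2 *s 0) = 2 ^ d * q 0" by (rule q0) simp
    then have "q 0 * (2 ^ d - 1) = 0" by (simp add: algebra_simps)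
    moreover have "(2::complex) ^ d \<noteq> 1"
    proof
      assume "(2::complex) ^ d = 1"
      then have "(2::real) ^ d = 1" by (metis of_real_eq_1_iff of_real_numeral of_real_power)
      moreover have "(1::real) < 2 ^ d" using False by (intro one_less_power) auto
      ultimately show False by simp
    qed
    ultimately show ?thesis using False by simp
  qed
  then show ?thesis using q q0 unfolding homog_def by metis
qed

section \<open>Derivations and Saito's criterion\<close>

text \<open>Defining the derivation with given values on the variables through a complex derivative yields the Leibniz rule for free.\<close>

lemma directional_ex:
  fixes c :: "'v::finite \<Rightarrow> 'v cpoly"
  shows "\<exists>q. \<forall>y. ((\<lambda>t. eval p (y + t *s (\<chi> v. eval (c v) y))) has_field_derivative eval q y) (at 0)"
proof (induction p rule: cpoly_induct)
  case (const d)
  show ?case by (rule exI[of _ 0]) simp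
next
  case (var v)
  show ?case by (rule exI[of _ "c v"]) (auto intro!: derivative_eq_intros)
next
  case (add p q)
  then obtain p' q' where *: "\<And>y. ((\<lambda>t. eval p (y + t *s (\<chi> v. eval (c v) y))) has_field_derivative eval p' y) (at 0)"
    "\<And>y. ((\<lambda>t. eval q (y + t *s (\<chi> v. eval (c v) y))) has_field_derivative eval q' y) (at 0)" by blast
  show ?case using DERIV_add[OF *] by (intro exI[of _ "p' + q'"]) simp
next
  case (mult p q)
  then obtain p' q' where *: "\<And>y. ((\<lambda>t. eval p (y + t *s (\<chi> v. eval (c v) y))) has_field_derivative eval p' y) (at 0)"
    "\<And>y. ((\<lambda>t. eval q (y + t *s (\<chi> v. eval (c v) y))) has_field_derivative eval q' y) (at 0)" by blast
  show ?case using DERIV_mult[OF *] by (intro exI[of _ "p' * q + q' * p"]) simp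
qed

definition directional :: "('v::finite \<Rightarrow> 'v cpoly) \<Rightarrow> 'v cpoly \<Rightarrow> 'v cpoly" where
  "directional c p = (SOME q. \<forall>y. ((\<lambda>t. eval p (y + t *s (\<chi> v. eval (c v) y))) has_field_derivative eval q y) (at 0))"

lemma directional:
  "((\<lambda>t. eval p (y + t *s (\<chi> v. eval (c v) y))) has_field_derivative eval (directional c p) y) (at 0)"
  unfolding directional_def using someI_ex[OF directional_ex] by blast

lemma directional_eqI:
  assumes "\<And>y. ((\<lambda>t. eval p (y + t *s (\<chi> v. eval (c v) y))) has_field_derivative eval q y) (at 0)"
  shows "directional c p = q"
  using DERIV_unique[OF directional assms] by (intro eval_eqD) blast

lemma directional_pconst [simp]: "directional c (pconst d) = 0"
  by (rule directional_eqI) simp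

lemma directional_pvar [simp]: "directional c (pvar v) = c v"
  by (rule directional_eqI) (auto intro!: derivative_eq_intros)

lemma directional_add: "directional c (p + q) = directional c p + directional c q"
  using DERIV_add[OF directional[of p _ c] directional[of q _ c]] by (intro directional_eqI) simp

lemma directional_mult: "directional c (p * q) = directional c p * q + p * directional c q"
  using DERIV_mult[OF directional[of p _ c] directional[of q _ c]] by (intro directional_eqI) (simp add: mult_ac)

lemma derivation_directional: "derivation (directional c)"
  by (auto simp: derivation_def directional_add directional_mult)

lemma derivationD:
  assumes "derivation L"
  shows "L (p + q) = L p + L q" "L (pconst c * p) = pconst c * L p" "L (p * q) = L p * q + p * L q"
  using assms unfolding derivation_def by blast+

lemma derivation_pconst:
  assumes "derivation L" shows "L (pconst c) = 0"
proof -
  have "L 1 = 0" using derivationD(3)[OF assms, of 1 1] by simp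
  then show ?thesis using derivationD(2)[OF assms, of c 1] by simp
qed

lemma derivation_eqI:
  fixes L M :: "'v::finite cpoly \<Rightarrow> 'v cpoly"
  assumes "derivation L" "derivation M" "\<And>v. L (pvar v) = M (pvar v)"
  shows "L = M"
proof
  fix p show "L p = M p"
    by (induction p rule: cpoly_induct)
       (simp_all add: derivation_pconst assms derivationD[OF assms(1)] derivationD[OF assms(2)])
qed

lemma derivation_linform:
  fixes L :: "'v::finite cpoly \<Rightarrow> 'v cpoly"
  assumes "derivation L"
  shows "L (linform a) = (\<Sum>v\<in>UNIV. pconst (a $ v) * L (pvar v))"
proof -
  have "L (\<Sum>v\<in>A. pconst (a $ v) * pvar v) = (\<Sum>v\<in>A. pconst (a $ v) * L (pvar v))" for A
  proof (induction A rule: infinite_finite_induct)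
    case (infinite A)
    then show ?case using derivation_pconst[OF assms, of 0] by simp
  next
    case empty
    then show ?case using derivation_pconst[OF assms, of 0] by simp
  next
    case (insert x F)
    then show ?case by (simp add: derivationD(1,2)[OF assms])
  qed
  then show ?thesis by (simp add: linform_def)
qed

lemma derivation_0: "derivation 0"
  by (simp add: derivation_def)

lemma derivation_sum: "(\<And>i. i \<in> A \<Longrightarrow> derivation (F i)) \<Longrightarrow> derivation (\<Sum>i\<in>A. F i)"
  by (induction A rule: infinite_finite_induct) (auto simp: derivation_0 intro: derivation_plus)

lemma sum_apply: "(\<Sum>i\<in>A. F i) x = (\<Sum>i\<in>A. (F i x :: 'b :: comm_monoid_add))"
  by (induction A rule: infinite_finite_induct) auto

text \<open>\<open>free_arrangement\<close> speaks of a set, so repetitions in the family have to be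
  excluded: two equal members would give a relation with coefficients 1 and - 1.\<close>

lemma module_independent_range:
  assumes "\<And>w o'. (\<Sum>i\<in>UNIV. pscale (w i) (th i)) = 0 \<Longrightarrow> w o' = 0"
  shows "pmod.independent (range (th :: 'o::finite \<Rightarrow> 'v cpoly \<Rightarrow> 'v cpoly))"
proof -
  have inj: "inj th"
  proof (rule injI, rule ccontr)
    fix x x' assume e: "th x = th x'" "x \<noteq> x'"
    let ?w = "\<lambda>i. if i = x then 1 else if i = x' then - 1 else (0 :: 'v cpoly)"
    have "(\<Sum>i\<in>UNIV. pscale (?w i) (th i)) = (\<Sum>i\<in>{x, x'}. pscale (?w i) (th i))"
      by (rule sum.mono_neutral_right) (auto simp: pscale_def)
    also have "\<dots> = 0" using e by (auto simp: pscale_def fun_eq_iff)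
    finally have "?w x = 0" by (rule assms)
    then show False by simp
  qed
  show ?thesis
    unfolding pmod.independent_explicit_module
  proof (intro allI impI)
    fix t u L assume t: "finite t" "t \<subseteq> range th" "(\<Sum>v\<in>t. pscale (u v) v) = 0" "L \<in> t"
    then obtain x where x: "L = th x" by auto
    let ?w = "\<lambda>i. if th i \<in> t then u (th i) else 0"
    have "(\<Sum>i\<in>UNIV. pscale (?w i) (th i)) = (\<Sum>i\<in>th -` t. pscale (u (th i)) (th i))"
      by (rule sum.mono_neutral_cong_right) (auto simp: pscale_def)
    also have "\<dots> = (\<Sum>v\<in>t. pscale (u v) v)"
      using inj t(2) by (intro sum.reindex_bij_betw bij_betwI') (auto simp: inj_eq)
    finally have "?w x = 0" using t(3) by (intro assms) simp
    then show "u L = 0" using x t(4) by simp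
  qed
qed

section \<open>Saito's criterion, with the coning variable split off\<close>

lemma polyfun_det:
  assumes "\<And>l k. polyfun (R l k)"
  shows "polyfun (\<lambda>y. det (\<chi> l k. R l k y))"
  unfolding det_def using assms by simp

lemma sum_option:
  fixes f :: "('n::finite) option \<Rightarrow> 'c::comm_monoid_add"
  shows "(\<Sum>v\<in>UNIV. f v) = f None + (\<Sum>k\<in>UNIV. f (Some k))"
  by (simp add: UNIV_option_conv sum.reindex o_def)

text \<open>The logarithmic condition for a derivation with components \<open>f k\<close> at the
  variables \<open>Some k\<close> and component 0 at the coning variable.\<close>

definition tangent :: "'i set \<Rightarrow> ('i \<Rightarrow> complex ^ 'n option) \<Rightarrow> ('n::finite \<Rightarrow> complex ^ 'n option \<Rightarrow> complex) \<Rightarrow> bool" where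
  "tangent I b f \<longleftrightarrow> (\<forall>i\<in>I. \<forall>y. dotp (b i) y = 0 \<longrightarrow> (\<Sum>k\<in>UNIV. b i $ Some k * f k y) = 0)"

context
  fixes I :: "'i set" and b :: "'i \<Rightarrow> complex ^ ('n::finite) option"
  assumes fin: "finite I"
    and bnz: "\<And>i. i \<in> I \<Longrightarrow> \<exists>k. b i $ Some k \<noteq> 0"
    and indep: "\<And>i j. i \<in> I \<Longrightarrow> j \<in> I \<Longrightarrow> i \<noteq> j \<Longrightarrow> \<exists>u. dotp (b i) u = 0 \<and> dotp (b j) u \<noteq> 0"
begin

lemma b_nonzero: "i \<in> I \<Longrightarrow> b i \<noteq> 0"
  using bnz by force

text \<open>On the hyperplane of \<open>b i\<close>, tangency of all rows puts the nonzero vector of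
  \<open>Some\<close> coefficients of \<open>b i\<close> into the kernel of the matrix, so the
  determinant vanishes there. Pairwise independence of the forms gives divisibility by their
  product.\<close>

lemma det_tangent_factor:
  assumes R: "\<And>l k. polyfun (R l k)" "\<And>l. tangent I b (R l)"
  shows "\<exists>q. polyfun q \<and> (\<forall>y. det (\<chi> l k. R l k y) = (\<Prod>i\<in>I. dotp (b i) y) * q y)"
proof (rule polyfun_prod_linform_factor[OF fin polyfun_det[OF R(1)] b_nonzero _ indep])
  fix i y assume i: "i \<in> I" and y: "dotp (b i) y = 0"
  let ?A = "(\<chi> l k. R l k y) :: complex ^ 'n ^ 'n" and ?u = "(\<chi> k. b i $ Some k) :: complex ^ 'n"
  have "?A *v ?u = 0"
    using R(2) i y by (simp add: tangent_def matrix_vector_mult_def vec_eq_iff mult.commute)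
  moreover have "?u \<noteq> 0" using bnz[OF i] by (auto simp: vec_eq_iff)
  ultimately have "\<not> invertible ?A"
    using matrix_left_invertible_ker[of ?A] by (auto simp: invertible_def)
  then show "det ?A = 0" using invertible_det_nz[of ?A] by blast
qed auto

text \<open>The basis consists of the Euler derivation and the rows \<open>E l\<close>, which
  annihilate the coning variable; this leaves a square determinant in the other variables. By its
  degree it is a constant times the product of the forms, and its value at \<open>y0\<close> shows
  that the constant is not 0.\<close>

theorem saito:
  assumes log: "\<And>L. L \<in> log_derivations A \<longleftrightarrow> derivation L \<and> pvar None dvd L (pvar None) \<and>
      (\<forall>i\<in>I. linform (b i) dvd L (linform (b i)))"
    and E: "\<And>l k. homog (d l) (E l k)" "\<And>l. tangent I b (E l)"
    and deg: "(\<Sum>l\<in>UNIV. d l) = card I"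
    and nondeg: "det (\<chi> l k. E l k y0) \<noteq> 0"
  shows "free_arrangement A"
proof -
  have "\<forall>l k. \<exists>p. E l k = eval p"
    using E(1) by (auto simp: homog_def polyfun_def)
  then obtain p where p: "\<And>l k. E l k = eval (p l k)" by metis
  define th where "th v = (case v of None \<Rightarrow> directional pvar
     | Some l \<Rightarrow> directional (\<lambda>v. case v of None \<Rightarrow> 0 | Some k \<Rightarrow> p l k))" for v
  let ?Q = "\<lambda>y. \<Prod>i\<in>I. dotp (b i) y"
  let ?M = "\<lambda>y. (\<chi> l k. E l k y) :: complex ^ 'n ^ 'n"
  have th_der: "derivation (th v)" for v
    by (simp add: th_def derivation_directional split: option.split)
  obtain c where c: "\<And>y. det (?M y) = ?Q y * c" and c0: "c \<noteq> 0"
  proof -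
    obtain q where q: "polyfun q" "\<And>y. det (?M y) = ?Q y * q y"
      using det_tangent_factor[of E] E homog_polyfun by blast
    have "homog (card I) (\<lambda>y. det (?M y))"
      unfolding homog_def
    proof (intro conjI allI polyfun_det)
      fix c y
      have "?M (c *s y) = (\<chi> l. c ^ d l *s (\<chi> k. E l k y))"
        using homog_scale[OF E(1)] by (simp add: vec_eq_iff)
      then have "det (?M (c *s y)) = (\<Prod>l\<in>UNIV. c ^ d l) * det (?M y)"
        by (simp add: det_rows_mul)
      then show "det (?M (c *s y)) = c ^ card I * det (?M y)"
        by (simp add: deg flip: power_sum)
    qed (use homog_polyfun[OF E(1)] in auto)
    then have qc: "q y = q 0" for y
      using q by (intro homog_quotient_const[OF fin b_nonzero]) auto
    show ?thesis
    proof (rule that[of "q 0"])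
      show "det (?M y) = ?Q y * q 0" for y
        using q(2)[of y] qc[of y] by simp
      then show "q 0 \<noteq> 0"
        using nondeg by auto
    qed
  qed
  have cancel: "f y = 0" if "polyfun f" "\<And>y. ?Q y * f y = 0" for f y
    using that by (intro prod_linform_cancel_on[of UNIV I f b y]) (use fin b_nonzero dotp_nonzero in auto)
  have th_log: "th v \<in> log_derivations A" for v
  proof (cases v)
    case None
    have "directional pvar (linform a) = linform a" for a :: "complex ^ 'n option"
      by (simp add: derivation_linform[OF derivation_directional]) (simp add: linform_def)
    then show ?thesis
      unfolding log using th_der[of v] None by (simp add: th_def)
  next
    case (Some l)
    have "linform (b i) dvd th v (linform (b i))" if i: "i \<in> I" for i
      unfolding linform_dvd_iff[OF b_nonzero[OF i]]
      using E(2)[of l] i Some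
      by (simp add: derivation_linform[OF th_der] sum_option tangent_def p)
         (simp add: th_def)
    then show ?thesis
      unfolding log using th_der[of v] Some by (simp add: th_def)
  qed
  have ind: "pmod.independent (range th)"
  proof (rule module_independent_range)
    fix w o' assume s: "(\<Sum>v\<in>UNIV. pscale (w v) (th v)) = 0"
    have s': "(\<Sum>v\<in>UNIV. w v * th v f) = 0" for f
      using fun_cong[OF s, of f] by (simp add: sum_apply pscale_def)
    have "w None * pvar None = 0"
      using s'[of "pvar None"] by (simp add: sum_option th_def)
    then have "eval (w None) y * y $ None = 0" for y
      by (metis eval_0 eval_mult eval_pvar)
    moreover have "dotp (\<chi> v. if v = None then 1 else 0) y = y $ None" for y :: "complex ^ 'n option"
      by (simp add: dotp_def sum_option)
    ultimately have "eval (w None) y = 0" for y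
      by (intro linform_cancel_on[of UNIV "eval (w None)" "\<chi> v. 1" "\<chi> v. if v = None then 1 else 0" y])
         auto
    then have wN: "w None = 0" by (rule eval_eq_0D)
    \<comment> \<open>Linear algebra is done only at points where the determinant is nonzero;
      \<open>cancel\<close> covers the others.\<close>
    have "w (Some l) = 0" for l
    proof (rule eval_eq_0D, rule cancel)
      fix y
      show "?Q y * eval (w (Some l)) y = 0"
      proof (cases "?Q y = 0")
        case False
        then have "invertible (?M y)"
          using c c0 invertible_det_nz[of "?M y"] by simp
        then have inv: "\<And>x. x v* ?M y = 0 \<Longrightarrow> x = 0"
          by (metis invertible_def vector_matrix_mul_rid vector_matrix_mult_0 vector_matrix_mul_assoc)
        have "(\<Sum>l\<in>UNIV. eval (w (Some l)) y * E l k y) = 0" for k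
        proof -
          have "eval (\<Sum>v\<in>UNIV. w v * th v (pvar (Some k))) y = 0"
            unfolding s' by simp
          then show ?thesis by (simp add: sum_option wN th_def p)
        qed
        then have "(\<chi> l. eval (w (Some l)) y) v* ?M y = 0"
          by (simp add: vector_matrix_mult_def vec_eq_iff mult.commute)
        then have "(\<chi> l. eval (w (Some l)) y) = (0 :: complex ^ 'n)" by (rule inv)
        then show ?thesis by (simp add: vec_eq_iff)
      qed simp
    qed simp
    with wN show "w o' = 0" by (cases o') auto
  qed
  have span: "L \<in> pmod.span (range th)" if L: "L \<in> log_derivations A" for L
  proof -
    have dL: "derivation L" using L log by blast
    obtain u where u: "L (pvar None) = pvar None * u"
      using L log by (auto elim: dvdE)
    \<comment> \<open>Subtracting \<open>u\<close> times the Euler derivation kills the component at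
      the coning variable. Tangency survives because the Euler derivation maps each linear form to
      itself.\<close>
    define v where "v k = L (pvar (Some k)) - u * pvar (Some k)" for k
    have tv: "tangent I b (\<lambda>k. eval (v k))"
      unfolding tangent_def
    proof (intro ballI allI impI)
      fix i y assume i: "i \<in> I" and y: "dotp (b i) y = 0"
      have "eval (L (linform (b i))) y = 0"
        using L i y log linform_dvd_iff[OF b_nonzero[OF i]] by blast
      then have "b i $ None * (y $ None * eval u y) + (\<Sum>k\<in>UNIV. b i $ Some k * eval (L (pvar (Some k))) y) = 0"
        by (simp add: derivation_linform[OF dL] sum_option u)
      moreover have "b i $ None * y $ None + (\<Sum>k\<in>UNIV. b i $ Some k * y $ Some k) = 0"
        using y by (simp add: dotp_def sum_option)
      then have "eval u y * (b i $ None * y $ None) + eval u y * (\<Sum>k\<in>UNIV. b i $ Some k * y $ Some k) = 0"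
        by (metis distrib_left mult_zero_right)
      ultimately show "(\<Sum>k\<in>UNIV. b i $ Some k * eval (v k) y) = 0"
        by (simp add: v_def right_diff_distrib sum_subtractf sum_distrib_left mult_ac)
           (metis (no_types, lifting) add_left_cancel)
    qed
    \<comment> \<open>Matrices of Cramer's rule: row \<open>j\<close> is replaced by
      \<open>v\<close>. All rows are still tangent, so each numerator is divisible by the product of
      the forms, and up to the constant \<open>c\<close> the quotients are the wanted polynomial
      coefficients.\<close>
    define R where "R j l = (if l = j then (\<lambda>k. eval (v k)) else E l)" for j l
    have "\<forall>j. \<exists>q. polyfun q \<and> (\<forall>y. det (\<chi> l k. R j l k y) = ?Q y * q y)"
    proof
      fix j
      have "tangent I b (R j l)" for l
        using tv E(2) by (cases "l = j") (simp_all add: R_def)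
      moreover have "polyfun (R j l k)" for l k
        using homog_polyfun[OF E(1)] by (simp add: R_def)
      ultimately show "\<exists>q. polyfun q \<and> (\<forall>y. det (\<chi> l k. R j l k y) = ?Q y * q y)"
        by (intro det_tangent_factor)
    qed
    then obtain q where q: "\<And>j. polyfun (q j)" "\<And>j y. det (\<chi> l k. R j l k y) = ?Q y * q j y"
      by metis
    then have "\<forall>j. \<exists>h. q j = eval h" by (simp add: polyfun_def)
    then obtain h where h: "\<And>j. q j = eval (h j)" by metis
    have v_eq: "v k = (\<Sum>l\<in>UNIV. pconst (1 / c) * h l * p l k)" for k
    proof -
      have "eval (v k) y - (\<Sum>l\<in>UNIV. q l y / c * E l k y) = 0" for y
      proof (rule cancel)
        fix y
        show "?Q y * (eval (v k) y - (\<Sum>l\<in>UNIV. q l y / c * E l k y)) = 0"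
        proof (cases "?Q y = 0")
          case False
          then have "invertible (?M y)"
            using c c0 invertible_det_nz[of "?M y"] by simp
          then obtain B where B: "B ** ?M y = mat 1" by (auto simp: invertible_def)
          define x where "x = (\<chi> k. eval (v k) y) v* B"
          have x: "(\<Sum>l\<in>UNIV. x $ l *s row l (?M y)) = (\<chi> k. eval (v k) y)"
          proof -
            have "x v* ?M y = (\<chi> k. eval (v k) y)"
              by (simp add: x_def vector_matrix_mul_assoc B)
            then show ?thesis
              by (simp add: vector_matrix_mult_def vec_eq_iff row_def mult.commute)
          qed
          have "x $ l * det (?M y) = ?Q y * q l y" for l
          proof -
            have "(\<chi> i. if i = l then \<Sum>l\<in>UNIV. x $ l *s row l (?M y) else row i (?M y)) = (\<chi> i k. R l i k y)"
              unfolding x by (simp add: vec_eq_iff R_def row_def)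
            then show ?thesis
              using cramer_lemma_transpose[of l x "?M y"] q(2)[of l y] by simp
          qed
          then have "x $ l = q l y / c" for l
            using c c0 False by (simp add: field_simps)
          moreover have "eval (v k) y = (\<Sum>l\<in>UNIV. x $ l * E l k y)"
            using arg_cong[OF x, of "\<lambda>w. w $ k"] by (simp add: row_def)
          ultimately show ?thesis by simp
        qed simp
      qed (use q homog_polyfun[OF E(1)] in \<open>simp add: divide_inverse\<close>)
      then show ?thesis
        by (intro eval_eqD) (simp add: p h)
    qed
    have "L = pscale u (th None) + (\<Sum>l\<in>UNIV. pscale (pconst (1 / c) * h l) (th (Some l)))" (is "L = ?S")
    proof (rule derivation_eqI[OF dL])
      show "derivation ?S"
        by (intro derivation_plus derivation_sum derivation_pscale th_der)
      show "L (pvar w) = ?S (pvar w)" for w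
      proof (cases w)
        case None
        then show ?thesis by (simp add: sum_apply pscale_def th_def u mult.commute)
      next
        case (Some k)
        have "L (pvar (Some k)) = u * pvar (Some k) + v k" by (simp add: v_def)
        then show ?thesis using Some by (simp add: sum_apply pscale_def th_def v_eq mult_ac)
      qed
    qed
    also have "?S \<in> pmod.span (range th)"
      by (intro pmod.span_add pmod.span_sum pmod.span_scale pmod.span_base) auto
    finally show ?thesis .
  qed
  have "pmod.span (range th) = log_derivations A"
    using th_log span pmod.span_minimal[OF _ subspace_log_derivations, of "range th" A] by blast
  with ind show ?thesis
    unfolding free_arrangement_def by blast
qed

end

section \<open>Even polynomial families and rational functions of one variable\<close>

text \<open>The polynomial \<open>\<Phi> y\<close> is in the variable \<open>t\<^sup>2\<close>: \<open>even_form n \<Phi>\<close> says that \<open>poly (\<Phi> y) (t\<^sup>2)\<close> is a form of degree \<open>2 * n\<close>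
  in \<open>t\<close> and \<open>y\<close> together. The two clauses are Horner's scheme.\<close>

inductive even_form :: "nat \<Rightarrow> (complex ^ 'v::finite \<Rightarrow> complex poly) \<Rightarrow> bool" where
  even_form_const: "homog (2 * n) a \<Longrightarrow> even_form n (\<lambda>y. [:a y:])"
| even_form_pCons: "even_form n \<Phi> \<Longrightarrow> homog (2 * Suc n) a \<Longrightarrow> even_form (Suc n) (\<lambda>y. pCons (a y) (\<Phi> y))"

lemma homog_cong_deg: "homog d f \<Longrightarrow> d = e \<Longrightarrow> homog e f"
  by simp

lemma even_form_zero: "even_form n (\<lambda>y. 0)"
  using even_form_const[of n "\<lambda>y. 0"] by simp

lemma even_form_shift: "even_form n \<Phi> \<Longrightarrow> even_form (Suc n) (\<lambda>y. pCons 0 (\<Phi> y))"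
  by (rule even_form_pCons) auto

lemma even_form_add: "even_form n \<Phi> \<Longrightarrow> even_form n \<Psi> \<Longrightarrow> even_form n (\<lambda>y. \<Phi> y + \<Psi> y)"
proof (induction n \<Phi> arbitrary: \<Psi> rule: even_form.induct)
  case (even_form_const n a)
  from even_form_const(2,1) show ?case
  proof cases
    case (even_form_const b)
    then show ?thesis using even_form.even_form_const[OF homog_add, of n a b] \<open>homog (2 * n) a\<close> by simp
  next
    case (even_form_pCons n' \<Psi>' b)
    then show ?thesis using even_form.even_form_pCons[OF _ homog_add, of n' \<Psi>' a b] \<open>homog (2 * n) a\<close> by simp
  qed
next
  case (even_form_pCons n \<Phi> a)
  from even_form_pCons(4) show ?case
  proof cases
    case (even_form_const b)
    then show ?thesis using even_form.even_form_pCons[OF _ homog_add, of n \<Phi> a b] even_form_pCons(1,2) by simp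
  next
    case (even_form_pCons \<Psi>' b)
    then show ?thesis
      using even_form.even_form_pCons[OF _ homog_add, of n "\<lambda>y. \<Phi> y + \<Psi>' y" a b] even_form_pCons.IH \<open>homog (2 * Suc n) a\<close> by simp
  qed
qed

lemma even_form_sum: "(\<And>i. i \<in> A \<Longrightarrow> even_form n (\<Phi> i)) \<Longrightarrow> even_form n (\<lambda>y. \<Sum>i\<in>A. \<Phi> i y)"
  by (induction A rule: infinite_finite_induct) (auto simp: even_form_zero intro: even_form_add)

lemma even_form_smult: "even_form n \<Phi> \<Longrightarrow> homog (2 * k) a \<Longrightarrow> even_form (n + k) (\<lambda>y. smult (a y) (\<Phi> y))"
proof (induction n \<Phi> rule: even_form.induct)
  case (even_form_const n b)
  have "homog (2 * (n + k)) (\<lambda>y. a y * b y)"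
    by (rule homog_cong_deg[OF homog_mult[OF even_form_const(2,1)]]) simp
  then show ?case by (simp add: even_form.even_form_const)
next
  case (even_form_pCons n \<Phi> b)
  have "homog (2 * Suc (n + k)) (\<lambda>y. a y * b y)"
    by (rule homog_cong_deg[OF homog_mult[OF even_form_pCons(4,2)]]) simp
  then show ?case using even_form.even_form_pCons[OF even_form_pCons.IH[OF even_form_pCons(4)]] by simp
qed

lemma even_form_cmult: "even_form n \<Phi> \<Longrightarrow> even_form n (\<lambda>y. smult c (\<Phi> y))"
  using even_form_smult[of n \<Phi> 0 "\<lambda>y. c"] by simp

lemma even_form_mult: "even_form n \<Phi> \<Longrightarrow> even_form k \<Psi> \<Longrightarrow> even_form (n + k) (\<lambda>y. \<Phi> y * \<Psi> y)"
proof (induction n \<Phi> rule: even_form.induct)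
  case (even_form_const n a)
  then show ?case using even_form_smult[of k \<Psi> n a] by (simp add: add.commute)
next
  case (even_form_pCons n \<Phi> a)
  have "even_form (k + Suc n) (\<lambda>y. smult (a y) (\<Psi> y))" "even_form (Suc (n + k)) (\<lambda>y. pCons 0 (\<Phi> y * \<Psi> y))"
    by (rule even_form_smult[OF even_form_pCons(4,2)], rule even_form_shift[OF even_form_pCons.IH[OF even_form_pCons(4)]])
  then show ?case
    using even_form_add[of "Suc n + k" "\<lambda>y. smult (a y) (\<Psi> y)" "\<lambda>y. pCons 0 (\<Phi> y * \<Psi> y)"]
    by (simp add: mult_pCons_left add.commute)
qed

lemma even_form_monom: "i \<le> n \<Longrightarrow> homog (2 * (n - i)) a \<Longrightarrow> even_form n (\<lambda>y. monom (a y) i)"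
proof (induction i arbitrary: n)
  case 0
  then show ?case using even_form_const by (simp add: monom_0)
next
  case (Suc i)
  then obtain n' where "n = Suc n'" by (auto dest: Suc_le_D)
  then show ?case using Suc even_form_shift[of n' "\<lambda>y. monom (a y) i"] by (simp add: monom_Suc)
qed

lemma even_form_degree: "even_form n \<Phi> \<Longrightarrow> degree (\<Phi> y) \<le> n"
  by (induction rule: even_form.induct) (auto simp: degree_pCons_le intro: order_trans[OF degree_pCons_le])

lemma even_form_coeff: "even_form n \<Phi> \<Longrightarrow> k \<le> n \<Longrightarrow> homog (2 * (n - k)) (\<lambda>y. coeff (\<Phi> y) k)"
proof (induction n \<Phi> arbitrary: k rule: even_form.induct)
  case (even_form_const n a)
  then show ?case by (cases k) auto
next
  case (even_form_pCons n \<Phi> a)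
  then show ?case by (cases k) (auto simp: coeff_pCons)
qed

lemma even_form_poly: "even_form n \<Phi> \<Longrightarrow> homog 2 c \<Longrightarrow> homog (2 * n) (\<lambda>y. poly (\<Phi> y) (c y))"
proof (induction n \<Phi> rule: even_form.induct)
  case (even_form_pCons n \<Phi> a)
  have "homog (2 * Suc n) (\<lambda>y. c y * poly (\<Phi> y) (c y))"
    by (rule homog_cong_deg[OF homog_mult[OF even_form_pCons(4) even_form_pCons.IH[OF even_form_pCons(4)]]]) simp
  then show ?case using homog_add[OF even_form_pCons(2)] by simp
qed simp

text \<open>Horner's scheme keeps track of the degree. With \<open>c\<close> the square of s z, this
  quotient is what is left when a factor t^2 - s^2 z^2 is moved into the weight.\<close>

lemma even_form_synthetic_div: "even_form (Suc n) \<Phi> \<Longrightarrow> homog 2 c \<Longrightarrow> even_form n (\<lambda>y. synthetic_div (\<Phi> y) (c y))"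
proof (induction n arbitrary: \<Phi>)
  case 0
  from 0(1) show ?case
  proof cases
    case (even_form_pCons \<Psi> a)
    from even_form_pCons(2) show ?thesis
      by cases (use even_form_pCons even_form.even_form_const in \<open>auto simp: even_form_zero\<close>)
  qed (simp add: even_form_zero)
next
  case (Suc n)
  from Suc.prems(1) show ?case
  proof cases
    case (even_form_pCons \<Psi> a)
    have "homog (2 * Suc n) (\<lambda>y. poly (\<Psi> y) (c y))" by (rule even_form_poly[OF even_form_pCons(2) Suc.prems(2)])
    then show ?thesis
      using even_form.even_form_pCons[OF Suc.IH[OF even_form_pCons(2) Suc.prems(2)]] even_form_pCons(1) by simp
  qed (simp add: even_form_zero)
qed

lemma even_form_0_synthetic_div: "even_form 0 \<Phi> \<Longrightarrow> synthetic_div (\<Phi> y) c = 0"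
  using even_form_degree[of 0 \<Phi> y] by (simp add: synthetic_div_eq_0_iff)

section \<open>Division in one variable and central antidifferences\<close>

lemma poly_synthetic_div: "poly p x = poly p c + (x - c) * poly (synthetic_div p c) (x :: complex)"
  using arg_cong[OF synthetic_div_correct'[of c p], of "\<lambda>q. poly q x"] by (simp add: algebra_simps)

text \<open>The central difference of t^(n+1) has leading term (n+1) t^n, so leading terms can be
  removed one by one. Bounding coefficients instead of the degree lets \<open>n = 0\<close> mean the
  zero polynomial.\<close>

lemma central_antidifference:
  fixes p :: "complex poly"
  assumes "\<And>k. k \<ge> n \<Longrightarrow> coeff p k = 0"
  shows "\<exists>q. (\<forall>k>n. coeff q k = 0) \<and> (\<forall>t. poly q (t + 1/2) - poly q (t - 1/2) = poly p t)"
  using assms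
proof (induction n arbitrary: p)
  case 0
  then have "p = 0" by (simp add: poly_eq_iff)
  then show ?case by (intro exI[of _ 0]) simp
next
  case (Suc n)
  define B where "B = [:1/2, 1:] ^ Suc n - [:-1/2, 1 :: complex:] ^ Suc n"
  have B: "coeff B k = of_nat (Suc n choose k) * ((1/2) ^ (Suc n - k) - (-1/2) ^ (Suc n - k))" if "k \<le> Suc n" for k
    using that coeff_linear_poly_power[of k "Suc n" "1/2" "1::complex"] coeff_linear_poly_power[of k "Suc n" "-1/2" "1::complex"]
    by (simp add: B_def right_diff_distrib del: power_Suc)
  have B0: "coeff B k = 0" if "k > Suc n" for k
  proof -
    have "degree ([:a, 1 :: complex:] ^ Suc n) < k" for a
      using that by (simp add: degree_power_eq del: power_Suc)
    then show ?thesis unfolding B_def coeff_diff by (simp add: coeff_eq_0 del: power_Suc)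
  qed
  define c where "c = coeff p n / of_nat (Suc n)"
  have "coeff (p - smult c B) k = 0" if k: "k \<ge> n" for k
  proof -
    consider "k = n" | "k = Suc n" | "k > Suc n" using k by linarith
    then show ?thesis
    proof cases
      case 1
      then show ?thesis using B[of n] by (simp add: c_def del: of_nat_Suc)
    next
      case 2
      then show ?thesis using B[of "Suc n"] Suc.prems[of k] by simp
    next
      case 3
      then show ?thesis using B0[of k] Suc.prems[of k] by simp
    qed
  qed
  from Suc.IH[OF this] obtain q where q: "\<And>k. k > n \<Longrightarrow> coeff q k = 0"
    "\<And>t. poly q (t + 1/2) - poly q (t - 1/2) = poly (p - smult c B) t" by blast
  have "poly (q + smult c (monom 1 (Suc n))) (t + 1/2) - poly (q + smult c (monom 1 (Suc n))) (t - 1/2) = poly p t" for t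
  proof -
    have "poly B t = (t + 1/2) ^ Suc n - (t - 1/2) ^ Suc n"
      by (simp add: B_def poly_power add.commute del: power_Suc)
    moreover have "poly (q + smult c (monom 1 (Suc n))) (t + 1/2) - poly (q + smult c (monom 1 (Suc n))) (t - 1/2)
      = (poly q (t + 1/2) - poly q (t - 1/2)) + c * ((t + 1/2) ^ Suc n - (t - 1/2) ^ Suc n)"
      by (simp add: poly_monom right_diff_distrib del: power_Suc)
    ultimately show ?thesis unfolding q(2) by simp
  qed
  moreover have "coeff (q + smult c (monom 1 (Suc n))) k = 0" if "k > Suc n" for k
    using that q(1)[of k] by simp
  ultimately show ?case by blast
qed

lemma odd_part_sum:
  "(\<Sum>j\<le>2 * k + 1. c j * (t ^ j - (- t) ^ j) / 2) = (\<Sum>i\<le>k. c (2 * i + 1) * (t :: complex) ^ (2 * i + 1))"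
  by (induction k) (auto simp: algebra_simps)

text \<open>The right side is even, so with q(t) also - q(- t) is an antidifference; the average of
  the two is the odd part of q.\<close>

lemma odd_antidifference_monomial:
  "\<exists>\<beta>. \<forall>t :: complex. (\<Sum>i\<le>k. \<beta> i * (t + 1/2) ^ (2 * i + 1)) - (\<Sum>i\<le>k. \<beta> i * (t - 1/2) ^ (2 * i + 1)) = t ^ (2 * k)"
proof -
  have "\<exists>q. (\<forall>j>2 * k + 1. coeff q j = 0) \<and> (\<forall>t. poly q (t + 1/2) - poly q (t - 1/2) = poly (monom (1 :: complex) (2 * k)) t)"
    by (rule central_antidifference) simp
  then obtain q where q: "\<And>j. j > 2 * k + 1 \<Longrightarrow> coeff q j = (0 :: complex)"
    "\<And>t. poly q (t + 1/2) - poly q (t - 1/2) = t ^ (2 * k)"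
    by (auto simp: poly_monom)
  have pq: "poly q t = (\<Sum>j\<le>2 * k + 1. coeff q j * t ^ j)" for t
  proof -
    have "degree q \<le> 2 * k + 1" using q(1) by (intro degree_le) auto
    from poly_as_sum_of_monoms'[OF this] have "poly q t = poly (\<Sum>j\<le>2 * k + 1. monom (coeff q j) j) t" by simp
    then show ?thesis by (simp add: poly_sum poly_monom del: sum.atMost_Suc)
  qed
  have odd: "(\<Sum>i\<le>k. coeff q (2 * i + 1) * t ^ (2 * i + 1)) = (poly q t - poly q (- t)) / 2" for t
    unfolding odd_part_sum[symmetric] pq by (simp add: sum_subtractf right_diff_distrib sum_divide_distrib diff_divide_distrib del: sum.atMost_Suc)
  have "(poly q (t + 1/2) - poly q (- (t + 1/2))) / 2 - (poly q (t - 1/2) - poly q (- (t - 1/2))) / 2 = t ^ (2 * k)" for t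
  proof -
    have "poly q (- t + 1/2) - poly q (- t - 1/2) = t ^ (2 * k)"
      unfolding q(2) by (simp add: power_mult)
    moreover have e: "- (t - 1/2) = - t + 1/2" "- (t + 1/2) = - t - 1/2" by simp_all
    moreover have "a - d = m \<Longrightarrow> b - c = m \<Longrightarrow> (b - d') / 2 - (c - a') / 2 = m" if "a' = a" "d' = d" for a b c d a' d' m :: complex
      using that by (auto simp: field_simps)
    ultimately show ?thesis using q(2)[of t] unfolding e by blast
  qed
  then show ?thesis
    by (intro exI[of _ "\<lambda>i. coeff q (2 * i + 1)"]) (simp only: odd, blast)
qed

text \<open>Homogenisation of \<open>odd_antidifference_monomial\<close> by z: for t = z s both
  sides are z^(2k+1) times the identity in s, and for z = 0 both vanish.\<close>

lemma even_form_antidifference_monomial: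
  "\<exists>\<Xi> :: complex ^ ('n::finite) option \<Rightarrow> complex poly. even_form k \<Xi> \<and> (\<forall>y t.
     (t + y $ None / 2) * poly (\<Xi> y) ((t + y $ None / 2)\<^sup>2) - (t - y $ None / 2) * poly (\<Xi> y) ((t - y $ None / 2)\<^sup>2)
     = y $ None * t ^ (2 * k))"
proof -
  obtain \<beta> where \<beta>: "\<And>t :: complex. (\<Sum>i\<le>k. \<beta> i * (t + 1/2) ^ (2 * i + 1)) - (\<Sum>i\<le>k. \<beta> i * (t - 1/2) ^ (2 * i + 1)) = t ^ (2 * k)"
    using odd_antidifference_monomial by blast
  define \<Xi> :: "complex ^ 'n option \<Rightarrow> complex poly" where "\<Xi> y = (\<Sum>i\<le>k. monom (\<beta> i * y $ None ^ (2 * (k - i))) i)" for y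
  have hpz: "homog (2 * e) (\<lambda>y :: complex ^ 'n option. c * y $ None ^ (2 * e))" for c e
    using homog_cmult[OF homog_power[OF homog_var, of "2 * e" None], of c] by simp
  have even_form: "even_form k \<Xi>"
    unfolding \<Xi>_def[abs_def] by (intro even_form_sum even_form_monom hpz) auto
  have e: "(z * s) * poly (\<Xi> y) ((z * s)\<^sup>2) = z ^ (2 * k + 1) * (\<Sum>i\<le>k. \<beta> i * s ^ (2 * i + 1))"
    if "z = y $ None" for y z s
  proof -
    have "z ^ (2 * (k - i)) * z ^ (2 * i) = z ^ (2 * k)" if "i \<le> k" for i
      using that by (simp flip: power_add distrib_left)
    then have *: "z * s * (\<beta> i * z ^ (2 * (k - i)) * (z * s) ^ (2 * i)) = z ^ (2 * k + 1) * (\<beta> i * s ^ (2 * i + 1))" if "i \<le> k" for i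
      using that by (simp add: power_mult_distrib mult_ac)
    show ?thesis
      unfolding \<Xi>_def poly_sum poly_monom sum_distrib_left power_mult[symmetric] \<open>z = y $ None\<close>[symmetric]
      by (rule sum.cong[OF refl]) (use * in auto)
  qed
  have "(t + y $ None / 2) * poly (\<Xi> y) ((t + y $ None / 2)\<^sup>2) - (t - y $ None / 2) * poly (\<Xi> y) ((t - y $ None / 2)\<^sup>2)
     = y $ None * t ^ (2 * k)" for y t
  proof (cases "y $ None = 0")
    case False
    define z s where "z = y $ None" and "s = t / z"
    have t: "t + z / 2 = z * (s + 1/2)" "t - z / 2 = z * (s - 1/2)" "t = z * s"
      using False by (simp_all add: s_def z_def field_simps)
    have "(t + z / 2) * poly (\<Xi> y) ((t + z / 2)\<^sup>2) - (t - z / 2) * poly (\<Xi> y) ((t - z / 2)\<^sup>2)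
      = z ^ (2 * k + 1) * ((\<Sum>i\<le>k. \<beta> i * (s + 1/2) ^ (2 * i + 1)) - (\<Sum>i\<le>k. \<beta> i * (s - 1/2) ^ (2 * i + 1)))"
      unfolding t(1,2) e[OF z_def] by (rule right_diff_distrib[symmetric])
    also have "\<dots> = z * t ^ (2 * k)"
      unfolding \<beta> t(3) by (simp add: power_mult_distrib)
    finally show ?thesis by (simp add: z_def)
  qed simp
  with even_form show ?thesis by blast
qed

lemma even_form_antidifference:
  fixes \<Phi> :: "complex ^ ('n::finite) option \<Rightarrow> complex poly"
  assumes "even_form n \<Phi>"
  obtains \<Xi> where "even_form n \<Xi>" "\<And>y t. (t + y $ None / 2) * poly (\<Xi> y) ((t + y $ None / 2)\<^sup>2)
      - (t - y $ None / 2) * poly (\<Xi> y) ((t - y $ None / 2)\<^sup>2) = y $ None * poly (\<Phi> y) (t\<^sup>2)"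
proof -
  obtain X :: "nat \<Rightarrow> complex ^ ('n::finite) option \<Rightarrow> complex poly" where X: "\<And>k. even_form k (X k)"
    "\<And>k y t. (t + y $ None / 2) * poly (X k y) ((t + y $ None / 2)\<^sup>2)
      - (t - y $ None / 2) * poly (X k y) ((t - y $ None / 2)\<^sup>2) = y $ None * t ^ (2 * k)"
    using even_form_antidifference_monomial by metis
  define \<Xi> where "\<Xi> y = (\<Sum>k\<le>n. smult (coeff (\<Phi> y) k) (X k y))" for y
  have "even_form n \<Xi>"
    unfolding \<Xi>_def[abs_def]
  proof (rule even_form_sum)
    fix k assume "k \<in> {..n}"
    then show "even_form n (\<lambda>y. smult (coeff (\<Phi> y) k) (X k y))"
      using even_form_smult[OF X(1)[of k] even_form_coeff[OF assms, of k]] by simp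
  qed
  moreover have "(t + y $ None / 2) * poly (\<Xi> y) ((t + y $ None / 2)\<^sup>2)
      - (t - y $ None / 2) * poly (\<Xi> y) ((t - y $ None / 2)\<^sup>2) = y $ None * poly (\<Phi> y) (t\<^sup>2)" (is "?L = _") for y t
  proof -
    have "?L = (\<Sum>k\<le>n. coeff (\<Phi> y) k * ((t + y $ None / 2) * poly (X k y) ((t + y $ None / 2)\<^sup>2)
      - (t - y $ None / 2) * poly (X k y) ((t - y $ None / 2)\<^sup>2)))"
      by (simp add: \<Xi>_def poly_sum sum_distrib_left right_diff_distrib sum_subtractf mult_ac)
    also have "\<dots> = y $ None * poly (\<Sum>k\<le>n. monom (coeff (\<Phi> y) k) k) (t\<^sup>2)"
      unfolding X(2) by (simp add: poly_sum poly_monom sum_distrib_left mult_ac flip: power_mult)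
    finally show ?thesis
      using poly_as_sum_of_monoms'[OF even_form_degree[OF assms]] by simp
  qed
  ultimately show ?thesis by (rule that)
qed

section \<open>Rational functions regular off the real line\<close>

text \<open>All poles in question are half-integers, so it suffices to control functions off the real line.\<close>

definition rational_fun :: "(complex \<Rightarrow> complex) \<Rightarrow> bool" where
  "rational_fun F \<longleftrightarrow> (\<exists>p q. \<forall>t. Im t \<noteq> 0 \<longrightarrow> poly q t \<noteq> 0 \<and> F t * poly q t = poly p t)"

lemma rational_fun_poly: "rational_fun (poly p)"
  unfolding rational_fun_def by (rule exI[of _ p], rule exI[of _ 1]) simp

lemma rational_fun_const: "rational_fun (\<lambda>t. c)"
  unfolding rational_fun_def by (rule exI[of _ "[:c:]"], rule exI[of _ 1]) simp

lemma rational_fun_id: "rational_fun (\<lambda>t. t)"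
  unfolding rational_fun_def by (rule exI[of _ "[:0, 1:]"], rule exI[of _ 1]) simp

lemma rational_fun_add:
  assumes "rational_fun F" "rational_fun G" shows "rational_fun (\<lambda>t. F t + G t)"
proof -
  obtain p q p' q' where "\<And>t. Im t \<noteq> 0 \<Longrightarrow> poly q t \<noteq> 0 \<and> F t * poly q t = poly p t"
    "\<And>t. Im t \<noteq> 0 \<Longrightarrow> poly q' t \<noteq> 0 \<and> G t * poly q' t = poly p' t"
    using assms unfolding rational_fun_def by metis
  then show ?thesis unfolding rational_fun_def
    by (intro exI[of _ "p * q' + p' * q"] exI[of _ "q * q'"]) (auto simp: algebra_simps)
qed

lemma rational_fun_mult:
  assumes "rational_fun F" "rational_fun G" shows "rational_fun (\<lambda>t. F t * G t)"
proof -
  obtain p q p' q' where *: "\<And>t. Im t \<noteq> 0 \<Longrightarrow> poly q t \<noteq> 0 \<and> F t * poly q t = poly p t"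
    "\<And>t. Im t \<noteq> 0 \<Longrightarrow> poly q' t \<noteq> 0 \<and> G t * poly q' t = poly p' t"
    using assms unfolding rational_fun_def by metis
  have "poly (q * q') t \<noteq> 0 \<and> F t * G t * poly (q * q') t = poly (p * p') t" if "Im t \<noteq> 0" for t
    using *[OF that] by (simp flip: *(1)[OF that, THEN conjunct2] *(2)[OF that, THEN conjunct2])
  then show ?thesis unfolding rational_fun_def by blast
qed

lemma rational_fun_cmult: "rational_fun F \<Longrightarrow> rational_fun (\<lambda>t. c * F t)"
  by (intro rational_fun_mult rational_fun_const)

lemma rational_fun_diff: "rational_fun F \<Longrightarrow> rational_fun G \<Longrightarrow> rational_fun (\<lambda>t. F t - G t)"
  using rational_fun_add[OF _ rational_fun_cmult[of G "-1"], of F] by simp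

lemma rational_fun_prod: "(\<And>i. i \<in> A \<Longrightarrow> rational_fun (F i)) \<Longrightarrow> rational_fun (\<lambda>t. \<Prod>i\<in>A. F i t)"
  by (induction A rule: infinite_finite_induct) (auto intro: rational_fun_const rational_fun_mult)

lemma rational_fun_power: "rational_fun F \<Longrightarrow> rational_fun (\<lambda>t. F t ^ n)"
  by (induction n) (auto intro: rational_fun_const rational_fun_mult)

lemma rational_fun_divide:
  assumes "rational_fun F" "rational_fun G" "\<And>t. Im t \<noteq> 0 \<Longrightarrow> G t \<noteq> 0"
  shows "rational_fun (\<lambda>t. F t / G t)"
proof -
  obtain p q p' q' where *: "\<And>t. Im t \<noteq> 0 \<Longrightarrow> poly q t \<noteq> 0 \<and> F t * poly q t = poly p t"
    "\<And>t. Im t \<noteq> 0 \<Longrightarrow> poly q' t \<noteq> 0 \<and> G t * poly q' t = poly p' t"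
    using assms unfolding rational_fun_def by metis
  have "poly (q * p') t \<noteq> 0 \<and> F t / G t * poly (q * p') t = poly (p * q') t" if "Im t \<noteq> 0" for t
    using *(1)[OF that] *(2)[OF that, THEN conjunct2, symmetric] *(2)[OF that] assms(3)[OF that] by (auto simp: field_simps)
  then show ?thesis unfolding rational_fun_def by blast
qed

lemma rational_fun_shift:
  assumes "rational_fun F" shows "rational_fun (\<lambda>t. F (t - 1/2))"
proof -
  obtain p q where *: "\<And>t. Im t \<noteq> 0 \<Longrightarrow> poly q t \<noteq> 0 \<and> F t * poly q t = poly p t"
    using assms unfolding rational_fun_def by metis
  show ?thesis unfolding rational_fun_def
    by (intro exI[of _ "pcompose p [:-1/2, 1:]"] exI[of _ "pcompose q [:-1/2, 1:]"])
       (use *[of "t - 1/2" for t] in \<open>auto simp: poly_pcompose\<close>)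
qed

text \<open>The value is constant along t, t + 1, t + 2, ..., so the numerator minus this constant
  times the denominator has infinitely many roots. Hence F takes the same value at - t, and oddness
  leaves only 0.\<close>

lemma rational_odd_periodic_eq_0:
  assumes F: "rational_fun F" and odd: "\<And>t. Im t \<noteq> 0 \<Longrightarrow> F (- t) = - F t"
    and per: "\<And>t. Im t \<noteq> 0 \<Longrightarrow> F (t + 1/2) = F (t - 1/2)" and t: "Im t \<noteq> 0"
  shows "F t = 0"
proof -
  obtain p q where *: "\<And>t. Im t \<noteq> 0 \<Longrightarrow> poly q t \<noteq> 0 \<and> F t * poly q t = poly p t"
    using F unfolding rational_fun_def by metis
  have Fn: "F (t + of_nat n) = F t" for n
  proof (induction n)
    case (Suc n)
    then show ?case using per[of "t + of_nat n + 1/2"] t by (simp add: algebra_simps)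
  qed simp
  have "poly (p - smult (F t) q) (t + of_nat n) = 0" for n
    using *[of "t + of_nat n"] Fn[of n] t by simp
  then have "range (\<lambda>n. t + of_nat n) \<subseteq> {x. poly (p - smult (F t) q) x = 0}" by auto
  moreover have "infinite (range (\<lambda>n. t + of_nat n))"
    by (rule range_inj_infinite) (simp add: inj_def)
  ultimately have "p - smult (F t) q = 0"
    using poly_roots_finite finite_subset by blast
  then have "poly p (- t) = F t * poly q (- t)" by simp
  then have "F (- t) = F t" using *[of "- t"] t by auto
  then show ?thesis using odd[OF t] by simp
qed

lemma telescope_const:
  assumes "\<And>r. r < n \<Longrightarrow> F (u + of_nat r + 1) = F (u + of_nat r :: complex)"
  shows "F (u + of_nat n) = (F u :: complex)"
  using assms by (induction n) (auto simp: algebra_simps)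

text \<open>Adding a small multiple of i \<open>r\<close> stays in the slice z = 1 of the hyperplane
  and makes the coordinates in the support of \<open>r\<close> nonreal, so only such points have to
  be checked. Scaling then reaches all z other than 0, and moving along \<open>y0\<close> reaches z
  = 0.\<close>

lemma hyperplane_extension:
  fixes f :: "complex ^ ('n::finite) option \<Rightarrow> complex"
  assumes f: "homog d f" and r: "dotp b r = 0" "r $ None = 0" "\<And>k. Im (r $ Some k) = 0"
    and y0: "dotp b y0 = 0" "y0 $ None = 1"
    and vanish: "\<And>y. dotp b y = 0 \<Longrightarrow> y $ None = 1 \<Longrightarrow> (\<And>k. r $ Some k \<noteq> 0 \<Longrightarrow> Im (y $ Some k) \<noteq> 0) \<Longrightarrow> f y = 0"
    and y: "dotp b y = 0"
  shows "f y = 0"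
proof -
  have pf: "polyfun f" using f by (rule homog_polyfun)
  have v1: "f y = 0" if y: "dotp b y = 0" "y $ None = 1" for y
  proof (rule polyfun_eq_0_on_line[OF pf, of y "\<i> *s r"])
    have "\<forall>\<^sub>F s in at_right (0::real). \<forall>k. r $ Some k \<noteq> 0 \<longrightarrow> Im (y $ Some k) + s * Re (r $ Some k) \<noteq> 0"
    proof (rule eventually_all_finite)
      fix k
      show "\<forall>\<^sub>F s in at_right (0::real). r $ Some k \<noteq> 0 \<longrightarrow> Im (y $ Some k) + s * Re (r $ Some k) \<noteq> 0"
      proof (cases "r $ Some k = 0")
        case False
        then have re: "Re (r $ Some k) \<noteq> 0" using r(3)[of k] by (simp add: complex_eq_iff)
        show ?thesis
        proof (cases "Im (y $ Some k) = 0")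
          case True
          then show ?thesis using re by (intro eventually_mono[OF eventually_at_right_less[of 0]]) auto
        next
          case nz: False
          have "((\<lambda>s. Im (y $ Some k) + s * Re (r $ Some k)) \<longlongrightarrow> Im (y $ Some k) + 0 * Re (r $ Some k)) (at_right 0)"
            by (intro tendsto_intros)
          then show ?thesis using tendsto_imp_eventually_ne[of _ "Im (y $ Some k)" _ 0] nz
            by (force elim: eventually_mono)
        qed
      qed simp
    qed
    then show "\<forall>\<^sub>F s in at_right 0. f (y + complex_of_real s *s (\<i> *s r)) = 0"
    proof (rule eventually_mono)
      fix s :: real assume s: "\<forall>k. r $ Some k \<noteq> 0 \<longrightarrow> Im (y $ Some k) + s * Re (r $ Some k) \<noteq> 0"
      show "f (y + complex_of_real s *s (\<i> *s r)) = 0"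
        by (rule vanish) (use s y r in \<open>auto simp: dotp_add dotp_scale\<close>)
    qed
  qed
  have v2: "f y = 0" if y: "dotp b y = 0" "y $ None \<noteq> 0" for y
  proof -
    let ?u = "(1 / y $ None) *s y"
    have "f ?u = 0" by (rule v1) (use y in \<open>auto simp: dotp_scale\<close>)
    moreover have "y = y $ None *s ?u" using y by (simp add: vec_eq_iff)
    ultimately show ?thesis using homog_scale[OF f, of "y $ None" ?u] by simp
  qed
  show ?thesis
  proof (cases "y $ None = 0")
    case True
    show ?thesis
    proof (rule polyfun_eq_0_on_line[OF pf, of y y0])
      show "\<forall>\<^sub>F s in at_right 0. f (y + complex_of_real s *s y0) = 0"
        using y y0 True by (intro eventually_mono[OF eventually_at_right_less[of 0]] v2) (auto simp: dotp_add dotp_scale)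
    qed
  qed (use v2 y in auto)
qed

section \<open>The weights and their contiguity relation\<close>

lemma even_form_prod:
  "finite A \<Longrightarrow> (\<And>i. i \<in> A \<Longrightarrow> even_form (d i) (\<Phi> i)) \<Longrightarrow> even_form (\<Sum>i\<in>A. d i) (\<lambda>y. \<Prod>i\<in>A. \<Phi> i y)"
proof (induction A rule: finite_induct)
  case empty
  then show ?case using even_form_const[of 0 "\<lambda>y. 1"] by (simp add: one_pCons)
next
  case (insert i A)
  then show ?case using even_form_mult[of "d i" "\<Phi> i" "\<Sum>i\<in>A. d i" "\<lambda>y. \<Prod>i\<in>A. \<Phi> i y"] by simp
qed

lemma even_form_linear: "homog 2 a \<Longrightarrow> even_form 1 (\<lambda>y. [:a y, 1:])"
  using even_form_pCons[OF even_form_const[of 0 "\<lambda>y. 1"], of a] by simp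

lemma homog_square: "homog 1 f \<Longrightarrow> homog 2 (\<lambda>y. (f y)\<^sup>2)"
  using homog_power[of 1 f 2] by simp

text \<open>For \<open>r < m\<close> these are the shifts -(m - 1)/2, ..., (m - 1)/2 of a window;
  larger indices continue the progression and occur among the zeros of the weight.\<close>

definition offset :: "nat \<Rightarrow> nat \<Rightarrow> complex" where
  "offset m r = (2 * of_nat r - of_nat m + 1) / 2"

lemma offset_Suc: "offset m (Suc r) = offset m r + 1"
  by (simp add: offset_def field_simps)

lemma Im_offset [simp]: "Im (offset m r) = 0"
  by (simp add: offset_def)

text \<open>The factors \<open>(t - s z)\<^sup>2 - x\<^sub>k\<^sup>2\<close>, regrouped so that the product is visibly even in \<open>t\<close>.\<close>

definition pair_factor :: "nat \<Rightarrow> complex ^ ('n::finite) option \<Rightarrow> complex \<Rightarrow> complex" where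
  "pair_factor m y t = (\<Prod>k\<in>UNIV. \<Prod>r<m. t\<^sup>2 - (y $ Some k + offset m r * y $ None)\<^sup>2)"

lemma pair_factor_minus: "pair_factor m y (- t) = pair_factor m y t"
  by (simp add: pair_factor_def)

lemma pair_factor_ae:
  obtains \<Gamma> :: "complex ^ ('n::finite) option \<Rightarrow> complex poly"
  where "even_form (CARD('n) * m) \<Gamma>" "\<And>y t. poly (\<Gamma> y) (t\<^sup>2) = pair_factor m y t"
proof
  let ?\<Gamma> = "\<lambda>y :: complex ^ 'n option. \<Prod>k\<in>UNIV. \<Prod>r<m. [:- (y $ Some k + offset m r * y $ None)\<^sup>2, 1:]"
  have "homog 1 (\<lambda>y :: complex ^ 'n option. y $ Some k + offset m r * y $ None)" for k r
    by (auto intro!: homog_add homog_cmult)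
  then have "homog 2 (\<lambda>y :: complex ^ 'n option. - (y $ Some k + offset m r * y $ None)\<^sup>2)" for k r
    using homog_cmult[OF homog_square, of "\<lambda>y. y $ Some k + offset m r * y $ None" "-1"] by simp
  then have 1: "even_form 1 (\<lambda>y :: complex ^ 'n option. [:- (y $ Some k + offset m r * y $ None)\<^sup>2, 1:])" for k r
    by (intro even_form_linear)
  have "even_form m (\<lambda>y :: complex ^ 'n option. \<Prod>r<m. [:- (y $ Some k + offset m r * y $ None)\<^sup>2, 1:])" for k
    using even_form_prod[OF _ 1, of "{..<m}" "\<lambda>_. k" "\<lambda>r. r"] by simp
  from even_form_prod[OF _ this, of UNIV "\<lambda>k. k"] show "even_form (CARD('n) * m) ?\<Gamma>" by simp
  show "poly (?\<Gamma> y) (t\<^sup>2) = pair_factor m y t" for y t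
    by (simp add: pair_factor_def poly_prod)
qed

text \<open>After a half step, the m + 1 zeros around each of x_k and - x_k are the m zeros for
  \<open>m\<close> and one more. The two extra linear factors multiply to the square difference on
  the right.\<close>

lemma pair_factor_Suc_shift:
  assumes "y $ None = 1"
  shows "pair_factor (Suc m) y (t + 1/2) = pair_factor m y t * (\<Prod>k\<in>UNIV. (t + (of_nat m + 1) / 2)\<^sup>2 - (y $ Some k)\<^sup>2)"
proof -
  have "(\<Prod>r<Suc m. (t + 1/2)\<^sup>2 - (x + offset (Suc m) r)\<^sup>2) =
      (\<Prod>r<m. t\<^sup>2 - (x + offset m r)\<^sup>2) * ((t + (of_nat m + 1) / 2)\<^sup>2 - x\<^sup>2)" for x
  proof -
    have "(\<Prod>r<Suc m. (t + 1/2)\<^sup>2 - (x + offset (Suc m) r)\<^sup>2) =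
        (\<Prod>r<Suc m. t + 1/2 - x - offset (Suc m) r) * (\<Prod>r<Suc m. t + 1/2 + x + offset (Suc m) r)"
      unfolding prod.distrib[symmetric] by (intro prod.cong) (auto simp: power2_eq_square algebra_simps)
    also have "(\<Prod>r<Suc m. t + 1/2 - x - offset (Suc m) r) = (t - x + (of_nat m + 1) / 2) * (\<Prod>r<m. t - x - offset m r)"
      unfolding prod.lessThan_Suc_shift
      by (intro arg_cong2[of _ _ _ _ "(*)"] prod.cong) (auto simp: offset_def field_simps)
    also have "(\<Prod>r<Suc m. t + 1/2 + x + offset (Suc m) r) = (\<Prod>r<m. t + x + offset m r) * (t + x + (of_nat m + 1) / 2)"
      unfolding prod.lessThan_Suc
      by (intro arg_cong2[of _ _ _ _ "(*)"] prod.cong) (auto simp: offset_def field_simps)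
    also have "(t - x + (of_nat m + 1) / 2) * (\<Prod>r<m. t - x - offset m r) * ((\<Prod>r<m. t + x + offset m r) * (t + x + (of_nat m + 1) / 2))
      = (\<Prod>r<m. (t - x - offset m r) * (t + x + offset m r)) * ((t - x + (of_nat m + 1) / 2) * (t + x + (of_nat m + 1) / 2))"
      unfolding prod.distrib by (simp only: mult_ac)
    also have "(\<Prod>r<m. (t - x - offset m r) * (t + x + offset m r)) = (\<Prod>r<m. t\<^sup>2 - (x + offset m r)\<^sup>2)"
      by (intro prod.cong) (auto simp: power2_eq_square algebra_simps)
    also have "(t - x + (of_nat m + 1) / 2) * (t + x + (of_nat m + 1) / 2) = (t + (of_nat m + 1) / 2)\<^sup>2 - x\<^sup>2"
      by (simp add: power2_eq_square algebra_simps)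
    finally show ?thesis .
  qed
  then show ?thesis
    by (simp add: pair_factor_def assms prod.distrib)
qed

text \<open>The indices start at 0 so that the quotient of the values at u + 1/2 and u - 1/2
  telescopes uniformly in \<open>a\<close> and \<open>b\<close>; \<open>weight\<close> divides by
  the initial factors again.\<close>

definition weight_num :: "nat \<Rightarrow> nat \<Rightarrow> nat \<Rightarrow> complex \<Rightarrow> complex" where
  "weight_num m a b t = (\<Prod>j<a. t\<^sup>2 - (offset m j)\<^sup>2) * (\<Prod>j<b. t\<^sup>2 - (offset m j - 1/2)\<^sup>2)"

text \<open>The normalisation makes the weight \<open>1\<close> at the multiplicities \<open>m1 = m div 2\<close>, \<open>m2 = (m + 1) div 2\<close>, for which oddness alone
  gives all conditions on the hyperplanes \<open>x\<^sub>i = \<kappa> z\<close>. For smaller multiplicities it has poles.\<close>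

definition weight :: "nat \<Rightarrow> nat \<Rightarrow> nat \<Rightarrow> complex \<Rightarrow> complex" where
  "weight m a b t = weight_num m a b t / weight_num m (m div 2) ((m + 1) div 2) t"

lemma square_diff_real_nonzero:
  assumes "Im t \<noteq> 0" "Im s = 0" shows "t\<^sup>2 - s\<^sup>2 \<noteq> 0"
proof
  assume "t\<^sup>2 - s\<^sup>2 = 0"
  then have "t = s \<or> t = - s" by (simp add: power2_eq_iff)
  with assms show False by auto
qed

lemma weight_num_nonzero: "Im t \<noteq> 0 \<Longrightarrow> weight_num m a b t \<noteq> 0"
  by (auto simp: weight_num_def square_diff_real_nonzero simp del: eq_iff_diff_eq_0[symmetric])

lemma weight_Suc: "weight m (Suc a) b t = (t\<^sup>2 - (offset m a)\<^sup>2) * weight m a b t"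
  "weight m a (Suc b) t = (t\<^sup>2 - (offset m b - 1/2)\<^sup>2) * weight m a b t"
  by (simp_all add: weight_def weight_num_def)

lemma weight_minus: "weight m a b (- t) = weight m a b t"
  by (simp add: weight_def weight_num_def)

lemma rational_fun_weight: "rational_fun (weight m a b)"
proof -
  have "rational_fun (weight_num m a b)" for a b
    unfolding weight_num_def[abs_def]
    by (intro rational_fun_mult rational_fun_prod rational_fun_diff rational_fun_power rational_fun_id rational_fun_const)
  then show ?thesis
    unfolding weight_def[abs_def] by (intro rational_fun_divide weight_num_nonzero)
qed

lemma weight_num_Suc: "weight_num m (Suc a) b t = (t - offset m a) * (t + offset m a) * weight_num m a b t"
  "weight_num m a (Suc b) t = (t - (offset m b - 1/2)) * (t + (offset m b - 1/2)) * weight_num m a b t"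
  by (simp_all add: weight_num_def square_diff_square_factored power2_eq_square mult_ac)

text \<open>In each family the zeros are spaced by 1, so neighbouring values share all but the
  extreme factors. Cleared of denominators, the identity is multiplied on both sides by the same two
  factors when \<open>a\<close> or \<open>b\<close> grows by 1.\<close>

lemma weight_num_shift:
  "weight_num m a b (u + 1/2) * ((u + 1/2 - offset m a) * (u + 1/2 - (offset m b - 1/2))) * ((u - of_nat m / 2) * (u - (of_nat m + 1) / 2))
   = weight_num m a b (u - 1/2) * ((u - 1/2 + offset m a) * (u - 1/2 + (offset m b - 1/2))) * ((u + of_nat m / 2) * (u + (of_nat m + 1) / 2))"
    (is "?L a b = ?R a b")
proof -
  have z: "?L 0 0 = ?R 0 0"
  proof -
    have "u + 1/2 - offset m 0 = u + of_nat m / 2" "u + 1/2 - (offset m 0 - 1/2) = u + (of_nat m + 1) / 2"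
      "u - 1/2 + offset m 0 = u - of_nat m / 2" "u - 1/2 + (offset m 0 - 1/2) = u - (of_nat m + 1) / 2"
      by (simp_all add: offset_def field_simps)
    moreover have "weight_num m 0 0 t = 1" for t by (simp add: weight_num_def)
    ultimately show ?thesis by (simp only: mult_1 mult.commute)
  qed
  have e: "u + 1/2 - (s + 1) = u - 1/2 - s" "u - 1/2 + (s + 1) = u + 1/2 + s"
    "u + 1/2 - (s + 1 - 1/2) = u - 1/2 - (s - 1/2)" "u - 1/2 + (s + 1 - 1/2) = u + 1/2 + (s - 1/2)" for s
    by (simp_all add: field_simps)
  have sa: "?L (Suc a) b = ?R (Suc a) b" if "?L a b = ?R a b" for a b
  proof -
    have 1: "?L (Suc a) b = ?L a b * ((u + 1/2 + offset m a) * (u - 1/2 - offset m a))"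
      unfolding weight_num_Suc offset_Suc e by (simp only: mult_ac)
    have 2: "?R (Suc a) b = ?R a b * ((u + 1/2 + offset m a) * (u - 1/2 - offset m a))"
      unfolding weight_num_Suc offset_Suc e by (simp only: mult_ac)
    show ?thesis unfolding 1 2 that ..
  qed
  have sb: "?L a (Suc b) = ?R a (Suc b)" if "?L a b = ?R a b" for a b
  proof -
    have 1: "?L a (Suc b) = ?L a b * ((u + 1/2 + (offset m b - 1/2)) * (u - 1/2 - (offset m b - 1/2)))"
      unfolding weight_num_Suc offset_Suc e by (simp only: mult_ac)
    have 2: "?R a (Suc b) = ?R a b * ((u + 1/2 + (offset m b - 1/2)) * (u - 1/2 - (offset m b - 1/2)))"
      unfolding weight_num_Suc offset_Suc e by (simp only: mult_ac)
    show ?thesis unfolding 1 2 that ..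
  qed
  have "?L a 0 = ?R a 0"
    by (induction a) (use z sa in blast)+
  then show ?thesis
    by (induction b) (use sb in blast)+
qed

lemma nonreal_nonzero: "Im t \<noteq> 0 \<Longrightarrow> Im s = 0 \<Longrightarrow> t + s \<noteq> 0" "Im t \<noteq> 0 \<Longrightarrow> Im s = 0 \<Longrightarrow> t - s \<noteq> 0"
  by (auto simp: complex_eq_iff)

text \<open>The quotient of two instances of \<open>weight_num_shift\<close>. For the normalising
  pair the extreme factors are u (u + 1/2) and u (u - 1/2), which is where the two divisions come
  from. This equation is exactly what makes \<open>H\<close> in \<open>lowering_weight\<close>
  odd.\<close>

lemma weight_shift:
  assumes u: "Im u \<noteq> 0"
  shows "weight m a b (u + 1/2) * ((u + 1/2 - offset m a) * (u + 1/2 - (offset m b - 1/2))) / (u + 1/2)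
   = weight m a b (u - 1/2) * ((u - 1/2 + offset m a) * (u - 1/2 + (offset m b - 1/2))) / (u - 1/2)"
proof -
  let ?A = "m div 2" and ?B = "(m + 1) div 2"
  define X where "X = (u - of_nat m / 2) * (u - (of_nat m + 1) / 2)"
  define Y where "Y = (u + of_nat m / 2) * (u + (of_nat m + 1) / 2)"
  have X: "X \<noteq> 0"
    unfolding X_def by (intro no_zero_divisors nonreal_nonzero u) simp_all
  have Y: "Y \<noteq> 0"
    unfolding Y_def by (intro no_zero_divisors nonreal_nonzero u) simp_all
  define Np Nm Dp Dm where "Np = weight_num m a b (u + 1/2)" and "Nm = weight_num m a b (u - 1/2)"
    and "Dp = weight_num m ?A ?B (u + 1/2)" and "Dm = weight_num m ?A ?B (u - 1/2)"
  define \<alpha> \<beta> where "\<alpha> = (u + 1/2 - offset m a) * (u + 1/2 - (offset m b - 1/2))"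
    and "\<beta> = (u - 1/2 + offset m a) * (u - 1/2 + (offset m b - 1/2))"
  have D: "Dp \<noteq> 0" "Dm \<noteq> 0"
    unfolding Dp_def Dm_def using u by (simp_all add: weight_num_nonzero)
  have u0: "u + 1/2 \<noteq> 0" "u - 1/2 \<noteq> 0" "u \<noteq> 0"
    using u by (auto simp: complex_eq_iff)
  have 1: "Np * \<alpha> * X = Nm * \<beta> * Y"
    unfolding Np_def Nm_def X_def Y_def \<alpha>_def \<beta>_def by (rule weight_num_shift)
  have "Dp * (u * (u + 1/2)) * X = Dm * (u * (u - 1/2)) * Y"
  proof -
    consider c where "m = 2 * c" | c where "m = 2 * c + 1" by (metis oddE evenE)
    then have "(u + 1/2 - offset m ?A) * (u + 1/2 - (offset m ?B - 1/2)) = u * (u + 1/2)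
      \<and> (u - 1/2 + offset m ?A) * (u - 1/2 + (offset m ?B - 1/2)) = u * (u - 1/2)"
      by cases (auto simp: offset_def field_simps)
    then show ?thesis
      using weight_num_shift[of m ?A ?B u] unfolding Dp_def Dm_def X_def Y_def by metis
  qed
  then have 2: "Dp * (u + 1/2) * X = Dm * (u - 1/2) * Y"
    using u0(3) by (simp add: mult_ac)
  have "(Np * \<alpha>) * (Dm * (u - 1/2)) * (X * Y) = (Np * \<alpha> * X) * (Dm * (u - 1/2) * Y)"
    by (simp only: mult_ac)
  also have "\<dots> = (Nm * \<beta>) * (Dp * (u + 1/2)) * (X * Y)"
    unfolding 1 2[symmetric] by (simp only: mult_ac)
  finally have "(Np * \<alpha>) * (Dm * (u - 1/2)) = (Nm * \<beta>) * (Dp * (u + 1/2))"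
    using X Y by simp
  then have "Np * \<alpha> / (Dp * (u + 1/2)) = Nm * \<beta> / (Dm * (u - 1/2))"
    using D u0 by (simp add: frac_eq_eq)
  then show ?thesis
    by (simp add: weight_def \<alpha>_def \<beta>_def Np_def Nm_def Dp_def Dm_def)
qed

text \<open>Separates the even and the odd part in t; the odd part is divisible by t z. The top
  coefficients are recorded because they decide whether the contiguity polynomial has full
  degree.\<close>

lemma shifted_squares_split:
  fixes e :: complex and K :: "('n::finite) set"
  assumes "finite K" "K \<noteq> {}"
  shows "\<exists>n Qe Qo. card K = Suc n \<and> even_form (Suc n) Qe \<and> even_form n Qo \<and>
    (\<forall>(y :: complex ^ 'n option) t. (\<Prod>k\<in>K. (t + e * y $ None)\<^sup>2 - (y $ Some k)\<^sup>2) = poly (Qe y) (t\<^sup>2) + t * y $ None * poly (Qo y) (t\<^sup>2)) \<and>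
    (\<forall>y. coeff (Qe y) (Suc n) = 1) \<and> (\<forall>y. coeff (Qo y) n = 2 * e * of_nat (Suc n))"
  using assms
proof (induction K rule: finite_ne_induct)
  case (singleton k)
  let ?\<alpha> = "\<lambda>y :: complex ^ 'n option. e\<^sup>2 * (y $ None)\<^sup>2 - (y $ Some k)\<^sup>2"
  have "homog 2 ?\<alpha>" by (intro homog_diff homog_cmult homog_square) auto
  then have 1: "even_form (Suc 0) (\<lambda>y. [:?\<alpha> y, 1:])" using even_form_linear by simp
  have 2: "even_form 0 (\<lambda>y :: complex ^ 'n option. [:2 * e:])" by (rule even_form_const) simp
  show ?case
    by (rule exI[of _ 0], rule exI[of _ "\<lambda>y. [:?\<alpha> y, 1:]"], rule exI[of _ "\<lambda>y. [:2 * e:]"])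
       (use 1 2 in \<open>auto simp: power2_eq_square algebra_simps\<close>)
next
  case (insert k K)
  then obtain n Qe Qo where n: "card K = Suc n" and Q: "even_form (Suc n) Qe" "even_form n Qo"
    and p: "\<And>(y :: complex ^ 'n option) t. (\<Prod>k\<in>K. (t + e * y $ None)\<^sup>2 - (y $ Some k)\<^sup>2) = poly (Qe y) (t\<^sup>2) + t * y $ None * poly (Qo y) (t\<^sup>2)"
    and c: "\<And>y. coeff (Qe y) (Suc n) = 1" "\<And>y. coeff (Qo y) n = 2 * e * of_nat (Suc n)" by blast
  let ?\<alpha> = "\<lambda>y :: complex ^ 'n option. e\<^sup>2 * (y $ None)\<^sup>2 - (y $ Some k)\<^sup>2"
  let ?\<beta> = "\<lambda>y :: complex ^ 'n option. 2 * e * (y $ None)\<^sup>2"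
  have h: "homog 2 ?\<alpha>" by (intro homog_diff homog_cmult homog_square) auto
  have h': "homog 2 ?\<beta>" by (intro homog_cmult homog_square) auto
  have 1: "even_form 1 (\<lambda>y. [:?\<alpha> y, 1:])" by (rule even_form_linear[OF h])
  have 2: "even_form 2 (\<lambda>y. pCons 0 [:?\<beta> y:])"
    using even_form_shift[OF even_form_const[of 1 ?\<beta>]] h' by (simp add: numeral_2_eq_2)
  define Qe' Qo' where "Qe' = (\<lambda>y. Qe y * [:?\<alpha> y, 1:] + Qo y * pCons 0 [:?\<beta> y:])"
    and "Qo' = (\<lambda>y. Qo y * [:?\<alpha> y, 1:] + smult (2 * e) (Qe y))"
  have "even_form (Suc (Suc n)) Qe'"
    unfolding Qe'_def using even_form_mult[OF Q(1) 1] even_form_mult[OF Q(2) 2] by (intro even_form_add) auto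
  moreover have "even_form (Suc n) Qo'"
    unfolding Qo'_def using even_form_mult[OF Q(2) 1] even_form_cmult[OF Q(1)] by (intro even_form_add) auto
  moreover have "(\<Prod>k\<in>insert k K. (t + e * y $ None)\<^sup>2 - (y $ Some k)\<^sup>2) = poly (Qe' y) (t\<^sup>2) + t * y $ None * poly (Qo' y) (t\<^sup>2)" for y t
  proof -
    define A B where "A = poly (Qe y) (t\<^sup>2)" and "B = poly (Qo y) (t\<^sup>2)"
    have 1: "(\<Prod>k\<in>insert k K. (t + e * y $ None)\<^sup>2 - (y $ Some k)\<^sup>2) = ((t + e * y $ None)\<^sup>2 - (y $ Some k)\<^sup>2) * (A + t * y $ None * B)"
      using insert.hyps p[of t y] by (simp add: A_def B_def)
    have 2: "poly (Qe' y) (t\<^sup>2) = A * (t\<^sup>2 + ?\<alpha> y) + B * (t\<^sup>2 * ?\<beta> y)" "poly (Qo' y) (t\<^sup>2) = B * (t\<^sup>2 + ?\<alpha> y) + 2 * e * A"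
      by (simp_all add: Qe'_def Qo'_def A_def B_def algebra_simps)
    show ?thesis unfolding 1 2 by (simp add: power2_eq_square algebra_simps)
  qed
  moreover have deg: "coeff (Qe y) (Suc (Suc n)) = 0" "coeff (Qo y) (Suc n) = 0" "coeff (Qo y) (Suc (Suc n)) = 0" for y
    using even_form_degree[OF Q(1), of y] even_form_degree[OF Q(2), of y] by (auto intro!: coeff_eq_0)
  moreover have "coeff (Qe' y) (Suc (Suc n)) = 1" "coeff (Qo' y) (Suc n) = 2 * e * of_nat (Suc (Suc n))" for y
    by (simp_all add: Qe'_def Qo'_def c deg algebra_simps)
  ultimately show ?case
    using n insert.hyps by (intro exI[of _ "Suc n"] exI[of _ Qe'] exI[of _ Qo']) auto
qed

text \<open>The polynomial \<open>P\<close> such that \<open>W(t) P(t\<^sup>2)\<close> times the pair factor for \<open>m\<close> is the central difference of a multiple of the pair factor for \<open>m + 1\<close>.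
  Its value at \<open>s\<^sup>2\<close> is the product over the hyperplanes \<open>x\<^sub>k = \<plusminus>c z\<close> that get removed.\<close>

lemma contiguity_poly:
  fixes s1 s2 e :: complex
  obtains P :: "complex ^ ('n::finite) option \<Rightarrow> complex poly" where "even_form CARD('n) P"
    "\<And>y t. y $ None = 1 \<Longrightarrow> t \<noteq> 0 \<Longrightarrow> poly (P y) (t\<^sup>2) =
        (t + s1) * (t + s2) / t * (\<Prod>k\<in>UNIV. (t + e)\<^sup>2 - (y $ Some k)\<^sup>2)
      + (- t + s1) * (- t + s2) / (- t) * (\<Prod>k\<in>UNIV. (- t + e)\<^sup>2 - (y $ Some k)\<^sup>2)"
    "\<And>y s. s = s1 \<or> s = s2 \<Longrightarrow> poly (P y) ((s * y $ None)\<^sup>2) = 2 * (s1 + s2) * (\<Prod>k\<in>UNIV. ((s + e) * y $ None)\<^sup>2 - (y $ Some k)\<^sup>2)"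
    "\<And>y. coeff (P y) CARD('n) = 2 * (s1 + s2) + 4 * e * of_nat CARD('n)"
proof -
  obtain n Qe Qo where n: "CARD('n) = Suc n" and Q: "even_form (Suc n) Qe" "even_form n Qo"
    and p: "\<And>(y :: complex ^ 'n option) t. (\<Prod>k\<in>UNIV. (t + e * y $ None)\<^sup>2 - (y $ Some k)\<^sup>2) = poly (Qe y) (t\<^sup>2) + t * y $ None * poly (Qo y) (t\<^sup>2)"
    and c: "\<And>y. coeff (Qe y) (Suc n) = 1" "\<And>y. coeff (Qo y) n = 2 * e * of_nat (Suc n)"
    using shifted_squares_split[of "UNIV :: 'n set" e] by auto
  \<comment> \<open>For z = 1 and the product written as A + t B, the even part s1 + s2 and the odd
    part t + s1 s2 / t of (t + s1) (t + s2) / t give 2 ((s1 + s2) A + (t^2 + s1 s2) B). At t = s1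
    this is 2 (s1 + s2) (A + s1 B), a multiple of the product itself; likewise at t = s2.\<close>
  define P where "P y = smult 2 (smult (s1 + s2) (Qe y) + [:s1 * s2 * (y $ None)\<^sup>2, 1:] * Qo y)" for y
  show ?thesis
  proof (rule that[of P])
    have "even_form 1 (\<lambda>y :: complex ^ 'n option. [:s1 * s2 * (y $ None)\<^sup>2, 1:])"
      by (intro even_form_linear homog_cmult homog_square) auto
    from even_form_mult[OF this Q(2)] show "even_form CARD('n) P"
      unfolding P_def[abs_def] n using Q(1) by (intro even_form_cmult even_form_add) auto
    show "coeff (P y) CARD('n) = 2 * (s1 + s2) + 4 * e * of_nat CARD('n)" for y
    proof -
      have "coeff (Qo y) (Suc n) = 0"
        using even_form_degree[OF Q(2), of y] by (auto intro!: coeff_eq_0)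
      then show ?thesis by (simp add: P_def n c algebra_simps)
    qed
    show "poly (P y) (t\<^sup>2) = (t + s1) * (t + s2) / t * (\<Prod>k\<in>UNIV. (t + e)\<^sup>2 - (y $ Some k)\<^sup>2)
      + (- t + s1) * (- t + s2) / (- t) * (\<Prod>k\<in>UNIV. (- t + e)\<^sup>2 - (y $ Some k)\<^sup>2)"
      if "y $ None = 1" "t \<noteq> 0" for y t
    proof -
      define A B where "A = poly (Qe y) (t\<^sup>2)" and "B = poly (Qo y) (t\<^sup>2)"
      have 1: "(\<Prod>k\<in>UNIV. (t + e)\<^sup>2 - (y $ Some k)\<^sup>2) = A + t * B"
        "(\<Prod>k\<in>UNIV. (- t + e)\<^sup>2 - (y $ Some k)\<^sup>2) = A - t * B"
        using p[of t y] p[of "- t" y] that by (simp_all add: A_def B_def)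
      have 2: "poly (P y) (t\<^sup>2) = 2 * ((s1 + s2) * A + (s1 * s2 + t\<^sup>2) * B)"
        using that by (simp add: P_def A_def B_def algebra_simps)
      show ?thesis
        unfolding 1 2 using that(2) by (simp add: field_simps power2_eq_square)
    qed
    show "poly (P y) ((s * y $ None)\<^sup>2) = 2 * (s1 + s2) * (\<Prod>k\<in>UNIV. ((s + e) * y $ None)\<^sup>2 - (y $ Some k)\<^sup>2)"
      if "s = s1 \<or> s = s2" for y s
    proof -
      define z A B where "z = y $ None" and "A = poly (Qe y) ((s * z)\<^sup>2)" and "B = poly (Qo y) ((s * z)\<^sup>2)"
      have "(\<Prod>k\<in>UNIV. ((s + e) * z)\<^sup>2 - (y $ Some k)\<^sup>2) = A + s * z * z * B"
        using p[of "s * z" y] by (simp add: A_def B_def z_def distrib_right)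
      moreover have "poly (P y) ((s * z)\<^sup>2) = 2 * ((s1 + s2) * A + (s1 * s2 * z\<^sup>2 + (s * z)\<^sup>2) * B)"
        by (simp add: P_def A_def B_def z_def algebra_simps)
      ultimately show ?thesis
        using that by (auto simp: z_def power2_eq_square algebra_simps)
    qed
  qed
qed

text \<open>The data of one contiguity step. The value of \<open>P\<close> is the product of the
  hyperplanes to be removed, \<open>H\<close> certifies that the weight W(t) P(t^2) belongs to the
  zero derivation, and the leading coefficient serves the transport of nondegeneracy.\<close>

definition lowering :: "nat \<Rightarrow> (complex \<Rightarrow> complex) \<Rightarrow> complex \<Rightarrow> complex \<Rightarrow>
    (complex ^ ('n::finite) option \<Rightarrow> complex poly) \<Rightarrow> bool" where
  "lowering m W s c P \<longleftrightarrow> even_form CARD('n) P \<and>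
     (\<exists>\<kappa>. \<kappa> \<noteq> 0 \<and> (\<forall>y. poly (P y) ((s * y $ None)\<^sup>2) = \<kappa> * (\<Prod>k\<in>UNIV. (c * y $ None)\<^sup>2 - (y $ Some k)\<^sup>2))) \<and>
     (\<forall>y. coeff (P y) CARD('n) \<noteq> 0) \<and>
     (\<forall>y. y $ None = 1 \<longrightarrow> (\<exists>H. rational_fun H \<and> (\<forall>t. Im t \<noteq> 0 \<longrightarrow> H (- t) = - H t) \<and>
        (\<forall>t. Im t \<noteq> 0 \<longrightarrow> H (t + 1/2) - H (t - 1/2) = W t * poly (P y) (t\<^sup>2) * pair_factor m y t) \<and>
        (\<forall>k. H (y $ Some k + of_nat m / 2) = 0)))"

text \<open>One polynomial, symmetric in the two roots, serves both relations: division at the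
  square of the first root raises \<open>a\<close>, at the second \<open>b\<close>. Adding (m + 1)/2
  to the roots gives a + 1 and b + 1/2, the next hyperplanes in each family.\<close>

lemma lowering_weight:
  "\<exists>P :: complex ^ ('n::finite) option \<Rightarrow> complex poly. lowering m (weight m a b) (offset m a) (of_nat a + 1) P"
  "\<exists>P :: complex ^ ('n::finite) option \<Rightarrow> complex poly. lowering m (weight m a b) (offset m b - 1/2) (of_nat b + 1/2) P"
proof -
  let ?s1 = "offset m a" and ?s2 = "offset m b - 1/2" and ?e = "(of_nat m + 1) / 2 :: complex"
  obtain P :: "complex ^ ('n::finite) option \<Rightarrow> complex poly" where P: "even_form CARD('n) P"
    "\<And>y t. y $ None = 1 \<Longrightarrow> t \<noteq> 0 \<Longrightarrow> poly (P y) (t\<^sup>2) =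
        (t + ?s1) * (t + ?s2) / t * (\<Prod>k\<in>UNIV. (t + ?e)\<^sup>2 - (y $ Some k)\<^sup>2)
      + (- t + ?s1) * (- t + ?s2) / (- t) * (\<Prod>k\<in>UNIV. (- t + ?e)\<^sup>2 - (y $ Some k)\<^sup>2)"
    "\<And>y s. s = ?s1 \<or> s = ?s2 \<Longrightarrow> poly (P y) ((s * y $ None)\<^sup>2) = 2 * (?s1 + ?s2) * (\<Prod>k\<in>UNIV. ((s + ?e) * y $ None)\<^sup>2 - (y $ Some k)\<^sup>2)"
    "\<And>y. coeff (P y) CARD('n) = 2 * (?s1 + ?s2) + 4 * ?e * of_nat CARD('n)"
    using contiguity_poly[of ?s1 ?s2 ?e] by blast
  \<comment> \<open>Parity keeps this constant away from 0 for all \<open>a\<close>,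
    \<open>b\<close> and \<open>m\<close>.\<close>
  have \<kappa>: "2 * (?s1 + ?s2) = of_int (2 * int a + 2 * int b - 2 * int m + 1)"
    by (simp add: offset_def field_simps)
  have \<kappa>0: "2 * (?s1 + ?s2) \<noteq> 0"
    unfolding \<kappa> of_int_eq_0_iff by presburger
  \<comment> \<open>There is at least one variable, so the term with the factor 2 (m + 1) outweighs
    - 2 m and the leading coefficient is positive.\<close>
  have "2 * (?s1 + ?s2) + 4 * ?e * of_nat CARD('n) = of_int (2 * int a + 2 * int b - 2 * int m + 1 + 2 * (int m + 1) * int CARD('n))"
    unfolding \<kappa> by (simp add: field_simps)
  moreover have "2 * int a + 2 * int b - 2 * int m + 1 + 2 * (int m + 1) * int CARD('n) > 0"
  proof -
    have "(int m + 1) * 1 \<le> (int m + 1) * int CARD('n)"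
      by (intro mult_left_mono) (auto simp: Suc_le_eq)
    then show ?thesis by (simp add: algebra_simps)
  qed
  ultimately have top: "coeff (P y) CARD('n) \<noteq> 0" for y
    unfolding P(4) by (metis less_irrefl of_int_eq_0_iff)
  have H: "\<exists>H. rational_fun H \<and> (\<forall>t. Im t \<noteq> 0 \<longrightarrow> H (- t) = - H t) \<and>
        (\<forall>t. Im t \<noteq> 0 \<longrightarrow> H (t + 1/2) - H (t - 1/2) = weight m a b t * poly (P y) (t\<^sup>2) * pair_factor m y t) \<and>
        (\<forall>k. H (y $ Some k + of_nat m / 2) = 0)" if y: "y $ None = 1" for y
  proof -
    define \<rho> where "\<rho> t = (t + ?s1) * (t + ?s2) / t" for t
    \<comment> \<open>The product for m + 1 vanishes at x_k + m/2, hence so does \<open>H\<close>.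
      The half step in the other two factors makes them meet the product for m when the difference
      is taken.\<close>
    define H where "H t = \<rho> (t - 1/2) * weight m a b (t - 1/2) * pair_factor (Suc m) y t" for t
    have odd: "H (- t) = - H t" if t: "Im t \<noteq> 0" for t
    proof -
      have "\<rho> (- t - 1/2) * weight m a b (- t - 1/2) = - (\<rho> (t - 1/2) * weight m a b (t - 1/2))"
      proof -
        have "\<rho> (- t - 1/2) = - ((t + 1/2 - ?s1) * (t + 1/2 - ?s2) / (t + 1/2))"
        proof -
          have "- t - 1/2 + ?s1 = - (t + 1/2 - ?s1)" "- t - 1/2 + ?s2 = - (t + 1/2 - ?s2)" "- t - 1/2 = - (t + 1/2)"
            by simp_all
          then show ?thesis unfolding \<rho>_def by (metis minus_mult_minus divide_minus_right)
        qed
        moreover have "weight m a b (- t - 1/2) = weight m a b (t + 1/2)"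
          using weight_minus[of m a b "t + 1/2"] by simp
        ultimately show ?thesis using weight_shift[OF t, of m a b] by (simp add: \<rho>_def mult_ac)
      qed
      then show ?thesis by (simp add: H_def pair_factor_minus)
    qed
    have Hp: "H (t + 1/2) = \<rho> t * weight m a b t * pair_factor m y t * (\<Prod>k\<in>UNIV. (t + ?e)\<^sup>2 - (y $ Some k)\<^sup>2)" for t
      by (simp add: H_def pair_factor_Suc_shift[OF y])
    have diff: "H (t + 1/2) - H (t - 1/2) = weight m a b t * poly (P y) (t\<^sup>2) * pair_factor m y t" if t: "Im t \<noteq> 0" for t
    proof -
      have "H (t - 1/2) = - H (- t + 1/2)" using odd[of "- t + 1/2"] t by simp
      moreover have "poly (P y) (t\<^sup>2) = \<rho> t * (\<Prod>k\<in>UNIV. (t + ?e)\<^sup>2 - (y $ Some k)\<^sup>2) + \<rho> (- t) * (\<Prod>k\<in>UNIV. (- t + ?e)\<^sup>2 - (y $ Some k)\<^sup>2)"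
        unfolding \<rho>_def using t by (intro P(2)[OF y]) auto
      ultimately show ?thesis
        using Hp[of t] Hp[of "- t"] by (simp add: pair_factor_minus weight_minus algebra_simps)
    qed
    have rat: "rational_fun H"
    proof -
      have "rational_fun (\<lambda>t. \<rho> (t - 1/2) * weight m a b (t - 1/2))"
        unfolding \<rho>_def
        by (intro rational_fun_shift[of "\<lambda>t. (t + ?s1) * (t + ?s2) / t * weight m a b t"] rational_fun_mult rational_fun_divide
           rational_fun_weight rational_fun_add rational_fun_id rational_fun_const) auto
      moreover have "rational_fun (pair_factor (Suc m) y)"
        unfolding pair_factor_def[abs_def]
        by (intro rational_fun_prod rational_fun_diff rational_fun_power rational_fun_id rational_fun_const)
      ultimately show ?thesis
        unfolding H_def[abs_def] by (rule rational_fun_mult)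
    qed
    have "H (y $ Some k + of_nat m / 2) = 0" for k
    proof -
      have "offset (Suc m) m = of_nat m / 2" by (simp add: offset_def)
      then have "(y $ Some k + of_nat m / 2)\<^sup>2 - (y $ Some k + offset (Suc m) m * y $ None)\<^sup>2 = 0"
        by (simp only: y mult_1_right diff_self)
      then have "(\<Prod>r<Suc m. (y $ Some k + of_nat m / 2)\<^sup>2 - (y $ Some k + offset (Suc m) r * y $ None)\<^sup>2) = 0"
        by (intro prod_zero) blast+
      then have "pair_factor (Suc m) y (y $ Some k + of_nat m / 2) = 0"
        unfolding pair_factor_def by (intro prod_zero) auto
      then show ?thesis by (simp add: H_def)
    qed
    with odd diff rat show ?thesis by blast
  qed
  have e: "?s1 + ?e = of_nat a + 1" "?s2 + ?e = of_nat b + 1/2"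
    by (simp_all add: offset_def field_simps)
  have p0: "poly (P y) ((?s1 * y $ None)\<^sup>2) = 2 * (?s1 + ?s2) * (\<Prod>k\<in>UNIV. ((of_nat a + 1) * y $ None)\<^sup>2 - (y $ Some k)\<^sup>2)"
    "poly (P y) ((?s2 * y $ None)\<^sup>2) = 2 * (?s1 + ?s2) * (\<Prod>k\<in>UNIV. ((of_nat b + 1/2) * y $ None)\<^sup>2 - (y $ Some k)\<^sup>2)" for y
    using P(3)[of ?s1 y] P(3)[of ?s2 y] unfolding e by blast+
  show "\<exists>P :: complex ^ ('n::finite) option \<Rightarrow> complex poly. lowering m (weight m a b) (offset m a) (of_nat a + 1) P"
    unfolding lowering_def using P(1) \<kappa>0 p0(1) top H by blast
  show "\<exists>P :: complex ^ ('n::finite) option \<Rightarrow> complex poly. lowering m (weight m a b) (offset m b - 1/2) (of_nat b + 1/2) P"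
    unfolding lowering_def using P(1) \<kappa>0 p0(2) top H by blast
qed

section \<open>Descending induction on the multiplicities\<close>

text \<open>The equations are asked only off the real line, where no weight has a pole; values at
  real points, possibly the result of a division by 0, are left free.\<close>

definition antidiff :: "nat \<Rightarrow> (complex \<Rightarrow> complex) \<Rightarrow> complex ^ ('n::finite) option \<Rightarrow> (complex \<Rightarrow> complex) \<Rightarrow> bool" where
  "antidiff m G y F \<longleftrightarrow> rational_fun F \<and> (\<forall>t. Im t \<noteq> 0 \<longrightarrow> F (- t) = - F t) \<and>
     (\<forall>t. Im t \<noteq> 0 \<longrightarrow> F (t + 1/2) - F (t - 1/2) = G t * pair_factor m y t)"

lemma antidiffD:
  assumes "antidiff m G y F"
  shows "rational_fun F" "Im t \<noteq> 0 \<Longrightarrow> F (- t) = - F t"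
    "Im t \<noteq> 0 \<Longrightarrow> F (t + 1/2) - F (t - 1/2) = G t * pair_factor m y t"
  using assms by (auto simp: antidiff_def)

lemma antidiff_zero: "antidiff m (\<lambda>t. 0) y (\<lambda>t. 0)"
  by (simp add: antidiff_def rational_fun_const)

lemma antidiff_combine:
  assumes "antidiff m G y F" "antidiff m G' y F'"
  shows "antidiff m (\<lambda>t. c * G t + c' * G' t) y (\<lambda>t. c * F t + c' * F' t)"
  unfolding antidiff_def
proof (intro conjI allI impI)
  show "rational_fun (\<lambda>t. c * F t + c' * F' t)"
    by (intro rational_fun_add rational_fun_cmult antidiffD(1)[OF assms(1)] antidiffD(1)[OF assms(2)])
  fix t :: complex assume t: "Im t \<noteq> 0"
  show "c * F (- t) + c' * F' (- t) = - (c * F t + c' * F' t)"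
    by (simp add: antidiffD(2)[OF assms(1) t] antidiffD(2)[OF assms(2) t])
  have "c * F (t + 1/2) + c' * F' (t + 1/2) - (c * F (t - 1/2) + c' * F' (t - 1/2))
      = c * (F (t + 1/2) - F (t - 1/2)) + c' * (F' (t + 1/2) - F' (t - 1/2))"
    by (simp add: right_diff_distrib)
  then show "c * F (t + 1/2) + c' * F' (t + 1/2) - (c * F (t - 1/2) + c' * F' (t - 1/2)) = (c * G t + c' * G' t) * pair_factor m y t"
    unfolding antidiffD(3)[OF assms(1) t] antidiffD(3)[OF assms(2) t] by (simp add: algebra_simps)
qed

lemma antidiff_cong:
  assumes "antidiff m G y F" "\<And>t. Im t \<noteq> 0 \<Longrightarrow> G t = G' t"
  shows "antidiff m G' y F"
  using assms by (simp add: antidiff_def)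

lemma antidiff_sum:
  assumes "finite A" "\<And>i. i \<in> A \<Longrightarrow> antidiff m (G i) y (F i)"
  shows "antidiff m (\<lambda>t. \<Sum>i\<in>A. c i * G i t) y (\<lambda>t. \<Sum>i\<in>A. c i * F i t)"
  using assms
proof (induction A rule: finite_induct)
  case (insert i A)
  then show ?case using antidiff_combine[of m "G i" y "F i" _ _ "c i" 1] by simp
qed (simp add: antidiff_zero)

lemma antidiff_unique:
  assumes "antidiff m G y F" "antidiff m G y F'" "Im t \<noteq> 0"
  shows "F t = F' t"
proof -
  have 0: "antidiff m (\<lambda>t. 1 * G t + (- 1) * G t) y (\<lambda>t. 1 * F t + (- 1) * F' t)"
    by (rule antidiff_combine[OF assms(1,2)])
  have "1 * F t + (- 1) * F' t = 0"
    using antidiffD[OF 0] by (intro rational_odd_periodic_eq_0[where F="\<lambda>t. 1 * F t + (- 1) * F' t"] assms(3)) auto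
  then show ?thesis by simp
qed

lemma offset_reflect: "r < m \<Longrightarrow> offset m (m - 1 - r) = - offset m r"
  by (simp add: offset_def of_nat_diff field_simps)

lemma pair_factor_eq_0:
  assumes y: "y $ None = 1" and r: "r < m" and t: "t\<^sup>2 = (y $ Some i + offset m r)\<^sup>2 \<or> t\<^sup>2 = (y $ Some i - offset m r)\<^sup>2"
  shows "pair_factor m y t = 0"
proof -
  obtain r' where r': "r' < m" "t\<^sup>2 - (y $ Some i + offset m r' * y $ None)\<^sup>2 = 0"
  proof (cases "t\<^sup>2 = (y $ Some i + offset m r)\<^sup>2")
    case True
    then show ?thesis using that[of r] r y by simp
  next
    case False
    then have "t\<^sup>2 = (y $ Some i - offset m r)\<^sup>2" using t by blast
    then show ?thesis using that[of "m - 1 - r"] r y offset_reflect[OF r] by simp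
  qed
  have "(\<Prod>r<m. t\<^sup>2 - (y $ Some i + offset m r * y $ None)\<^sup>2) = 0"
    using r' by (intro prod_zero) auto
  then show ?thesis unfolding pair_factor_def by (intro prod_zero) auto
qed

lemma antidiff_window:
  assumes F: "antidiff m G y F" and y: "y $ None = 1" and im: "Im (y $ Some i) \<noteq> 0" and r: "r \<le> m"
  shows "F (y $ Some i + of_nat m / 2 - of_nat r) = F (y $ Some i + of_nat m / 2)"
  using r
proof (induction r)
  case (Suc r)
  \<comment> \<open>The midpoint between two neighbouring points of the window, a zero of the pair
    factor.\<close>
  let ?t = "y $ Some i + of_nat m / 2 - of_nat r - 1/2"
  have e: "?t = y $ Some i + offset m (m - 1 - r)"
    using Suc.prems by (simp add: offset_def of_nat_diff field_simps)
  have "pair_factor m y ?t = 0"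
  proof (rule pair_factor_eq_0[OF y])
    show "m - 1 - r < m" using Suc.prems by simp
    show "?t\<^sup>2 = (y $ Some i + offset m (m - 1 - r))\<^sup>2 \<or> ?t\<^sup>2 = (y $ Some i - offset m (m - 1 - r))\<^sup>2"
      unfolding e by blast
  qed
  then have "F (?t + 1/2) - F (?t - 1/2) = 0"
    using antidiffD(3)[OF F, of ?t] im by simp
  moreover have "?t + 1/2 = y $ Some i + of_nat m / 2 - of_nat r"
    "?t - 1/2 = y $ Some i + of_nat m / 2 - of_nat (Suc r)"
    by simp_all
  ultimately show ?case using Suc by simp
qed simp

text \<open>\<open>E\<close> lists the components of a derivation of degree \<open>d + 2 * n\<close>, and \<open>S\<close> the values \<open>\<kappa>\<close> of the hyperplanes \<open>x\<^sub>i = \<kappa> z\<close>. On the slice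
  \<open>z = 1\<close> the components are the values of an antidifference \<open>F\<close>, except at half-integral coordinates outside \<open>S\<close>, where
  the divisions of the descending induction break down.\<close>

definition solvable :: "('n::finite) itself \<Rightarrow> nat \<Rightarrow> (complex \<Rightarrow> complex) \<Rightarrow> nat \<Rightarrow> complex set \<Rightarrow> bool" where
  "solvable (_ :: ('n::finite) itself) m W d S \<longleftrightarrow>
    (\<forall>n (\<Phi> :: complex ^ 'n option \<Rightarrow> complex poly). even_form n \<Phi> \<longrightarrow>
      (\<exists>E. (\<forall>i. homog (d + 2 * n) (E i)) \<and> (\<forall>i. \<forall>\<kappa>\<in>S. \<forall>y. y $ Some i = \<kappa> * y $ None \<longrightarrow> E i y = 0) \<and>
        (\<forall>y. y $ None = 1 \<longrightarrow> (\<forall>k. 2 * y $ Some k \<in> \<int> \<longrightarrow> y $ Some k \<in> S) \<longrightarrow>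
          (\<exists>F. antidiff m (\<lambda>t. W t * poly (\<Phi> y) (t\<^sup>2)) y F \<and>
             (\<forall>i. Im (y $ Some i) \<noteq> 0 \<longrightarrow> E i y = F (y $ Some i + of_nat m / 2))))))"

lemma solvableE:
  fixes \<Phi> :: "complex ^ ('n::finite) option \<Rightarrow> complex poly"
  assumes "solvable TYPE('n) m W d S" "even_form n \<Phi>"
  obtains E where "\<And>i. homog (d + 2 * n) (E i)"
    "\<And>i \<kappa> y. \<kappa> \<in> S \<Longrightarrow> y $ Some i = \<kappa> * y $ None \<Longrightarrow> E i y = 0"
    "\<And>y. y $ None = 1 \<Longrightarrow> (\<And>k. 2 * y $ Some k \<in> \<int> \<Longrightarrow> y $ Some k \<in> S) \<Longrightarrow>
      \<exists>F. antidiff m (\<lambda>t. W t * poly (\<Phi> y) (t\<^sup>2)) y F \<and>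
             (\<forall>i. Im (y $ Some i) \<noteq> 0 \<longrightarrow> E i y = F (y $ Some i + of_nat m / 2))"
proof -
  from assms(1)[unfolded solvable_def, THEN spec, THEN spec, THEN mp, OF assms(2)]
  obtain E where E: "(\<forall>i. homog (d + 2 * n) (E i)) \<and> (\<forall>i. \<forall>\<kappa>\<in>S. \<forall>y. y $ Some i = \<kappa> * y $ None \<longrightarrow> E i y = 0) \<and>
        (\<forall>y. y $ None = 1 \<longrightarrow> (\<forall>k. 2 * y $ Some k \<in> \<int> \<longrightarrow> y $ Some k \<in> S) \<longrightarrow>
          (\<exists>F. antidiff m (\<lambda>t. W t * poly (\<Phi> y) (t\<^sup>2)) y F \<and>
             (\<forall>i. Im (y $ Some i) \<noteq> 0 \<longrightarrow> E i y = F (y $ Some i + of_nat m / 2))))" ..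
  show ?thesis
    by (rule that[of E]) (use E in simp_all)
qed

definition bvec :: "'n::finite \<Rightarrow> complex \<Rightarrow> complex ^ ('n::finite) option" where
  "bvec k \<kappa> = (\<chi> v. if v = Some k then 1 else if v = None then - \<kappa> else 0)"

lemma dotp_bvec: "dotp (bvec k \<kappa>) y = y $ Some k - \<kappa> * y $ None"
proof -
  have "(\<Sum>j\<in>UNIV. (if Some j = Some k then 1 else if Some j = None then - \<kappa> else 0) * y $ Some j) = y $ Some k"
    by (simp add: if_distrib if_distribR cong: if_cong)
  then show ?thesis by (simp add: dotp_def sum_option bvec_def)
qed

lemma bvec_nonzero: "bvec k \<kappa> \<noteq> 0"
proof
  assume "bvec k \<kappa> = 0"
  then have "bvec k \<kappa> $ Some k = 0" by simp
  then show False by (simp add: bvec_def)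
qed

lemma bvec_separate:
  assumes "k \<noteq> k' \<or> \<kappa> \<noteq> \<kappa>'"
  shows "\<exists>u. dotp (bvec k \<kappa>) u = 0 \<and> dotp (bvec k' \<kappa>') u \<noteq> 0"
  by (rule exI[of _ "\<chi> v. case v of None \<Rightarrow> 1 | Some j \<Rightarrow> if j = k then \<kappa> else \<kappa>' + 1"])
     (use assms in \<open>auto simp: dotp_bvec\<close>)

lemma real_half_int: "2 * x \<in> \<int> \<Longrightarrow> Im x = 0"
  by (auto elim!: Ints_cases simp: complex_eq_iff)

text \<open>On z = 1 write P(t^2) = P(s^2) + (t^2 - s^2) Pt(t^2). Since W P has an antidifference
  with zero components, the components \<open>Et\<close> belonging to (t^2 - s^2) W Pt are - P(s^2)
  times those wanted for W alone. As P(s^2) is a multiple of the product of the removed forms, these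
  arise by dividing \<open>Et\<close>. A general \<open>\<Phi>\<close> is split at s^2 in the same
  way, into a constant multiple of this solution and a solution for the raised weight.\<close>

lemma solvable_lower:
  fixes P :: "complex ^ ('n::finite) option \<Rightarrow> complex poly"
  assumes low: "lowering m W s c P"
    and sol: "solvable TYPE('n) m (\<lambda>t. (t\<^sup>2 - s\<^sup>2) * W t) (d + 2) (S \<union> {c, - c})"
    and c: "2 * c \<in> \<int>" "c \<noteq> 0" "c \<notin> S" "- c \<notin> S"
  shows "solvable TYPE('n) m W d S"
proof -
  let ?N = "CARD('n)" and ?W = "\<lambda>t. (t\<^sup>2 - s\<^sup>2) * W t"
  define S' where "S' = S \<union> {c, - c}"
  define I where "I = (UNIV :: 'n set) \<times> {c, - c}"
  let ?b = "\<lambda>(k, \<kappa>). bvec k \<kappa>"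
  let ?Q = "\<lambda>y :: complex ^ 'n option. \<Prod>p\<in>I. dotp (?b p) y"
  obtain N' where N': "?N = Suc N'" by (metis Suc_pred zero_less_card_finite)
  have cc: "c \<noteq> - c" using c(2) by simp
  have I: "finite I" "card I = 2 * ?N"
    using cc by (simp_all add: I_def card_cartesian_product)
  have Q: "?Q y = (\<Prod>k\<in>UNIV. (y $ Some k)\<^sup>2 - (c * y $ None)\<^sup>2)" for y
  proof -
    have "?Q y = (\<Prod>k\<in>UNIV. \<Prod>\<kappa>\<in>{c, - c}. y $ Some k - \<kappa> * y $ None)"
      unfolding I_def by (subst prod.cartesian_product) (auto simp: dotp_bvec intro!: prod.cong)
    also have "\<dots> = (\<Prod>k\<in>UNIV. (y $ Some k)\<^sup>2 - (c * y $ None)\<^sup>2)"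
      using cc by (intro prod.cong) (auto simp: power2_eq_square algebra_simps)
    finally show ?thesis .
  qed
  from low obtain \<kappa>0 where aeP: "even_form ?N P" and \<kappa>0: "\<kappa>0 \<noteq> 0"
    "\<And>y. poly (P y) ((s * y $ None)\<^sup>2) = \<kappa>0 * (\<Prod>k\<in>UNIV. (c * y $ None)\<^sup>2 - (y $ Some k)\<^sup>2)"
    unfolding lowering_def by blast
  define \<kappa>1 where "\<kappa>1 = \<kappa>0 * (- 1) ^ ?N"
  have \<kappa>1: "\<kappa>1 \<noteq> 0" using \<kappa>0 by (simp add: \<kappa>1_def)
  have p0: "poly (P y) ((s * y $ None)\<^sup>2) = \<kappa>1 * ?Q y" for y
  proof -
    have "(\<Prod>k\<in>UNIV. (c * y $ None)\<^sup>2 - (y $ Some k)\<^sup>2) = (\<Prod>k\<in>UNIV. (- 1) * ((y $ Some k)\<^sup>2 - (c * y $ None)\<^sup>2))"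
      by (intro prod.cong) auto
    also have "\<dots> = (- 1) ^ ?N * ?Q y"
      unfolding Q prod.distrib by simp
    finally show ?thesis unfolding \<kappa>0(2) \<kappa>1_def by simp
  qed
  have H: "\<exists>H. antidiff m (\<lambda>t. W t * poly (P y) (t\<^sup>2)) y H \<and> (\<forall>k. H (y $ Some k + of_nat m / 2) = 0)"
    if "y $ None = 1" for y
    using low that unfolding lowering_def antidiff_def by blast
  have hps: "homog 2 (\<lambda>y :: complex ^ 'n option. (s * y $ None)\<^sup>2)"
    by (intro homog_square homog_cmult) simp
  define Pt where "Pt y = synthetic_div (P y) ((s * y $ None)\<^sup>2)" for y
  have "even_form N' Pt"
    unfolding Pt_def[abs_def] using aeP hps by (intro even_form_synthetic_div) (simp_all add: N')
  with sol obtain Et where Et: "\<And>i. homog (d + 2 + 2 * N') (Et i)"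
    "\<And>i \<kappa> y. \<kappa> \<in> S' \<Longrightarrow> y $ Some i = \<kappa> * y $ None \<Longrightarrow> Et i y = 0"
    "\<And>y. y $ None = 1 \<Longrightarrow> (\<And>k. 2 * y $ Some k \<in> \<int> \<Longrightarrow> y $ Some k \<in> S') \<Longrightarrow>
      \<exists>F. antidiff m (\<lambda>t. ?W t * poly (Pt y) (t\<^sup>2)) y F \<and>
             (\<forall>i. Im (y $ Some i) \<noteq> 0 \<longrightarrow> Et i y = F (y $ Some i + of_nat m / 2))"
    unfolding S'_def by (rule solvableE) blast
  have Psplit: "W t * poly (P y) (t\<^sup>2) = \<kappa>1 * ?Q y * W t + ?W t * poly (Pt y) (t\<^sup>2)" if "y $ None = 1" for y t
  proof -
    have "poly (P y) (t\<^sup>2) = poly (P y) ((s * y $ None)\<^sup>2) + (t\<^sup>2 - (s * y $ None)\<^sup>2) * poly (Pt y) (t\<^sup>2)"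
      unfolding Pt_def by (rule poly_synthetic_div)
    then have e: "poly (P y) (t\<^sup>2) = \<kappa>1 * ?Q y + (t\<^sup>2 - s\<^sup>2) * poly (Pt y) (t\<^sup>2)"
      unfolding p0 using that by simp
    show ?thesis unfolding e by (simp only: distrib_left mult_ac)
  qed
  \<comment> \<open>For \<open>i = k\<close> the vanishing is part of the hypothesis. Otherwise
    P(s^2) = 0 on this hyperplane, so \<open>F\<close> and \<open>h\<close> are antidifferences of
    the same function, and \<open>h\<close> has zero components.\<close>
  have Et0: "Et i y = 0" if \<kappa>: "\<kappa> \<in> {c, - c}" and yk: "dotp (bvec k \<kappa>) y = 0" for i k \<kappa> y
  proof (cases "i = k")
    case True
    have "\<kappa> \<in> S'" using \<kappa> by (auto simp: S'_def)
    then show ?thesis using Et(2)[of \<kappa> y i] yk True by (simp add: dotp_bvec)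
  next
    case False
    show ?thesis
    \<comment> \<open>Coordinate \<open>k\<close> has to keep the half-integral value
      \<open>\<kappa>\<close>, which is admissible because it lies in \<open>S'\<close>; all others
      are made nonreal.\<close>
    proof (rule hyperplane_extension[OF Et(1), of "bvec k \<kappa>" "\<chi> v. case v of None \<Rightarrow> 0 | Some j \<Rightarrow> if j = k then 0 else 1"
          "\<chi> v. case v of None \<Rightarrow> 1 | Some j \<Rightarrow> \<kappa>"])
      fix y :: "complex ^ 'n option"
      assume y: "dotp (bvec k \<kappa>) y = 0" "y $ None = 1"
        and im: "\<And>j. (\<chi> v. case v of None \<Rightarrow> 0 | Some j \<Rightarrow> if j = k then 0 else (1::complex)) $ Some j \<noteq> 0 \<Longrightarrow> Im (y $ Some j) \<noteq> 0"
      have yk: "y $ Some k = \<kappa>" using y by (simp add: dotp_bvec)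
      have im': "Im (y $ Some j) \<noteq> 0" if "j \<noteq> k" for j using im[of j] that by simp
      have "y $ Some j \<in> S'" if "2 * y $ Some j \<in> \<int>" for j
        using real_half_int[OF that] im'[of j] yk \<kappa> by (cases "j = k") (auto simp: S'_def)
      from Et(3)[OF y(2) this] obtain F where F: "antidiff m (\<lambda>t. ?W t * poly (Pt y) (t\<^sup>2)) y F"
        "\<And>i. Im (y $ Some i) \<noteq> 0 \<Longrightarrow> Et i y = F (y $ Some i + of_nat m / 2)" by blast
      obtain h where h: "antidiff m (\<lambda>t. W t * poly (P y) (t\<^sup>2)) y h" "\<And>k. h (y $ Some k + of_nat m / 2) = 0"
        using H[OF y(2)] by blast
      have "(k, \<kappa>) \<in> I" using \<kappa> by (simp add: I_def)
      then have "?Q y = 0" using y(1) I(1) by (intro prod_zero bexI[of _ "(k, \<kappa>)"]) auto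
      then have "antidiff m (\<lambda>t. ?W t * poly (Pt y) (t\<^sup>2)) y h"
        using Psplit[OF y(2)] by (intro antidiff_cong[OF h(1)]) simp
      from antidiff_unique[OF F(1) this, of "y $ Some i + of_nat m / 2"]
      show "Et i y = 0" using F(2)[OF im'[OF False]] im'[OF False] h(2)[of i] by simp
    qed (use yk in \<open>simp_all add: dotp_bvec split: if_splits\<close>)
  qed
  have "\<exists>q. polyfun q \<and> (\<forall>y. Et i y = ?Q y * q y)" for i
  proof (rule polyfun_prod_linform_factor[OF I(1) homog_polyfun[OF Et(1)]])
    show "?b p \<noteq> 0" for p by (cases p) (simp add: bvec_nonzero)
    show "Et i y = 0" if "p \<in> I" "dotp (?b p) y = 0" for p y
      using that Et0 by (cases p) (auto simp: I_def)
    show "\<exists>u. dotp (?b p) u = 0 \<and> dotp (?b p') u \<noteq> 0" if "p \<noteq> p'" for p p'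
      using that bvec_separate[of "fst p" "fst p'" "snd p" "snd p'"] by (cases p, cases p') auto
  qed
  then obtain q where q: "\<And>i. polyfun (q i)" "\<And>i y. Et i y = ?Q y * q i y" by metis
  have hq: "homog d (q i)" for i
  proof (rule homog_quotient[OF I(1) _ _ q(1) q(2)])
    show "?b p \<noteq> 0" for p by (cases p) (simp add: bvec_nonzero)
    show "homog (d + card I) (Et i)" using Et(1)[of i] by (simp add: I(2) N')
  qed
  define E0 where "E0 i y = (- 1 / \<kappa>1) * q i y" for i y
  have hE0: "homog d (E0 i)" for i unfolding E0_def[abs_def] by (intro homog_cmult hq)
  have E0: "?Q y * E0 i y = (- 1 / \<kappa>1) * Et i y" for i y
    by (simp add: E0_def q(2))
  have E0_vanish: "E0 i y = 0" if \<kappa>: "\<kappa> \<in> S" and y: "y $ Some i = \<kappa> * y $ None" for i \<kappa> y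
  proof (rule prod_linform_cancel_on[of "{y. dotp (bvec i \<kappa>) y = 0}" I "E0 i" ?b])
    show "\<exists>u\<in>{y. dotp (bvec i \<kappa>) y = 0}. dotp (?b p) u \<noteq> 0" if p: "p \<in> I" for p
    proof -
      obtain k' \<kappa>' where p': "p = (k', \<kappa>')" by (cases p)
      then have "\<kappa> \<noteq> \<kappa>'" using p c \<kappa> by (auto simp: I_def)
      then show ?thesis using bvec_separate[of i k' \<kappa> \<kappa>'] p' by auto
    qed
    show "?Q y * E0 i y = 0" if "y \<in> {y. dotp (bvec i \<kappa>) y = 0}" for y
      unfolding E0 using Et(2)[of \<kappa> y i] \<kappa> that by (simp add: S'_def dotp_bvec)
  qed (use I homog_polyfun[OF hE0] y in \<open>auto simp: dotp_bvec algebra_simps\<close>)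
  show ?thesis
    unfolding solvable_def
  proof (intro allI impI)
    fix n and \<Phi> :: "complex ^ 'n option \<Rightarrow> complex poly"
    assume \<Phi>: "even_form n \<Phi>"
    define \<Phi>t where "\<Phi>t y = synthetic_div (\<Phi> y) ((s * y $ None)\<^sup>2)" for y
    have "\<exists>E. (\<forall>i. homog (d + 2 * n) (E i)) \<and> (\<forall>i. \<forall>\<kappa>\<in>S. \<forall>y. y $ Some i = \<kappa> * y $ None \<longrightarrow> E i y = 0) \<and>
       (\<forall>y. y $ None = 1 \<longrightarrow> (\<forall>k. 2 * y $ Some k \<in> \<int> \<longrightarrow> y $ Some k \<in> S') \<longrightarrow>
      (\<exists>F. antidiff m (\<lambda>t. ?W t * poly (\<Phi>t y) (t\<^sup>2)) y F \<and>
             (\<forall>i. Im (y $ Some i) \<noteq> 0 \<longrightarrow> E i y = F (y $ Some i + of_nat m / 2))))"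
    proof (cases n)
      \<comment> \<open>A form of degree 0 is constant in t, so the quotient is 0 and the zero
        family solves it.\<close>
      case 0
      then have "\<Phi>t y = 0" for y using even_form_0_synthetic_div \<Phi> by (simp add: \<Phi>t_def)
      then show ?thesis
        by (intro exI[of _ "\<lambda>i y. 0"]) (auto intro!: exI[of _ "\<lambda>t. 0"] simp: antidiff_zero)
    next
      case (Suc n')
      then have "even_form n' \<Phi>t" unfolding \<Phi>t_def[abs_def] using \<Phi> hps by (intro even_form_synthetic_div) simp_all
      with sol obtain E where E: "\<And>i. homog (d + 2 + 2 * n') (E i)"
        "\<And>i \<kappa> y. \<kappa> \<in> S' \<Longrightarrow> y $ Some i = \<kappa> * y $ None \<Longrightarrow> E i y = 0"
        "\<And>y. y $ None = 1 \<Longrightarrow> (\<And>k. 2 * y $ Some k \<in> \<int> \<Longrightarrow> y $ Some k \<in> S') \<Longrightarrow>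
          \<exists>F. antidiff m (\<lambda>t. ?W t * poly (\<Phi>t y) (t\<^sup>2)) y F \<and>
             (\<forall>i. Im (y $ Some i) \<noteq> 0 \<longrightarrow> E i y = F (y $ Some i + of_nat m / 2))"
        unfolding S'_def by (rule solvableE) blast
      have "homog (d + 2 * n) (E i)" for i using E(1)[of i] Suc by simp
      with E(2,3) show ?thesis
        by (intro exI[of _ E]) (auto simp: S'_def)
    qed
    then obtain E where E: "\<And>i. homog (d + 2 * n) (E i)"
        "\<And>i \<kappa> y. \<kappa> \<in> S \<Longrightarrow> y $ Some i = \<kappa> * y $ None \<Longrightarrow> E i y = 0"
        "\<And>y. y $ None = 1 \<Longrightarrow> (\<And>k. 2 * y $ Some k \<in> \<int> \<Longrightarrow> y $ Some k \<in> S') \<Longrightarrow>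
          \<exists>F. antidiff m (\<lambda>t. ?W t * poly (\<Phi>t y) (t\<^sup>2)) y F \<and>
             (\<forall>i. Im (y $ Some i) \<noteq> 0 \<longrightarrow> E i y = F (y $ Some i + of_nat m / 2))"
      by blast
    define \<phi> where "\<phi> y = poly (\<Phi> y) ((s * y $ None)\<^sup>2)" for y
    have h\<phi>: "homog (2 * n) \<phi>" unfolding \<phi>_def[abs_def] by (rule even_form_poly[OF \<Phi> hps])
    show "\<exists>E. (\<forall>i. homog (d + 2 * n) (E i)) \<and> (\<forall>i. \<forall>\<kappa>\<in>S. \<forall>y. y $ Some i = \<kappa> * y $ None \<longrightarrow> E i y = 0) \<and>
       (\<forall>y. y $ None = 1 \<longrightarrow> (\<forall>k. 2 * y $ Some k \<in> \<int> \<longrightarrow> y $ Some k \<in> S) \<longrightarrow>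
      (\<exists>F. antidiff m (\<lambda>t. W t * poly (\<Phi> y) (t\<^sup>2)) y F \<and>
             (\<forall>i. Im (y $ Some i) \<noteq> 0 \<longrightarrow> E i y = F (y $ Some i + of_nat m / 2))))"
    proof (intro exI[of _ "\<lambda>i y. E0 i y * \<phi> y + E i y"] conjI allI ballI impI)
      show "homog (d + 2 * n) (\<lambda>y. E0 i y * \<phi> y + E i y)" for i
        by (intro homog_add homog_mult hE0 h\<phi> E(1))
      show "E0 i y * \<phi> y + E i y = 0" if "\<kappa> \<in> S" "y $ Some i = \<kappa> * y $ None" for i \<kappa> y
        using E0_vanish[OF that] E(2)[OF that] by simp
      fix y :: "complex ^ 'n option"
      assume y: "y $ None = 1" and good: "\<forall>k. 2 * y $ Some k \<in> \<int> \<longrightarrow> y $ Some k \<in> S"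
      then have good': "y $ Some k \<in> S'" if "2 * y $ Some k \<in> \<int>" for k
        using that by (simp add: S'_def)
      \<comment> \<open>The half-integers c and - c lie outside \<open>S\<close>, so an admissible
        point avoids all removed hyperplanes and the division is legitimate there.\<close>
      have "2 * (- c) \<in> \<int>" using Ints_minus[OF c(1)] by simp
      then have "y $ Some k \<noteq> c" "y $ Some k \<noteq> - c" for k
        using good c by metis+
      then have "(y $ Some k)\<^sup>2 - (c * y $ None)\<^sup>2 \<noteq> 0" for k
        using y by (simp add: power2_eq_iff)
      then have Qy: "?Q y \<noteq> 0" unfolding Q by simp
      define p where "p = \<kappa>1 * ?Q y"
      have p: "p \<noteq> 0" using Qy \<kappa>1 by (simp add: p_def)
      obtain F where F: "antidiff m (\<lambda>t. ?W t * poly (\<Phi>t y) (t\<^sup>2)) y F"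
        "\<And>i. Im (y $ Some i) \<noteq> 0 \<Longrightarrow> E i y = F (y $ Some i + of_nat m / 2)"
        using E(3)[OF y good'] by blast
      obtain Ft where Ft: "antidiff m (\<lambda>t. ?W t * poly (Pt y) (t\<^sup>2)) y Ft"
        "\<And>i. Im (y $ Some i) \<noteq> 0 \<Longrightarrow> Et i y = Ft (y $ Some i + of_nat m / 2)"
        using Et(3)[OF y good'] by blast
      obtain h where h: "antidiff m (\<lambda>t. W t * poly (P y) (t\<^sup>2)) y h" "\<And>k. h (y $ Some k + of_nat m / 2) = 0"
        using H[OF y] by blast
      \<comment> \<open>\<open>Psplit\<close> solved for the weight \<open>W\<close> itself.\<close>
      define F0 where "F0 t = 1 / p * h t + (- 1 / p) * Ft t" for t
      have F0: "antidiff m W y F0"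
        unfolding F0_def[abs_def] using Psplit[OF y] p
        by (intro antidiff_cong[OF antidiff_combine[OF h(1) Ft(1)]]) (simp add: p_def[symmetric] field_simps)
      have "antidiff m (\<lambda>t. W t * poly (\<Phi> y) (t\<^sup>2)) y (\<lambda>t. \<phi> y * F0 t + 1 * F t)"
      proof (rule antidiff_cong[OF antidiff_combine[OF F0 F(1)]])
        fix t
        have "poly (\<Phi> y) (t\<^sup>2) = \<phi> y + (t\<^sup>2 - (s * y $ None)\<^sup>2) * poly (\<Phi>t y) (t\<^sup>2)"
          unfolding \<phi>_def \<Phi>t_def by (rule poly_synthetic_div)
        then have e: "poly (\<Phi> y) (t\<^sup>2) = \<phi> y + (t\<^sup>2 - s\<^sup>2) * poly (\<Phi>t y) (t\<^sup>2)"
          using y by simp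
        show "\<phi> y * W t + 1 * (?W t * poly (\<Phi>t y) (t\<^sup>2)) = W t * poly (\<Phi> y) (t\<^sup>2)"
          unfolding e by (simp only: distrib_left mult_1 mult_ac)
      qed
      moreover have "E0 i y * \<phi> y + E i y = \<phi> y * F0 (y $ Some i + of_nat m / 2) + 1 * F (y $ Some i + of_nat m / 2)"
        if "Im (y $ Some i) \<noteq> 0" for i
      proof -
        have "F0 (y $ Some i + of_nat m / 2) = (- 1 / p) * Et i y"
          unfolding F0_def h(2) Ft(2)[OF that] by simp
        moreover have "E0 i y = (- 1 / p) * Et i y"
          using E0[of y i] Qy \<kappa>1 by (simp add: p_def field_simps)
        ultimately have "E0 i y = F0 (y $ Some i + of_nat m / 2)" by simp
        then show ?thesis using F(2)[OF that] by simp
      qed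
      ultimately show "\<exists>F. antidiff m (\<lambda>t. W t * poly (\<Phi> y) (t\<^sup>2)) y F \<and>
             (\<forall>i. Im (y $ Some i) \<noteq> 0 \<longrightarrow> E0 i y * \<phi> y + E i y = F (y $ Some i + of_nat m / 2))"
        by blast
    qed
  qed
qed

text \<open>At a point with nonreal coordinates this says that no nontrivial combination of the
  derivations for the powers t^(2l), with l below the number of variables, vanishes: their
  determinant is nonzero. Stated through antidifferences, it can be compared between
  weights.\<close>

definition nondegenerate :: "nat \<Rightarrow> (complex \<Rightarrow> complex) \<Rightarrow> complex ^ ('n::finite) option \<Rightarrow> bool" where
  "nondegenerate m W y \<longleftrightarrow> (\<forall>C F. degree C < CARD('n) \<longrightarrow> antidiff m (\<lambda>t. W t * poly C (t\<^sup>2)) y F \<longrightarrow>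
     (\<forall>i. F (y $ Some i + of_nat m / 2) = 0) \<longrightarrow> C = 0)"

lemma nondegenerateD:
  fixes y :: "complex ^ ('n::finite) option"
  assumes "nondegenerate m W y" "degree C < CARD('n)" "antidiff m (\<lambda>t. W t * poly C (t\<^sup>2)) y F"
    "\<And>i. F (y $ Some i + of_nat m / 2) = 0"
  shows "C = 0"
  using assms unfolding nondegenerate_def by blast

text \<open>Let N be the number of variables. In the polynomials of degree at most N, both those of
  degree below N and the multiples of T - s^2 are complements of the line spanned by
  \<open>P y\<close>, because \<open>P y\<close> has degree N and does not vanish at s^2. Adding
  multiples of \<open>P y\<close> does not change the values at the sample points, since
  \<open>H\<close> vanishes there.\<close>

lemma nondegenerate_lowering_iff:
  fixes y :: "complex ^ ('n::finite) option" and P :: "complex ^ 'n option \<Rightarrow> complex poly"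
  assumes low: "lowering m W s c P" and c: "Im c = 0" and y: "y $ None = 1" "\<And>k. Im (y $ Some k) \<noteq> 0"
  shows "nondegenerate m (\<lambda>t. (t\<^sup>2 - s\<^sup>2) * W t) y \<longleftrightarrow> nondegenerate m W y"
proof -
  let ?N = "CARD('n)"
  from low obtain \<kappa>0 where aeP: "even_form ?N P" and \<kappa>0: "\<kappa>0 \<noteq> 0"
    "poly (P y) ((s * y $ None)\<^sup>2) = \<kappa>0 * (\<Prod>k\<in>UNIV. (c * y $ None)\<^sup>2 - (y $ Some k)\<^sup>2)"
    and top: "coeff (P y) ?N \<noteq> 0"
    unfolding lowering_def by blast
  have "c\<^sup>2 - (y $ Some k)\<^sup>2 \<noteq> 0" for k
    using square_diff_real_nonzero[OF y(2)[of k] c] by simp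
  then have p0: "poly (P y) (s\<^sup>2) \<noteq> 0"
    using \<kappa>0 y(1) by simp
  obtain H where H: "antidiff m (\<lambda>t. W t * poly (P y) (t\<^sup>2)) y H" "\<And>k. H (y $ Some k + of_nat m / 2) = 0"
    using low y unfolding lowering_def antidiff_def by blast
  have degP: "degree (P y) \<le> ?N" using even_form_degree[OF aeP] .
  have N0: "?N > 0" by simp
  have comb: "antidiff m (\<lambda>t. W t * poly (D - smult \<mu> (P y)) (t\<^sup>2)) y (\<lambda>t. 1 * F t + (- \<mu>) * H t)"
    if "antidiff m (\<lambda>t. W t * poly D (t\<^sup>2)) y F" for D F \<mu>
    by (rule antidiff_cong[OF antidiff_combine[OF that H(1)]]) (simp add: algebra_simps)
  show ?thesis
  proof
    assume nd: "nondegenerate m (\<lambda>t. (t\<^sup>2 - s\<^sup>2) * W t) y"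
    show "nondegenerate m W y"
      unfolding nondegenerate_def
    proof (intro allI impI)
      fix C F assume C: "degree C < ?N" and F: "antidiff m (\<lambda>t. W t * poly C (t\<^sup>2)) y F"
        "\<forall>i. F (y $ Some i + of_nat m / 2) = 0"
      define \<mu> where "\<mu> = poly C (s\<^sup>2) / poly (P y) (s\<^sup>2)"
      define C2 where "C2 = C - smult \<mu> (P y)"
      define C3 where "C3 = synthetic_div C2 (s\<^sup>2)"
      have C2s: "poly C2 (s\<^sup>2) = 0" using p0 by (simp add: C2_def \<mu>_def)
      have "degree C2 \<le> ?N"
        unfolding C2_def using C degP by (intro degree_diff_le) (auto intro: order_trans[OF degree_smult_le])
      moreover have "degree C3 = degree C2 - 1" by (simp add: C3_def degree_synthetic_div)
      ultimately have "degree C3 < ?N" using N0 by linarith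
      moreover have "antidiff m (\<lambda>t. (t\<^sup>2 - s\<^sup>2) * W t * poly C3 (t\<^sup>2)) y (\<lambda>t. 1 * F t + (- \<mu>) * H t)"
        using poly_synthetic_div[of C2 _ "s\<^sup>2"] C2s
        by (intro antidiff_cong[OF comb[OF F(1)]]) (simp add: C3_def C2_def[symmetric])
      moreover have "1 * F (y $ Some i + of_nat m / 2) + (- \<mu>) * H (y $ Some i + of_nat m / 2) = 0" for i
        using F(2) H(2) by simp
      ultimately have "C3 = 0" by (rule nondegenerateD[OF nd])
      then have "C2 = 0" using synthetic_div_correct'[of "s\<^sup>2" C2] C2s by (simp add: C3_def)
      then have e: "C = smult \<mu> (P y)" by (simp add: C2_def)
      have "coeff C ?N = 0" using C by (rule coeff_eq_0)
      then have "\<mu> * coeff (P y) ?N = 0" unfolding e by simp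
      then have "\<mu> = 0" using top by simp
      then show "C = 0" using e by simp
    qed
  next
    assume nd: "nondegenerate m W y"
    show "nondegenerate m (\<lambda>t. (t\<^sup>2 - s\<^sup>2) * W t) y"
      unfolding nondegenerate_def
    proof (intro allI impI)
      fix C F assume C: "degree C < ?N" and F: "antidiff m (\<lambda>t. (t\<^sup>2 - s\<^sup>2) * W t * poly C (t\<^sup>2)) y F"
        "\<forall>i. F (y $ Some i + of_nat m / 2) = 0"
      define C1 where "C1 = [:- s\<^sup>2, 1:] * C"
      have F1: "antidiff m (\<lambda>t. W t * poly C1 (t\<^sup>2)) y F"
        by (rule antidiff_cong[OF F(1)]) (simp add: C1_def algebra_simps)
      define \<mu> where "\<mu> = coeff C1 ?N / coeff (P y) ?N"
      define C2 where "C2 = C1 - smult \<mu> (P y)"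
      have "degree C1 \<le> ?N"
        unfolding C1_def using C degree_mult_le[of "[:- s\<^sup>2, 1:]" C] by simp
      then have "degree C2 \<le> ?N"
        unfolding C2_def using degP by (intro degree_diff_le) (auto intro: order_trans[OF degree_smult_le])
      moreover have "coeff C2 ?N = 0" using top by (simp add: C2_def \<mu>_def)
      ultimately have "degree C2 < ?N"
        using N0 by (metis degree_0 le_neq_implies_less leading_coeff_0_iff)
      moreover have "antidiff m (\<lambda>t. W t * poly C2 (t\<^sup>2)) y (\<lambda>t. 1 * F t + (- \<mu>) * H t)"
        unfolding C2_def by (rule comb[OF F1])
      moreover have "1 * F (y $ Some i + of_nat m / 2) + (- \<mu>) * H (y $ Some i + of_nat m / 2) = 0" for i
        using F(2) H(2) by simp
      ultimately have "C2 = 0" by (rule nondegenerateD[OF nd])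
      then have e: "C1 = smult \<mu> (P y)" by (simp add: C2_def)
      have "poly C1 (s\<^sup>2) = 0" by (simp add: C1_def)
      then have "\<mu> = 0" using p0 by (simp add: e)
      then have "C1 = 0" using e by simp
      then show "C = 0" unfolding C1_def mult_eq_0_iff by simp
    qed
  qed
qed

section \<open>Large multiplicities and nondegeneracy\<close>

definition cat_set :: "nat \<Rightarrow> nat \<Rightarrow> complex set" where
  "cat_set a b = of_int ` {- int a..int a} \<union> (\<lambda>j. of_int j - 1/2) ` {1 - int b..int b}"

lemma cat_set_half_nat:
  assumes "\<kappa> \<in> cat_set a b"
  obtains K where "\<kappa> = of_nat K / 2 \<or> \<kappa> = - (of_nat K / 2)" "even K \<Longrightarrow> K \<le> 2 * a" "odd K \<Longrightarrow> K + 1 \<le> 2 * b"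
proof -
  from assms consider j where "\<kappa> = of_int j" "- int a \<le> j" "j \<le> int a"
    | j where "\<kappa> = of_int j - 1/2" "1 - int b \<le> j" "j \<le> int b"
    by (auto simp: cat_set_def)
  then show ?thesis
  proof cases
    case 1
    show ?thesis
    proof (rule that[of "2 * nat \<bar>j\<bar>"])
      show "\<kappa> = of_nat (2 * nat \<bar>j\<bar>) / 2 \<or> \<kappa> = - (of_nat (2 * nat \<bar>j\<bar>) / 2)"
        using 1 by (cases "j \<ge> 0") simp_all
    qed (use 1 in auto)
  next
    case 2
    show ?thesis
    proof (rule that[of "nat \<bar>2 * j - 1\<bar>"])
      show "\<kappa> = of_nat (nat \<bar>2 * j - 1\<bar>) / 2 \<or> \<kappa> = - (of_nat (nat \<bar>2 * j - 1\<bar>) / 2)"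
        using 2 by (cases "j \<ge> 1") (simp_all add: field_simps)
    qed (use 2 in \<open>auto simp: even_nat_iff\<close>)
  qed
qed

lemma cat_set_Suc:
  "cat_set (Suc a) b = cat_set a b \<union> {of_nat a + 1, - (of_nat a + 1)}"
  "cat_set a (Suc b) = cat_set a b \<union> {of_nat b + 1/2, - (of_nat b + 1/2)}"
proof -
  have 1: "{- int (Suc a)..int (Suc a)} = {- int a..int a} \<union> {int a + 1, - (int a + 1)}" by auto
  show "cat_set (Suc a) b = cat_set a b \<union> {of_nat a + 1, - (of_nat a + 1)}"
    unfolding cat_set_def 1 image_Un by auto
  have 2: "{1 - int (Suc b)..int (Suc b)} = {1 - int b..int b} \<union> {int b + 1, - int b}" by auto
  have "(\<lambda>j. of_int j - 1/2) ` {int b + 1, - int b} = {of_nat b + 1/2, - (of_nat b + 1/2 :: complex)}"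
    by (simp add: add.commute)
  then show "cat_set a (Suc b) = cat_set a b \<union> {of_nat b + 1/2, - (of_nat b + 1/2)}"
    unfolding cat_set_def 2 image_Un by (simp only: Un_assoc)
qed

lemma of_int_neq_half_int: "(of_int i :: complex) \<noteq> of_int j - 1/2"
proof
  assume "(of_int i :: complex) = of_int j - 1/2"
  then have "(of_int (2 * i) :: complex) = of_int (2 * j - 1)" by simp
  then have "2 * i = 2 * j - 1" by (simp only: of_int_eq_iff)
  then show False by presburger
qed

lemma cat_set_notin:
  "of_nat a + 1 \<notin> cat_set a b" "- (of_nat a + 1) \<notin> cat_set a b"
  "of_nat b + 1/2 \<notin> cat_set a b" "- (of_nat b + 1/2) \<notin> cat_set a b"
proof -
  have e: "(of_nat a + 1 :: complex) = of_int (int a + 1)" "(- (of_nat a + 1) :: complex) = of_int (- (int a + 1))"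
    "(of_nat b + 1/2 :: complex) = of_int (int b + 1) - 1/2" "(- (of_nat b + 1/2) :: complex) = of_int (- int b) - 1/2"
    by simp_all
  have mi: "of_int i \<in> cat_set a b \<longleftrightarrow> - int a \<le> i \<and> i \<le> int a" for i
    using of_int_neq_half_int unfolding cat_set_def by auto
  have mh: "of_int i - 1/2 \<in> cat_set a b \<longleftrightarrow> 1 - int b \<le> i \<and> i \<le> int b" for i
    using of_int_neq_half_int[symmetric] unfolding cat_set_def by auto
  show "of_nat a + 1 \<notin> cat_set a b" by (subst e(1), subst mi) simp
  show "- (of_nat a + 1) \<notin> cat_set a b" by (subst e(2), subst mi) simp
  show "of_nat b + 1/2 \<notin> cat_set a b" by (subst e(3), subst mh) simp
  show "- (of_nat b + 1/2) \<notin> cat_set a b" by (subst e(4), subst mh) simp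
qed

text \<open>The numbers \<open>t\<close> are the midpoints in the gap between the windows around -
  K/2 and K/2. They are symmetric about 0 with step 1: the nonnegative ones are zeros of the weight
  directly, the others by reflection, and the parity of \<open>K\<close> decides which family of
  zeros is met.\<close>

lemma weight_covers_gap:
  assumes r: "m \<le> r" "r < K" and K: "even K \<Longrightarrow> K \<le> 2 * a" "odd K \<Longrightarrow> K + 1 \<le> 2 * b"
    and t: "t = of_nat r + 1/2 - (of_nat K + of_nat m) / 2"
  shows "(\<exists>j\<in>{m div 2..<a}. t\<^sup>2 = (offset m j)\<^sup>2) \<or> (\<exists>j\<in>{(m + 1) div 2..<b}. t\<^sup>2 = (offset m j - 1/2)\<^sup>2)"
proof (cases "even K")
  case True
  then obtain h where h: "K = 2 * h" by (elim evenE)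
  show ?thesis
  proof (cases "2 * r + 1 \<ge> K + m")
    case True
    then have "h \<le> r" using h by simp
    then obtain j where j: "r = h + j" by (auto simp: le_iff_add)
    have "t = offset m j" by (simp add: t h j offset_def field_simps)
    moreover have "j \<in> {m div 2..<a}" using True r K h j by auto
    ultimately show ?thesis by blast
  next
    case False
    then have "r + 1 \<le> h + m" using h by simp
    then obtain j where j: "h + m = r + 1 + j" by (auto simp: le_iff_add)
    have "of_nat (h + m) = (of_nat (r + 1 + j) :: complex)" unfolding j ..
    then have hc: "of_nat h = of_nat r + 1 + (of_nat j :: complex) - of_nat m" by (simp add: algebra_simps)
    have "t = - offset m j" by (simp add: t h hc offset_def field_simps)
    moreover have "j \<in> {m div 2..<a}" using False r K h j by auto
    ultimately show ?thesis by (metis power2_minus)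
  qed
next
  case False
  then obtain h where h: "K = 2 * h + 1" by (elim oddE)
  show ?thesis
  proof (cases "2 * r + 1 \<ge> K + m")
    case True
    then have "h \<le> r" using h by simp
    then obtain j where j: "r = h + j" by (auto simp: le_iff_add)
    have "t = offset m j - 1/2" by (simp add: t h j offset_def field_simps)
    moreover have "j \<in> {(m + 1) div 2..<b}" using True r K h j by auto
    ultimately show ?thesis by blast
  next
    case False
    then have "r \<le> h + m" using h by simp
    then obtain j where j: "h + m = r + j" by (auto simp: le_iff_add)
    have "of_nat (h + m) = (of_nat (r + j) :: complex)" unfolding j ..
    then have hc: "of_nat h = of_nat r + (of_nat j :: complex) - of_nat m" by (simp add: algebra_simps)
    have "t = - (offset m j - 1/2)" by (simp add: t h hc offset_def field_simps)
    moreover have "j \<in> {(m + 1) div 2..<b}" using False r K h j by auto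
    ultimately show ?thesis by (metis power2_minus)
  qed
qed

text \<open>Telescoping from u = -(K + m)/2 over K + m steps ends at - u, so oddness gives F(u) = 0.
  Stopping after K steps reaches minus the second point.\<close>

lemma odd_sum_vanishes:
  fixes F G :: "complex \<Rightarrow> complex"
  assumes odd: "\<And>t. F (- t) = - F t" and diff: "\<And>t. F (t + 1/2) - F (t - 1/2) = G t"
    and G: "\<And>r. r < K + m \<Longrightarrow> G (of_nat r + 1/2 - (of_nat K + of_nat m) / 2) = 0"
  shows "F (of_nat K / 2 + of_nat m / 2) = 0" "F (- (of_nat K / 2) + of_nat m / 2) = 0"
proof -
  define u :: complex where "u = - ((of_nat K + of_nat m) / 2)"
  have step: "F (u + of_nat r + 1) = F (u + of_nat r)" if "r < K + m" for r
  proof -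
    have "F (u + of_nat r + 1) - F (u + of_nat r) = G (of_nat r + 1/2 - (of_nat K + of_nat m) / 2)"
      using diff[of "u + of_nat r + 1/2"] by (simp add: u_def algebra_simps)
    then show ?thesis using G[OF that] by simp
  qed
  have "F (u + of_nat (K + m)) = F u"
    by (rule telescope_const) (rule step)
  moreover have e: "u + of_nat (K + m) = - u" by (simp add: u_def field_simps)
  ultimately have u0: "F u = 0" unfolding e odd by simp
  then show "F (of_nat K / 2 + of_nat m / 2) = 0"
    using odd[of u] by (simp add: u_def add_divide_distrib add.commute)
  have "F (u + of_nat K) = F u"
    by (rule telescope_const) (rule step, simp)
  moreover have e': "u + of_nat K = - (- (of_nat K / 2) + of_nat m / 2)" by (simp add: u_def field_simps)
  ultimately show "F (- (of_nat K / 2) + of_nat m / 2) = 0"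
    unfolding e' odd u0 by simp
qed

text \<open>Here the denominator of the weight cancels, and a homogeneous polynomial antidifference
  exists for every \<open>\<Phi>\<close>. What remains is the vanishing on x_i =
  \<open>\<kappa>\<close> z, by telescoping over two windows and the gap between them.\<close>

lemma solvable_base:
  assumes a: "m div 2 \<le> a" and b: "(m + 1) div 2 \<le> b" and d: "d + 2 * m = 2 * a + 2 * b + 2 * m * CARD('n::finite) + 1"
  shows "solvable TYPE('n) m (weight m a b) d (cat_set a b)"
  unfolding solvable_def
proof (intro allI impI)
  fix n and \<Phi> :: "complex ^ 'n option \<Rightarrow> complex poly"
  assume \<Phi>: "even_form n \<Phi>"
  let ?A = "m div 2" and ?B = "(m + 1) div 2" and ?N = "CARD('n)"
  \<comment> \<open>The factors of the weight that survive the cancellation, made homogeneous by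
    z.\<close>
  define V where "V y = (\<Prod>j\<in>{?A..<a}. [:- (offset m j * y $ None)\<^sup>2, 1:]) * (\<Prod>j\<in>{?B..<b}. [:- ((offset m j - 1/2) * y $ None)\<^sup>2, 1:])"
    for y :: "complex ^ 'n option"
  obtain \<Gamma> :: "complex ^ 'n option \<Rightarrow> complex poly"
    where \<Gamma>: "even_form (?N * m) \<Gamma>" "\<And>y t. poly (\<Gamma> y) (t\<^sup>2) = pair_factor m y t" by (rule pair_factor_ae[where 'n='n and m=m]) blast
  have "homog 2 (\<lambda>y :: complex ^ 'n option. - (c * y $ None)\<^sup>2)" for c
    using homog_cmult[OF homog_square[OF homog_cmult[of 1 "\<lambda>y :: complex ^ 'n option. y $ None" c]], of "-1"] by simp
  then have lin: "even_form 1 (\<lambda>y :: complex ^ 'n option. [:- (c * y $ None)\<^sup>2, 1:])" for c by (rule even_form_linear)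
  have "even_form ((\<Sum>j\<in>{?A..<a}. 1) + (\<Sum>j\<in>{?B..<b}. 1)) V"
    unfolding V_def[abs_def] by (intro even_form_mult even_form_prod lin) auto
  then have V: "even_form ((a - ?A) + (b - ?B)) V" by simp
  have wtV: "weight m a b t = poly (V y) (t\<^sup>2)" if y: "y $ None = 1" and t: "Im t \<noteq> 0" for y t
  proof -
    have "weight_num m a b t = weight_num m ?A ?B t * poly (V y) (t\<^sup>2)"
    proof -
      have "poly (V y) (t\<^sup>2) = (\<Prod>j\<in>{?A..<a}. t\<^sup>2 - (offset m j)\<^sup>2) * (\<Prod>j\<in>{?B..<b}. t\<^sup>2 - (offset m j - 1/2)\<^sup>2)"
        by (simp add: V_def y poly_prod)
      then show ?thesis
        unfolding weight_num_def lessThan_atLeast0 prod.atLeastLessThan_concat[OF le0 a, symmetric]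
          prod.atLeastLessThan_concat[OF le0 b, symmetric]
        by (simp only: mult_ac)
    qed
    then show ?thesis using weight_num_nonzero[OF t] by (simp add: weight_def)
  qed
  define T where "T y = V y * \<Phi> y * \<Gamma> y" for y
  define nT where "nT = (a - ?A) + (b - ?B) + n + ?N * m"
  have "even_form nT T" unfolding T_def[abs_def] nT_def by (intro even_form_mult V \<Phi> \<Gamma>)
  then obtain \<Xi> where \<Xi>: "even_form nT \<Xi>" "\<And>y t. (t + y $ None / 2) * poly (\<Xi> y) ((t + y $ None / 2)\<^sup>2)
      - (t - y $ None / 2) * poly (\<Xi> y) ((t - y $ None / 2)\<^sup>2) = y $ None * poly (T y) (t\<^sup>2)"
    using even_form_antidifference by blast
  define l where "l i y = y $ Some i + of_nat m / 2 * y $ None" for i and y :: "complex ^ 'n option"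
  have hl: "homog 1 (l i)" for i unfolding l_def[abs_def] by (intro homog_add homog_cmult) auto
  define E where "E i y = l i y * poly (\<Xi> y) ((l i y)\<^sup>2)" for i y
  have hE: "homog (d + 2 * n) (E i)" for i
  proof -
    have "homog (1 + 2 * nT) (E i)"
      unfolding E_def[abs_def] by (intro homog_mult hl even_form_poly \<Xi>(1) homog_square)
    moreover have "1 + 2 * nT = d + 2 * n"
    proof -
      define A B X where "A = ?A" and "B = ?B" and "X = ?N * m"
      have AB: "A + B = m" unfolding A_def B_def by presburger
      obtain a' b' where ab: "a = A + a'" "b = B + b'"
        using a b by (auto simp: A_def B_def le_iff_add)
      have "nT = a' + b' + n + X"
        unfolding nT_def A_def[symmetric] B_def[symmetric] X_def[symmetric] ab by simp
      moreover have "d + 2 * m = 2 * a + 2 * b + 2 * X + 1" using d by (simp add: X_def mult_ac)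
      ultimately show ?thesis using AB ab by linarith
    qed
    ultimately show ?thesis by simp
  qed
  define F where "F y t = t * poly (\<Xi> y) (t\<^sup>2)" for y t
  have F_odd: "F y (- t) = - F y t" for y t by (simp add: F_def)
  have F_diff: "F y (t + 1/2) - F y (t - 1/2) = poly (V y) (t\<^sup>2) * poly (\<Phi> y) (t\<^sup>2) * pair_factor m y t" if "y $ None = 1" for y t
    using \<Xi>(2)[of t y] that by (simp add: F_def T_def \<Gamma>(2))
  have EF: "E i y = F y (y $ Some i + of_nat m / 2)" if "y $ None = 1" for i y
    using that by (simp add: E_def F_def l_def)
  show "\<exists>E. (\<forall>i. homog (d + 2 * n) (E i)) \<and> (\<forall>i. \<forall>\<kappa>\<in>cat_set a b. \<forall>y. y $ Some i = \<kappa> * y $ None \<longrightarrow> E i y = 0) \<and>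
      (\<forall>y. y $ None = 1 \<longrightarrow> (\<forall>k. 2 * y $ Some k \<in> \<int> \<longrightarrow> y $ Some k \<in> cat_set a b) \<longrightarrow>
        (\<exists>F. antidiff m (\<lambda>t. weight m a b t * poly (\<Phi> y) (t\<^sup>2)) y F \<and>
           (\<forall>i. Im (y $ Some i) \<noteq> 0 \<longrightarrow> E i y = F (y $ Some i + of_nat m / 2))))"
  proof (intro exI[of _ E] conjI allI ballI impI)
    show "homog (d + 2 * n) (E i)" for i by (rule hE)
    show "E i y = 0" if \<kappa>: "\<kappa> \<in> cat_set a b" and y: "y $ Some i = \<kappa> * y $ None" for i \<kappa> y
    \<comment> \<open>The direction is 0: the antidifference is a polynomial, so real coordinates
      are harmless and only z = 1 is arranged.\<close>
    proof (rule hyperplane_extension[OF hE, of "bvec i \<kappa>" 0 "\<chi> v. case v of None \<Rightarrow> 1 | Some j \<Rightarrow> \<kappa>"])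
      fix y :: "complex ^ 'n option" assume "dotp (bvec i \<kappa>) y = 0" and y: "y $ None = 1"
      then have yi: "y $ Some i = \<kappa>" by (simp add: dotp_bvec)
      obtain K where K: "\<kappa> = of_nat K / 2 \<or> \<kappa> = - (of_nat K / 2)" "even K \<Longrightarrow> K \<le> 2 * a" "odd K \<Longrightarrow> K + 1 \<le> 2 * b"
        by (rule cat_set_half_nat[OF \<kappa>]) blast
      have zero: "poly (V y) (t\<^sup>2) * poly (\<Phi> y) (t\<^sup>2) * pair_factor m y t = 0"
        if r: "r < K + m" and t: "t = of_nat r + 1/2 - (of_nat K + of_nat m) / 2" for r t
      proof -
        \<comment> \<open>Window around - K/2, gap, window around K/2; for K at most m the gap is
          empty.\<close>
        consider "r < m" | "m \<le> r" "r < K" | "K \<le> r" by linarith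
        then show ?thesis
        proof cases
          case 1
          have "t = - (of_nat K / 2) + offset m r" by (simp add: t offset_def field_simps)
          then have "t\<^sup>2 = (y $ Some i + offset m r)\<^sup>2 \<or> t\<^sup>2 = (y $ Some i - offset m r)\<^sup>2"
            using K(1) by (auto simp: yi power2_eq_iff)
          then show ?thesis using pair_factor_eq_0[OF y 1] by simp
        next
          case 2
          from weight_covers_gap[OF this K(2,3) t] have "poly (V y) (t\<^sup>2) = 0"
          proof
            assume "\<exists>j\<in>{?A..<a}. t\<^sup>2 = (offset m j)\<^sup>2"
            then show ?thesis unfolding V_def using y by (auto simp: poly_prod)
          next
            assume "\<exists>j\<in>{?B..<b}. t\<^sup>2 = (offset m j - 1/2)\<^sup>2"
            then show ?thesis unfolding V_def using y by (auto simp: poly_prod)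
          qed
          then show ?thesis by simp
        next
          case 3
          then obtain r' where r': "r = K + r'" by (auto simp: le_iff_add)
          have "t = of_nat K / 2 + offset m r'" by (simp add: t r' offset_def field_simps)
          then have "t\<^sup>2 = (y $ Some i + offset m r')\<^sup>2 \<or> t\<^sup>2 = (y $ Some i - offset m r')\<^sup>2"
            using K(1) by (auto simp: yi power2_eq_iff)
          moreover have "r' < m" using r r' by simp
          ultimately show ?thesis using pair_factor_eq_0[OF y] by simp
        qed
      qed
      have "F y (of_nat K / 2 + of_nat m / 2) = 0" "F y (- (of_nat K / 2) + of_nat m / 2) = 0"
        by (rule odd_sum_vanishes[where G="\<lambda>t. poly (V y) (t\<^sup>2) * poly (\<Phi> y) (t\<^sup>2) * pair_factor m y t", OF F_odd F_diff[OF y]],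
            rule zero, assumption, rule refl)+
      then show "E i y = 0" unfolding EF[OF y] yi using K(1) by (elim disjE) (simp_all only:)
    qed (use y in \<open>simp_all add: dotp_bvec\<close>)
    fix y :: "complex ^ 'n option" assume y: "y $ None = 1"
    have "antidiff m (\<lambda>t. weight m a b t * poly (\<Phi> y) (t\<^sup>2)) y (F y)"
      unfolding antidiff_def
    proof (intro conjI allI impI)
      have "F y t = poly (pCons 0 (pcompose (\<Xi> y) [:0, 0, 1:])) t" for t
        by (simp add: F_def poly_pcompose power2_eq_square)
      then have "F y = poly (pCons 0 (pcompose (\<Xi> y) [:0, 0, 1:]))" by blast
      then show "rational_fun (F y)" by (simp only: rational_fun_poly)
    qed (simp_all add: F_odd F_diff[OF y] wtV[OF y])
    then show "\<exists>F. antidiff m (\<lambda>t. weight m a b t * poly (\<Phi> y) (t\<^sup>2)) y F \<and>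
           (\<forall>i. Im (y $ Some i) \<noteq> 0 \<longrightarrow> E i y = F (y $ Some i + of_nat m / 2))"
      using EF[OF y] by blast
  qed
qed

text \<open>Raising both multiplicities by \<open>m\<close> certainly reaches the range of
  \<open>solvable_base\<close>; each of the 2 m lowering steps back takes 2 from the degree.\<close>

lemma solvable_weight:
  assumes "d + 2 * m = 2 * a + 2 * b + 2 * m * CARD('n::finite) + 1"
  shows "solvable TYPE('n) m (weight m a b) d (cat_set a b)"
proof -
  have da: "solvable TYPE('n) m (weight m a b) d (cat_set a b)"
    if "solvable TYPE('n) m (weight m (Suc a) b) (d + 2) (cat_set (Suc a) b)" for a b d
  proof -
    obtain P :: "complex ^ 'n option \<Rightarrow> complex poly" where P: "lowering m (weight m a b) (offset m a) (of_nat a + 1) P"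
      using lowering_weight(1) by blast
    have "weight m (Suc a) b = (\<lambda>t. (t\<^sup>2 - (offset m a)\<^sup>2) * weight m a b t)" by (simp add: weight_Suc fun_eq_iff)
    moreover have "2 * (of_nat a + 1 :: complex) = of_int (2 * int a + 2)" by simp
    then have "2 * (of_nat a + 1 :: complex) \<in> \<int>" by (simp only: Ints_of_int)
    moreover have "(of_nat a + 1 :: complex) \<noteq> 0" by (metis of_nat_Suc of_nat_eq_0_iff nat.simps(3) add.commute)
    ultimately show ?thesis
      using that cat_set_notin by (intro solvable_lower[OF P]) (simp_all add: cat_set_Suc(1))
  qed
  have db: "solvable TYPE('n) m (weight m a b) d (cat_set a b)"
    if "solvable TYPE('n) m (weight m a (Suc b)) (d + 2) (cat_set a (Suc b))" for a b d
  proof -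
    obtain P :: "complex ^ 'n option \<Rightarrow> complex poly" where P: "lowering m (weight m a b) (offset m b - 1/2) (of_nat b + 1/2) P"
      using lowering_weight(2) by blast
    have "weight m a (Suc b) = (\<lambda>t. (t\<^sup>2 - (offset m b - 1/2)\<^sup>2) * weight m a b t)" by (simp add: weight_Suc fun_eq_iff)
    moreover have e: "2 * (of_nat b + 1/2 :: complex) = of_int (2 * int b + 1)" by simp
    then have "2 * (of_nat b + 1/2 :: complex) \<in> \<int>" by (simp only: Ints_of_int)
    moreover have "(of_nat b + 1/2 :: complex) \<noteq> 0"
    proof
      assume "(of_nat b + 1/2 :: complex) = 0"
      then have "(of_int (2 * int b + 1) :: complex) = 0" using e by simp
      then show False unfolding of_int_eq_0_iff by presburger
    qed
    ultimately show ?thesis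
      using that cat_set_notin by (intro solvable_lower[OF P]) (simp_all add: cat_set_Suc(2))
  qed
  have ka: "solvable TYPE('n) m (weight m (a + k) b) (d + 2 * k) (cat_set (a + k) b) \<Longrightarrow> solvable TYPE('n) m (weight m a b) d (cat_set a b)" for a b d k
  proof (induction k)
    case (Suc k)
    then show ?case using da[of "a + k" b "d + 2 * k"] by simp
  qed simp
  have kb: "solvable TYPE('n) m (weight m a (b + k)) (d + 2 * k) (cat_set a (b + k)) \<Longrightarrow> solvable TYPE('n) m (weight m a b) d (cat_set a b)" for a b d k
  proof (induction k)
    case (Suc k)
    then show ?case using db[of a "b + k" "d + 2 * k"] by simp
  qed simp
  have "solvable TYPE('n) m (weight m (a + m) (b + m)) (d + 2 * m + 2 * m) (cat_set (a + m) (b + m))"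
    by (rule solvable_base) (use assms in auto)
  then show ?thesis by (intro kb[of a b m d] ka[of a m "b + m"]) simp
qed

text \<open>Here \<open>F\<close> is an odd polynomial with more roots than its degree permits: \<open>0\<close> and the windows around \<open>\<plusminus>x\<^sub>k\<close>.\<close>

lemma nondegenerate_base:
  fixes y :: "complex ^ ('n::finite) option" and f :: "'n \<Rightarrow> nat"
  assumes f: "inj f" and y: "y $ None = 1" "\<And>k. y $ Some k = \<i> * of_nat (Suc (f k))"
  shows "nondegenerate m (weight m (m div 2) ((m + 1) div 2)) y"
  unfolding nondegenerate_def
proof (intro allI impI)
  let ?W = "weight m (m div 2) ((m + 1) div 2)" and ?N = "CARD('n)"
  fix C F assume C: "degree C < ?N" and F: "antidiff m (\<lambda>t. ?W t * poly C (t\<^sup>2)) y F"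
    and Fx: "\<forall>i. F (y $ Some i + of_nat m / 2) = 0"
  have W: "?W t = 1" if "Im t \<noteq> 0" for t
    using weight_num_nonzero[OF that] by (simp add: weight_def)
  have im: "Im (y $ Some k) \<noteq> 0" for k by (simp add: y)
  obtain \<Gamma> :: "complex ^ 'n option \<Rightarrow> complex poly"
    where \<Gamma>: "even_form (?N * m) \<Gamma>" "\<And>y t. poly (\<Gamma> y) (t\<^sup>2) = pair_factor m y t" by (rule pair_factor_ae[where 'n='n and m=m]) blast
  define p where "p = pcompose (C * \<Gamma> y) [:0, 0, 1:]"
  have pp: "poly p t = poly C (t\<^sup>2) * pair_factor m y t" for t
    by (simp add: p_def poly_pcompose \<Gamma>(2)[symmetric] power2_eq_square)
  \<comment> \<open>With N variables this is 2 N (m + 1) - 1, a bound for the degree of the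
    antidifference.\<close>
  define n where "n = 2 * (?N - 1 + ?N * m) + 1"
  have "degree p < n"
  proof -
    have "degree (C * \<Gamma> y) \<le> ?N - 1 + ?N * m"
      using degree_mult_le[of C "\<Gamma> y"] even_form_degree[OF \<Gamma>(1), of y] C by linarith
    then show ?thesis by (simp add: p_def degree_pcompose n_def)
  qed
  then have "coeff p k = 0" if "k \<ge> n" for k using that by (intro coeff_eq_0) simp
  from central_antidifference[OF this] obtain q where q: "\<And>k. k > n \<Longrightarrow> coeff q k = 0"
    "\<And>t. poly q (t + 1/2) - poly q (t - 1/2) = poly p t" by blast
  define q' where "q' = smult (1/2) (q - pcompose q [:0, - 1:])"
  have q': "poly q' t = (poly q t - poly q (- t)) / 2" for t
    by (simp add: q'_def poly_pcompose)
  have "degree q \<le> n" using q(1) by (intro degree_le) auto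
  then have degq': "degree q' \<le> n"
    unfolding q'_def
    by (intro order_trans[OF degree_smult_le] degree_diff_le) (simp_all add: degree_pcompose)
  have Q: "antidiff m (\<lambda>t. ?W t * poly C (t\<^sup>2)) y (poly q')"
    unfolding antidiff_def
  proof (intro conjI allI impI rational_fun_poly)
    fix t :: complex assume t: "Im t \<noteq> 0"
    show "poly q' (- t) = - poly q' t" by (simp add: q' field_simps)
    have "poly q (- t + 1/2) - poly q (- t - 1/2) = poly p t"
      unfolding q(2) pp by (simp add: pair_factor_minus)
    moreover have e: "- (t - 1/2) = - t + 1/2" "- (t + 1/2) = - t - 1/2" by simp_all
    moreover have "a - d = M \<Longrightarrow> b - c = M \<Longrightarrow> (b - d') / 2 - (c - a') / 2 = M" if "a' = a" "d' = d" for a b c d a' d' M :: complex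
      using that by (auto simp: field_simps)
    ultimately have "poly q' (t + 1/2) - poly q' (t - 1/2) = poly p t"
      unfolding q' e using q(2)[of t] by blast
    then show "poly q' (t + 1/2) - poly q' (t - 1/2) = ?W t * poly C (t\<^sup>2) * pair_factor m y t"
      using W[OF t] by (simp add: pp)
  qed
  have root: "poly q' (y $ Some k + of_nat m / 2 - of_nat r) = 0" if "r \<le> m" for k r
    using antidiff_window[OF F y(1) im that, of k] antidiff_unique[OF F Q, of "y $ Some k + of_nat m / 2 - of_nat r"] im[of k] Fx
    by simp
  have odd: "poly q' (- t) = - poly q' t" for t by (simp add: q' field_simps)
  \<comment> \<open>Together with 0 these are 2 N (m + 1) + 1 roots. They are distinct: the
    imaginary part determines the sign and \<open>k\<close>, and then the real part determines
    \<open>r\<close>.\<close>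
  define R where "R = (\<lambda>(\<sigma>, k, r). \<sigma> * (y $ Some k + of_nat m / 2 - of_nat r)) ` ({1, - 1 :: complex} \<times> (UNIV :: 'n set) \<times> {..m})"
  have "inj_on (\<lambda>(\<sigma>, k, r). \<sigma> * (y $ Some k + of_nat m / 2 - of_nat r)) ({1, - 1 :: complex} \<times> (UNIV :: 'n set) \<times> {..m})"
    by (rule inj_onI) (use f in \<open>auto simp: y complex_eq_iff inj_eq\<close>)
  then have cR: "card R = 2 * (?N * Suc m)"
    unfolding R_def by (simp add: card_image card_cartesian_product)
  have R0: "0 \<notin> R" by (auto simp: R_def y complex_eq_iff)
  have "insert 0 R \<subseteq> {x. poly q' x = 0}"
    using root odd by (auto simp: R_def q')
  have "q' = 0"
  proof (rule ccontr)
    assume "q' \<noteq> 0"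
    then have "card (insert 0 R) \<le> degree q'"
      using card_mono[OF poly_roots_finite \<open>insert 0 R \<subseteq> _\<close>] card_poly_roots_bound[of q'] by simp
    moreover have "card (insert 0 R) = 2 * (?N * Suc m) + 1"
      using R0 cR by (simp add: R_def)
    moreover have "n < 2 * (?N * Suc m) + 1"
    proof -
      obtain N' where "?N = Suc N'" by (metis Suc_pred zero_less_card_finite)
      then show ?thesis by (simp add: n_def)
    qed
    ultimately show False using degq' by linarith
  qed
  then have CG: "poly C (t\<^sup>2) * pair_factor m y t = 0" if "Im t \<noteq> 0" for t
    using antidiffD(3)[OF Q that] W[OF that] by simp
  \<comment> \<open>Vanishing is known only for nonreal \<open>t\<close>, so an infinite set of
    nonreal values is chosen for its square.\<close>
  have "poly (C * \<Gamma> y) (of_nat r + \<i>) = 0" for r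
  proof -
    define t where "t = csqrt (of_nat r + \<i>)"
    have t2: "t\<^sup>2 = of_nat r + \<i>" by (simp add: t_def)
    have "Im t \<noteq> 0"
    proof
      assume "Im t = 0"
      then have "Im (t\<^sup>2) = 0" by (simp add: power2_eq_square)
      then show False by (simp add: t2)
    qed
    from CG[OF this] show ?thesis by (simp add: \<Gamma>(2)[symmetric] t2)
  qed
  then have "range (\<lambda>r. of_nat r + \<i>) \<subseteq> {x. poly (C * \<Gamma> y) x = 0}" by auto
  moreover have "infinite (range (\<lambda>r. of_nat r + \<i>))"
    by (rule range_inj_infinite) (simp add: inj_def)
  ultimately have "C * \<Gamma> y = 0"
    using poly_roots_finite finite_subset by blast
  moreover have "\<Gamma> y \<noteq> 0"
  proof
    assume "\<Gamma> y = 0"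
    then have "pair_factor m y 0 = 0" using \<Gamma>(2)[of y 0] by simp
    then obtain k r where "y $ Some k + offset m r = 0"
      by (auto simp: pair_factor_def y(1))
    then have "Im (y $ Some k + offset m r) = 0" by simp
    then show False using im[of k] by simp
  qed
  ultimately show "C = 0" by simp
qed

text \<open>Since the lowering step is an equivalence, every weight can be compared with the one for
  \<open>a = b = 0\<close> and from there with the normalising pair, where the weight is 1.\<close>

lemma nondegenerate_weight:
  fixes y :: "complex ^ ('n::finite) option" and f :: "'n \<Rightarrow> nat"
  assumes f: "inj f" and y: "y $ None = 1" "\<And>k. y $ Some k = \<i> * of_nat (Suc (f k))"
  shows "nondegenerate m (weight m a b) y"
proof -
  have im: "Im (y $ Some k) \<noteq> 0" for k by (simp add: y)
  have sa: "nondegenerate m (weight m (Suc a) b) y \<longleftrightarrow> nondegenerate m (weight m a b) y" for a b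
  proof -
    obtain P :: "complex ^ 'n option \<Rightarrow> complex poly" where "lowering m (weight m a b) (offset m a) (of_nat a + 1) P"
      using lowering_weight(1) by blast
    from nondegenerate_lowering_iff[OF this _ y(1) im] show ?thesis by (simp add: weight_Suc[abs_def])
  qed
  have sb: "nondegenerate m (weight m a (Suc b)) y \<longleftrightarrow> nondegenerate m (weight m a b) y" for a b
  proof -
    obtain P :: "complex ^ 'n option \<Rightarrow> complex poly" where "lowering m (weight m a b) (offset m b - 1/2) (of_nat b + 1/2) P"
      using lowering_weight(2) by blast
    from nondegenerate_lowering_iff[OF this _ y(1) im] show ?thesis by (simp add: weight_Suc[abs_def])
  qed
  have a0: "nondegenerate m (weight m a b) y \<longleftrightarrow> nondegenerate m (weight m 0 b) y" for a b
    by (induction a) (simp_all add: sa)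
  have b0: "nondegenerate m (weight m 0 b) y \<longleftrightarrow> nondegenerate m (weight m 0 0) y" for b
    by (induction b) (simp_all add: sb)
  show ?thesis
    using nondegenerate_base[OF f y] a0 b0 by metis
qed

section \<open>The hyperplanes of the arrangement\<close>

fun catvec :: "('n::finite \<times> complex) + ('n \<times> 'n) \<times> complex \<times> complex \<Rightarrow> complex ^ 'n option" where
  "catvec (Inl (i, \<kappa>)) = bvec i \<kappa>"
| "catvec (Inr ((i, j), \<epsilon>, \<kappa>)) =
     (\<chi> v. case v of None \<Rightarrow> - \<kappa> | Some k \<Rightarrow> if k = i then 1 else if k = j then - \<epsilon> else 0)"

text \<open>The hyperplane z = 0 is absent because \<open>saito\<close> handles it through the Euler
  derivation.\<close>

definition cat_index :: "nat \<Rightarrow> nat \<Rightarrow> nat \<Rightarrow> (('n::{finite,linorder} \<times> complex) + ('n \<times> 'n) \<times> complex \<times> complex) set" where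
  "cat_index m1 m2 m3 = (UNIV \<times> cat_set m1 m2) <+> ({(i, j). i < j} \<times> {1, - 1} \<times> of_int ` {- int m3..int m3})"

lemma catvec_sum:
  "(\<Sum>k\<in>UNIV. catvec (Inl (i, \<kappa>)) $ Some k * f k) = f i"
  "i \<noteq> j \<Longrightarrow> (\<Sum>k\<in>UNIV. catvec (Inr ((i, j), \<epsilon>, \<kappa>)) $ Some k * f k) = f i - \<epsilon> * f j"
proof -
  have "(\<Sum>k\<in>UNIV. catvec (Inl (i, \<kappa>)) $ Some k * f k) = (\<Sum>k\<in>{i}. catvec (Inl (i, \<kappa>)) $ Some k * f k)"
    by (rule sum.mono_neutral_right) (auto simp: bvec_def)
  then show "(\<Sum>k\<in>UNIV. catvec (Inl (i, \<kappa>)) $ Some k * f k) = f i" by (simp add: bvec_def)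
next
  assume "i \<noteq> j"
  have "(\<Sum>k\<in>UNIV. catvec (Inr ((i, j), \<epsilon>, \<kappa>)) $ Some k * f k) = (\<Sum>k\<in>{i, j}. catvec (Inr ((i, j), \<epsilon>, \<kappa>)) $ Some k * f k)"
    by (rule sum.mono_neutral_right) auto
  then show "(\<Sum>k\<in>UNIV. catvec (Inr ((i, j), \<epsilon>, \<kappa>)) $ Some k * f k) = f i - \<epsilon> * f j" using \<open>i \<noteq> j\<close> by simp
qed

lemma dotp_catvec:
  "dotp (catvec (Inl (i, \<kappa>))) y = y $ Some i - \<kappa> * y $ None"
  "i \<noteq> j \<Longrightarrow> dotp (catvec (Inr ((i, j), \<epsilon>, \<kappa>))) y = y $ Some i - \<epsilon> * y $ Some j - \<kappa> * y $ None"
  by (simp add: dotp_bvec, simp add: dotp_def sum_option catvec_sum(2)[simplified])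

lemma dotp_0: "dotp a 0 = 0"
  by (simp add: dotp_def)

lemma finite_cat_set: "finite (cat_set a b)"
  by (simp add: cat_set_def)

lemma card_cat_set: "card (cat_set a b) = 1 + 2 * a + 2 * b"
proof -
  have "(of_int ` {- int a..int a} :: complex set) \<inter> (\<lambda>j. of_int j - 1/2) ` {1 - int b..int b} = {}"
    using of_int_neq_half_int by auto
  moreover have "card (of_int ` {- int a..int a} :: complex set) = 2 * a + 1"
    by (subst card_image) (auto simp: inj_on_def)
  moreover have "card ((\<lambda>j. of_int j - 1/2 :: complex) ` {1 - int b..int b}) = 2 * b"
    by (subst card_image) (auto simp: inj_on_def)
  ultimately show ?thesis
    by (simp add: cat_set_def card_Un_disjoint)
qed

lemma card_ordered_pairs:
  "2 * card {(i, j). i < (j :: 'n::{finite,linorder})} = CARD('n) * (CARD('n) - 1)"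
proof -
  let ?L = "{(i, j). i < (j :: 'n)}" and ?G = "{(i, j). (j :: 'n) < i}" and ?D = "(\<lambda>i. (i, i)) ` (UNIV :: 'n set)"
  have "card ?G = card ?L"
    by (rule bij_betw_same_card[of prod.swap]) (auto simp: bij_betw_def inj_on_def image_iff)
  moreover have "card ?D = CARD('n)" by (subst card_image) (auto simp: inj_on_def)
  moreover have "card (UNIV :: ('n \<times> 'n) set) = card (?L \<union> (?G \<union> ?D))"
    by (rule arg_cong[of _ _ card]) auto
  moreover have "card (?L \<union> (?G \<union> ?D)) = card ?L + (card ?G + card ?D)"
    by (subst card_Un_disjoint; (subst card_Un_disjoint)?) auto
  ultimately have "CARD('n) * CARD('n) = 2 * card ?L + CARD('n)"
    by simp
  then show ?thesis by (simp add: diff_mult_distrib2)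
qed

lemma finite_cat_index: "finite (cat_index m1 m2 m3)"
  by (simp add: cat_index_def finite_cat_set)

lemma card_cat_index:
  "card (cat_index m1 m2 m3 :: (('n::{finite,linorder} \<times> complex) + ('n \<times> 'n) \<times> complex \<times> complex) set)
    = CARD('n) * (1 + 2 * m1 + 2 * m2) + CARD('n) * (CARD('n) - 1) * (2 * m3 + 1)"
proof -
  have "card (of_int ` {- int m3..int m3} :: complex set) = 2 * m3 + 1"
    by (subst card_image) (auto simp: inj_on_def)
  then have "card (cat_index m1 m2 m3 :: (('n \<times> complex) + ('n \<times> 'n) \<times> complex \<times> complex) set)
    = CARD('n) * (1 + 2 * m1 + 2 * m2) + (2 * card {(i, j). i < (j :: 'n)}) * (2 * m3 + 1)"
    unfolding cat_index_def
    by (subst card_Plus) (auto simp: finite_cat_set card_cartesian_product card_cat_set)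
  then show ?thesis unfolding card_ordered_pairs .
qed

lemma proportional_if_vanishing:
  assumes "a \<noteq> 0" "\<And>u. dotp a u = 0 \<Longrightarrow> dotp b u = 0"
  obtains c where "b = c *s a"
proof -
  obtain w where w: "a $ w \<noteq> 0" using assms(1) by (auto simp: vec_eq_iff)
  have e: "b $ v = b $ w / a $ w * a $ v" for v
  proof (cases "v = w")
    case False
    define u where "u = (\<chi> x. if x = v then a $ w else if x = w then - a $ v else 0)"
    have d: "dotp d u = d $ v * a $ w - d $ w * a $ v" for d
    proof -
      have "dotp d u = (\<Sum>x\<in>{v, w}. d $ x * u $ x)"
        unfolding dotp_def by (rule sum.mono_neutral_right) (auto simp: u_def)
      then show ?thesis using False by (simp add: u_def)
    qed
    have "dotp b u = 0" by (rule assms(2)) (simp add: d)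
    then show ?thesis using w unfolding d by (simp add: field_simps)
  qed (use w in simp)
  have "b = (b $ w / a $ w) *s a"
  proof (rule vec_eq_iff[THEN iffD2], rule allI)
    show "b $ v = ((b $ w / a $ w) *s a) $ v" for v
      unfolding vector_smult_component by (rule e)
  qed
  then show ?thesis by (rule that)
qed

lemma catvec_Some_nonzero: "\<exists>k. catvec p $ Some k \<noteq> 0"
proof (cases p)
  case (Inl q)
  then show ?thesis by (cases q) (auto simp: bvec_def intro!: exI[of _ "fst q"])
next
  case (Inr q)
  then show ?thesis by (cases q) (auto intro!: exI[of _ "fst (fst q)"])
qed

lemma catvec_nonzero: "catvec p \<noteq> 0"
  using catvec_Some_nonzero[of p] by force

text \<open>Proportional forms have the same support, which fixes the type of the index and, because
  of i < j, the variables. The coefficient 1 at the first variable then makes the factor 1.\<close>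

lemma catvec_proportional:
  assumes p: "p \<in> cat_index m1 m2 m3" "q \<in> cat_index m1 m2 m3" and e: "catvec q = c *s catvec p"
  shows "p = q"
proof -
  have ev: "catvec q $ v = c * catvec p $ v" for v by (simp add: e)
  have c: "c \<noteq> 0" using e catvec_nonzero[of q] by auto
  have supp: "catvec q $ v = 0 \<longleftrightarrow> catvec p $ v = 0" for v using ev[of v] c by simp
  consider (ll) i \<kappa> i' \<kappa>' where "p = Inl (i, \<kappa>)" "q = Inl (i', \<kappa>')"
    | (lr) i \<kappa> i' j' \<epsilon>' \<kappa>' where "p = Inl (i, \<kappa>)" "q = Inr ((i', j'), \<epsilon>', \<kappa>')" "i' < j'" "\<epsilon>' \<noteq> 0"
    | (rl) i j \<epsilon> \<kappa> i' \<kappa>' where "p = Inr ((i, j), \<epsilon>, \<kappa>)" "q = Inl (i', \<kappa>')" "i < j" "\<epsilon> \<noteq> 0"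
    | (rr) i j \<epsilon> \<kappa> i' j' \<epsilon>' \<kappa>' where "p = Inr ((i, j), \<epsilon>, \<kappa>)" "q = Inr ((i', j'), \<epsilon>', \<kappa>')" "i < j" "i' < j'" "\<epsilon> \<noteq> 0" "\<epsilon>' \<noteq> 0"
    using p by (cases p; cases q) (auto simp: cat_index_def)
  then show ?thesis
  proof cases
    case ll
    have "i = i'" using supp[of "Some i'"] ll by (auto simp: bvec_def split: if_splits)
    then have "c = 1" using ev[of "Some i"] ll by (simp add: bvec_def)
    then show ?thesis using ev[of None] ll \<open>i = i'\<close> by (simp add: bvec_def)
  next
    case lr
    have "i = i'" "i = j'" using supp[of "Some i'"] supp[of "Some j'"] lr by (auto simp: bvec_def split: if_splits)
    then show ?thesis using lr by simp
  next
    case rl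
    have "i = i'" "i' = j" using supp[of "Some i"] supp[of "Some j"] rl by (auto simp: bvec_def split: if_splits)
    then show ?thesis using rl by simp
  next
    case rr
    have "i' = i \<or> i' = j" "j' = i \<or> j' = j" "i = i' \<or> i = j'" "j = i' \<or> j = j'"
      using supp[of "Some i"] supp[of "Some j"] supp[of "Some i'"] supp[of "Some j'"] rr
      by (auto split: if_splits)
    then have ij: "i' = i" "j' = j" using rr by auto
    then have "c = 1" using ev[of "Some i"] rr by simp
    then show ?thesis using ev[of None] ev[of "Some j"] rr ij by (auto split: if_splits)
  qed
qed

declare catvec.simps [simp del]

lemma catvec_separate:
  assumes "p \<in> cat_index m1 m2 m3" "q \<in> cat_index m1 m2 m3" "p \<noteq> q"
  shows "\<exists>u. dotp (catvec p) u = 0 \<and> dotp (catvec q) u \<noteq> 0"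
proof (rule ccontr)
  assume "\<not> ?thesis"
  then obtain c where "catvec q = c *s catvec p"
    using proportional_if_vanishing[OF catvec_nonzero, of p "catvec q"] by blast
  with catvec_proportional[OF assms(1,2)] assms(3) show False by blast
qed

lemma int_multiple_iff:
  fixes w z :: complex
  shows "w = 0 \<or> (\<exists>k\<in>{1..m}. w\<^sup>2 - (of_nat k)\<^sup>2 * z\<^sup>2 = 0) \<longleftrightarrow> (\<exists>K\<in>{- int m..int m}. w = of_int K * z)"
proof
  assume "w = 0 \<or> (\<exists>k\<in>{1..m}. w\<^sup>2 - (of_nat k)\<^sup>2 * z\<^sup>2 = 0)"
  then show "\<exists>K\<in>{- int m..int m}. w = of_int K * z"
  proof
    assume "w = 0"
    then show ?thesis by (intro bexI[of _ 0]) auto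
  next
    assume "\<exists>k\<in>{1..m}. w\<^sup>2 - (of_nat k)\<^sup>2 * z\<^sup>2 = 0"
    then obtain k where k: "k \<in> {1..m}" "w\<^sup>2 = (of_nat k * z)\<^sup>2" by (auto simp: power_mult_distrib)
    from k(2) show ?thesis
      unfolding power2_eq_iff
      by (elim disjE) (use k(1) in \<open>auto intro: bexI[of _ "int k"] bexI[of _ "- int k"]\<close>)
  qed
next
  assume "\<exists>K\<in>{- int m..int m}. w = of_int K * z"
  then obtain K where K: "- int m \<le> K" "K \<le> int m" "w = of_int K * z" by auto
  show "w = 0 \<or> (\<exists>k\<in>{1..m}. w\<^sup>2 - (of_nat k)\<^sup>2 * z\<^sup>2 = 0)"
  proof (cases "K = 0")
    case False
    have "(of_nat (nat \<bar>K\<bar>) :: complex)\<^sup>2 = (of_int K)\<^sup>2"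
      by (cases "K \<ge> 0") auto
    then have "w\<^sup>2 - (of_nat (nat \<bar>K\<bar>))\<^sup>2 * z\<^sup>2 = 0" using K(3) by (simp add: power_mult_distrib)
    then show ?thesis using K False by (intro disjI2 bexI[of _ "nat \<bar>K\<bar>"]) auto
  qed (use K in simp)
qed

lemma half_int_multiple_iff:
  fixes w z :: complex
  shows "(\<exists>k\<in>{1..m}. 4 * w\<^sup>2 - (2 * of_nat k - 1)\<^sup>2 * z\<^sup>2 = 0) \<longleftrightarrow> (\<exists>j\<in>{1 - int m..int m}. w = (of_int j - 1/2) * z)"
proof
  assume "\<exists>k\<in>{1..m}. 4 * w\<^sup>2 - (2 * of_nat k - 1)\<^sup>2 * z\<^sup>2 = 0"
  then obtain k where k: "k \<in> {1..m}" "4 * w\<^sup>2 = (2 * of_nat k - 1)\<^sup>2 * z\<^sup>2" by auto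
  have "(2 * of_nat k - 1)\<^sup>2 * z\<^sup>2 = 4 * ((of_nat k - 1/2) * z)\<^sup>2"
    by (simp add: power2_eq_square field_simps)
  then have k2: "w\<^sup>2 = ((of_nat k - 1/2) * z)\<^sup>2" using k(2) by simp
  from k2 have "w = (of_int (int k) - 1/2) * z \<or> w = (of_int (1 - int k) - 1/2) * z"
    unfolding power2_eq_iff by (auto simp: algebra_simps)
  then show "\<exists>j\<in>{1 - int m..int m}. w = (of_int j - 1/2) * z"
  proof
    assume "w = (of_int (int k) - 1/2) * z"
    then show ?thesis by (rule bexI) (use k(1) in auto)
  next
    assume "w = (of_int (1 - int k) - 1/2) * z"
    then show ?thesis by (rule bexI) (use k(1) in auto)
  qed
next
  assume "\<exists>j\<in>{1 - int m..int m}. w = (of_int j - 1/2) * z"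
  then obtain j where j: "1 - int m \<le> j" "j \<le> int m" "w = (of_int j - 1/2) * z" by auto
  define k where "k = (if j \<ge> 1 then nat j else nat (1 - j))"
  have "(2 * of_nat k - 1 :: complex) = 2 * of_int j - 1 \<or> (2 * of_nat k - 1 :: complex) = - (2 * of_int j - 1)"
    by (auto simp: k_def)
  then have "(2 * of_nat k - 1 :: complex)\<^sup>2 = (2 * of_int j - 1)\<^sup>2" unfolding power2_eq_iff .
  moreover have "4 * w\<^sup>2 = (2 * of_int j - 1)\<^sup>2 * z\<^sup>2"
    unfolding j(3) by (simp add: power2_eq_square field_simps)
  ultimately show "\<exists>k\<in>{1..m}. 4 * w\<^sup>2 - (2 * of_nat k - 1)\<^sup>2 * z\<^sup>2 = 0"
    using j by (intro bexI[of _ k]) (auto simp: k_def)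
qed

lemma eval_BC_poly_eq_0_iff:
  fixes y :: "complex ^ ('n::{finite,linorder}) option"
  shows "eval (BC_poly m1 m2 m3) y = 0 \<longleftrightarrow> y $ None = 0 \<or> (\<exists>p\<in>cat_index m1 m2 m3. dotp (catvec p) y = 0)"
proof -
  define z where "z = y $ None"
  have 1: "(\<exists>i. y $ Some i = 0 \<or> (\<exists>j\<in>{1..m1}. (y $ Some i)\<^sup>2 - (of_nat j)\<^sup>2 * z\<^sup>2 = 0)
      \<or> (\<exists>j\<in>{1..m2}. 4 * (y $ Some i)\<^sup>2 - (2 * of_nat j - 1)\<^sup>2 * z\<^sup>2 = 0))
    \<longleftrightarrow> (\<exists>i. \<exists>\<kappa>\<in>cat_set m1 m2. dotp (catvec (Inl (i, \<kappa>))) y = 0)"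
    unfolding disj_assoc[symmetric] int_multiple_iff half_int_multiple_iff dotp_catvec cat_set_def bex_Un bex_simps
    by (simp add: z_def bex_simps image_iff)
  have 2: "(\<exists>i j. i < j \<and> (\<exists>\<epsilon>\<in>{1, - 1}. y $ Some i - \<epsilon> * y $ Some j = 0 \<or> (\<exists>k\<in>{1..m3}. (y $ Some i - \<epsilon> * y $ Some j)\<^sup>2 - (of_nat k)\<^sup>2 * z\<^sup>2 = 0)))
    \<longleftrightarrow> (\<exists>i j. i < j \<and> (\<exists>\<epsilon>\<in>{1, - 1}. \<exists>\<kappa>\<in>of_int ` {- int m3..int m3}. dotp (catvec (Inr ((i, j), \<epsilon>, \<kappa>))) y = 0))"
  proof -
    have "(\<exists>\<kappa>\<in>of_int ` {- int m3..int m3}. dotp (catvec (Inr ((i, j), \<epsilon>, \<kappa>))) y = 0) \<longleftrightarrow>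
        (\<exists>K\<in>{- int m3..int m3}. y $ Some i - \<epsilon> * y $ Some j = of_int K * z)" if "i < j" for i j \<epsilon>
      using that by (simp add: dotp_catvec(2) less_imp_neq z_def)
    then show ?thesis unfolding int_multiple_iff by (simp cong: conj_cong)
  qed
  have "eval (BC_poly m1 m2 m3) y = 0 \<longleftrightarrow> z = 0 \<or>
     (\<exists>i. y $ Some i = 0 \<or> (\<exists>j\<in>{1..m1}. (y $ Some i)\<^sup>2 - (of_nat j)\<^sup>2 * z\<^sup>2 = 0)
      \<or> (\<exists>j\<in>{1..m2}. 4 * (y $ Some i)\<^sup>2 - (2 * of_nat j - 1)\<^sup>2 * z\<^sup>2 = 0)) \<or>
     (\<exists>i j. i < j \<and> (\<exists>\<epsilon>\<in>{1, - 1}. y $ Some i - \<epsilon> * y $ Some j = 0 \<or> (\<exists>k\<in>{1..m3}. (y $ Some i - \<epsilon> * y $ Some j)\<^sup>2 - (of_nat k)\<^sup>2 * z\<^sup>2 = 0)))"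
    by (simp add: BC_poly_def Let_def z_def del: right_minus_eq)
  also have "\<dots> \<longleftrightarrow> z = 0 \<or> (\<exists>p\<in>cat_index m1 m2 m3. dotp (catvec p) y = 0)"
    unfolding 1 2 cat_index_def by auto
  finally show ?thesis by (simp add: z_def)
qed

text \<open>\<open>arrangement_of\<close> takes every linear divisor of the polynomial, so the point
  is that up to scalars there are none besides z and the listed forms.\<close>

lemma log_derivations_cBCCat:
  fixes L :: "('n::{finite,linorder}) option cpoly \<Rightarrow> 'n option cpoly"
  shows "L \<in> log_derivations (cBCCat m1 m2 m3) \<longleftrightarrow> derivation L \<and> pvar None dvd L (pvar None) \<and>
      (\<forall>p\<in>cat_index m1 m2 m3. linform (catvec p) dvd L (linform (catvec p)))"
proof -
  let ?Q = "BC_poly m1 m2 m3 :: 'n option cpoly" and ?I = "cat_index m1 m2 m3 :: (('n \<times> complex) + ('n \<times> 'n) \<times> complex \<times> complex) set"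
  define zv :: "complex ^ 'n option" where "zv = (\<chi> v. if v = None then 1 else 0)"
  have dz: "dotp zv y = y $ None" for y
    by (simp add: dotp_def sum_option zv_def)
  have lz: "linform zv = pvar None"
    by (rule eval_eqD) (simp add: eval_linform_dotp dz)
  have zv0: "zv \<noteq> 0"
  proof
    assume "zv = 0"
    then have "zv $ None = 0" by simp
    then show False by (simp add: zv_def)
  qed
  have zdvd: "linform zv dvd ?Q"
    unfolding linform_dvd_iff[OF zv0] by (simp add: dz eval_BC_poly_eq_0_iff)
  have pdvd: "linform (catvec p) dvd ?Q" if "p \<in> ?I" for p
    unfolding linform_dvd_iff[OF catvec_nonzero] using that by (auto simp: eval_BC_poly_eq_0_iff)
  have conv: "linform a dvd L (linform a)"
    if L: "derivation L" "pvar None dvd L (pvar None)" "\<forall>p\<in>?I. linform (catvec p) dvd L (linform (catvec p))"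
      and a: "a \<noteq> 0" "linform a dvd ?Q" for a
  proof -
    let ?F = "insert zv (catvec ` ?I)"
    have fin: "finite ?F" by (simp add: finite_cat_index)
    \<comment> \<open>A hyperplane covered by finitely many hyperplanes lies in one of them:
      otherwise the product of their forms could be cancelled on it from a product with 1, giving 1
      = 0.\<close>
    have "\<exists>f\<in>?F. \<forall>u. dotp a u = 0 \<longrightarrow> dotp f u = 0"
    proof (rule ccontr)
      assume "\<not> ?thesis"
      then have sep: "\<exists>u\<in>{u. dotp a u = 0}. dotp f u \<noteq> 0" if "f \<in> ?F" for f using that by blast
      have "(\<Prod>f\<in>?F. dotp f y) * 1 = 0" if "y \<in> {u. dotp a u = 0}" for y
      proof -
        have "eval ?Q y = 0" using a that linform_dvd_iff by blast
        then have "\<exists>f\<in>?F. dotp f y = 0" by (auto simp: eval_BC_poly_eq_0_iff dz)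
        then show ?thesis using fin by (simp add: prod_zero_iff del: prod.insert)
      qed
      then have "(\<lambda>y. 1 :: complex) (0 :: complex ^ 'n option) = 0"
        by (intro prod_linform_cancel_on[of "{u. dotp a u = 0}" ?F "\<lambda>y. 1" "\<lambda>f. f" 0])
           (use fin sep in \<open>auto intro: hyperplane_closed simp del: prod.insert simp: dotp_0\<close>)
      then show False by simp
    qed
    then obtain f where f: "f \<in> ?F" "\<And>u. dotp a u = 0 \<Longrightarrow> dotp f u = 0" by blast
    obtain c where c: "f = c *s a" using proportional_if_vanishing[OF a(1) f(2)] by blast
    have "f \<noteq> 0" using f(1) zv0 catvec_nonzero by (metis imageE insertE)
    then have c0: "c \<noteq> 0" using c by auto
    then have "a = (\<chi> v. (1 / c) * f $ v)" by (simp add: c vec_eq_iff)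
    then have la: "linform a = pconst (1 / c) * linform f" by (metis linform_scale)
    have La: "L (linform a) = pconst (1 / c) * L (linform f)"
      unfolding la by (rule derivationD(2)[OF L(1)])
    have "linform f dvd L (linform f)" using f(1) L(2,3) lz by auto
    then show ?thesis unfolding La unfolding la by (rule mult_dvd_mono[OF dvd_refl])
  qed
  show ?thesis
    unfolding cBCCat_def log_derivations_arrangement_of
    using conv zdvd pdvd zv0 catvec_nonzero lz by metis
qed

text \<open>For \<open>\<epsilon> = 1\<close>, a walk of |K| steps inside one window joins the two
  upper endpoints. For \<open>\<epsilon> = - 1\<close>, a point of one window is minus the lowest or
  the highest point of the other, and oddness supplies the sign.\<close>

lemma antidiff_reflection:
  assumes F: "antidiff m G y F" and y: "y $ None = 1" "Im (y $ Some i) \<noteq> 0" "Im (y $ Some j) \<noteq> 0"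
    and K: "\<bar>K\<bar> \<le> int m" and \<epsilon>: "\<epsilon> = 1 \<or> \<epsilon> = - 1" and ij: "y $ Some i = \<epsilon> * y $ Some j + of_int K"
  shows "F (y $ Some i + of_nat m / 2) = \<epsilon> * F (y $ Some j + of_nat m / 2)"
proof -
  note wi = antidiff_window[OF F y(1) y(2)] and wj = antidiff_window[OF F y(1) y(3)]
  show ?thesis
  proof (cases "\<epsilon> = 1")
    case True
    show ?thesis
    proof (cases "K \<ge> 0")
      case K0: True
      have e: "y $ Some i + of_nat m / 2 - of_nat (nat K) = y $ Some j + of_nat m / 2"
        using True ij K0 by simp
      show ?thesis using wi[of "nat K"] K K0 True unfolding e by simp
    next
      case False
      have e: "y $ Some j + of_nat m / 2 - of_nat (nat (- K)) = y $ Some i + of_nat m / 2"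
        using True ij False by simp
      show ?thesis using wj[of "nat (- K)"] K False True unfolding e by simp
    qed
  next
    case False
    then have \<epsilon>': "\<epsilon> = - 1" using \<epsilon> by blast
    show ?thesis
    proof (cases "K \<ge> 0")
      case True
      have e: "y $ Some j + of_nat m / 2 - of_nat (nat K) = - (y $ Some i + of_nat m / 2 - of_nat m)"
        using True by (simp add: ij \<epsilon>' field_simps)
      have "F (- (y $ Some i + of_nat m / 2 - of_nat m)) = F (y $ Some j + of_nat m / 2)"
        using wj[of "nat K"] K True unfolding e by simp
      moreover have "F (- (y $ Some i + of_nat m / 2 - of_nat m)) = - F (y $ Some i + of_nat m / 2 - of_nat m)"
        using y by (intro antidiffD(2)[OF F]) simp
      ultimately show ?thesis using wi[of m] \<epsilon>' by simp
    next
      case False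
      have e: "y $ Some i + of_nat m / 2 - of_nat (nat (K + int m)) = - (y $ Some j + of_nat m / 2)"
        using K by (simp add: ij \<epsilon>' field_simps)
      have "F (- (y $ Some j + of_nat m / 2)) = F (y $ Some i + of_nat m / 2)"
        using wi[of "nat (K + int m)"] K False unfolding e by simp
      moreover have "F (- (y $ Some j + of_nat m / 2)) = - F (y $ Some j + of_nat m / 2)"
        using y by (intro antidiffD(2)[OF F]) simp
      ultimately show ?thesis using \<epsilon>' by simp
    qed
  qed
qed

theorem theorem5p13:
  fixes m1 m2 m3 :: nat
  shows "free_arrangement (cBCCat m1 m2 m3 :: (complex ^ 'n::{finite,linorder} option) set set)"
proof -
  let ?N = "CARD('n)" and ?I = "cat_index m1 m2 m3 :: (('n \<times> complex) + ('n \<times> 'n) \<times> complex \<times> complex) set"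
    and ?S = "cat_set m1 m2"
  have N1: "?N \<ge> 1" by (simp add: Suc_le_eq)
  define d where "d = 2 * m1 + 2 * m2 + 2 * m3 * (?N - 1) + 1"
  have d: "d + 2 * m3 = 2 * m1 + 2 * m2 + 2 * m3 * ?N + 1"
    using N1 by (cases ?N) (auto simp: d_def)
  obtain rk :: "'n \<Rightarrow> nat" where rk: "bij_betw rk UNIV {..<?N}"
    using ex_bij_betw_finite_nat[of "UNIV :: 'n set"] by (auto simp: lessThan_atLeast0)
  have inj: "inj rk" using rk by (simp add: bij_betw_def)
  have rkN: "rk l < ?N" for l using rk by (auto simp: bij_betw_def)
  \<comment> \<open>The rows come from the powers t^(2 rk l); as the ranks run through 0, ..., N -
    1, the degrees are the required exponents.\<close>
  define good where "good l E \<longleftrightarrow> (\<forall>i. homog (d + 2 * rk l) (E i)) \<and> (\<forall>i. \<forall>\<kappa>\<in>?S. \<forall>y. y $ Some i = \<kappa> * y $ None \<longrightarrow> E i y = 0) \<and>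
      (\<forall>y. y $ None = 1 \<longrightarrow> (\<forall>k. 2 * y $ Some k \<in> \<int> \<longrightarrow> y $ Some k \<in> ?S) \<longrightarrow>
        (\<exists>F. antidiff m3 (\<lambda>t. weight m3 m1 m2 t * poly (monom 1 (rk l)) (t\<^sup>2)) y F \<and>
             (\<forall>i. Im (y $ Some i) \<noteq> 0 \<longrightarrow> E i y = F (y $ Some i + of_nat m3 / 2))))"
    for l and E :: "'n \<Rightarrow> complex ^ 'n option \<Rightarrow> complex"
  have "\<exists>E. good l E" for l
  proof -
    have "even_form (rk l) (\<lambda>y :: complex ^ 'n option. monom 1 (rk l))"
      by (rule even_form_monom) auto
    from solvable_weight[OF d, unfolded solvable_def, THEN spec, THEN spec, THEN mp, OF this]
    show ?thesis unfolding good_def .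
  qed
  then obtain E where good: "\<And>l. good l (E l)" by metis
  have E: "homog (d + 2 * rk l) (E l i)" "\<kappa> \<in> ?S \<Longrightarrow> y $ Some i = \<kappa> * y $ None \<Longrightarrow> E l i y = 0"
    "y $ None = 1 \<Longrightarrow> (\<And>k. 2 * y $ Some k \<in> \<int> \<Longrightarrow> y $ Some k \<in> ?S) \<Longrightarrow>
        \<exists>F. antidiff m3 (\<lambda>t. weight m3 m1 m2 t * poly (monom 1 (rk l)) (t\<^sup>2)) y F \<and>
             (\<forall>i. Im (y $ Some i) \<noteq> 0 \<longrightarrow> E l i y = F (y $ Some i + of_nat m3 / 2))" for l i \<kappa> y
    using good[of l] unfolding good_def by simp_all
  have pair: "E l i y - \<epsilon> * E l j y = 0"
    if "i < j" and \<epsilon>: "\<epsilon> = 1 \<or> \<epsilon> = - 1" and \<kappa>: "\<kappa> = of_int K" "\<bar>K\<bar> \<le> int m3"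
      and y: "dotp (catvec (Inr ((i, j), \<epsilon>, \<kappa>))) y = 0" for l i j \<epsilon> \<kappa> K y
  proof -
    have ij: "i \<noteq> j" using that(1) by simp
    have h: "homog (d + 2 * rk l) (\<lambda>y. E l i y - \<epsilon> * E l j y)" by (intro homog_diff homog_cmult E(1))
    show ?thesis
    \<comment> \<open>This direction lies in the hyperplane and is nonzero at every variable, so all
      coordinates become nonreal and every such point is admissible for \<open>E\<close>.\<close>
    proof (rule hyperplane_extension[OF h, of "catvec (Inr ((i, j), \<epsilon>, \<kappa>))"
          "\<chi> v. case v of None \<Rightarrow> 0 | Some k \<Rightarrow> if k = i then \<epsilon> else 1"
          "\<chi> v. case v of None \<Rightarrow> 1 | Some k \<Rightarrow> if k = i then \<kappa> else 0"])
      fix y :: "complex ^ 'n option"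
      assume yd: "dotp (catvec (Inr ((i, j), \<epsilon>, \<kappa>))) y = 0" and y1: "y $ None = 1"
        and im0: "\<And>k. (\<chi> v. case v of None \<Rightarrow> 0 | Some k \<Rightarrow> if k = i then \<epsilon> else 1) $ Some k \<noteq> 0 \<Longrightarrow> Im (y $ Some k) \<noteq> 0"
      have im: "Im (y $ Some k) \<noteq> 0" for k by (rule im0) (use \<epsilon> in \<open>auto split: if_splits\<close>)
      have yij: "y $ Some i = \<epsilon> * y $ Some j + of_int K"
        using yd y1 \<kappa> ij by (simp add: dotp_catvec(2) algebra_simps)
      have "y $ Some k \<in> ?S" if "2 * y $ Some k \<in> \<int>" for k
        using real_half_int[OF that] im[of k] by simp
      from E(3)[OF y1 this] obtain F where F: "antidiff m3 (\<lambda>t. weight m3 m1 m2 t * poly (monom 1 (rk l)) (t\<^sup>2)) y F"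
         "\<And>i. Im (y $ Some i) \<noteq> 0 \<Longrightarrow> E l i y = F (y $ Some i + of_nat m3 / 2)" by blast
      show "E l i y - \<epsilon> * E l j y = 0"
        using antidiff_reflection[OF F(1) y1 im im \<kappa>(2) \<epsilon> yij] F(2)[OF im] by simp
    qed (use y \<epsilon> ij in \<open>auto simp: dotp_catvec(2)\<close>)
  qed
  \<comment> \<open>Distinct imaginary coordinates with positive imaginary parts, as the root count
    in \<open>nondegenerate_base\<close> requires.\<close>
  define y0 :: "complex ^ 'n option" where
    "y0 = (\<chi> v. case v of None \<Rightarrow> 1 | Some k \<Rightarrow> \<i> * of_nat (Suc (rk k)))"
  have y0: "y0 $ None = 1" "\<And>k. y0 $ Some k = \<i> * of_nat (Suc (rk k))" by (simp_all add: y0_def)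
  have im: "Im (y0 $ Some k) \<noteq> 0" for k by (simp add: y0)
  show ?thesis
  proof (rule saito[of ?I catvec "cBCCat m1 m2 m3" "\<lambda>l. d + 2 * rk l" E y0,
        OF finite_cat_index catvec_Some_nonzero catvec_separate log_derivations_cBCCat E(1)])
    show "tangent ?I catvec (E l)" for l
      unfolding tangent_def
    proof (intro ballI allI impI)
      fix p y assume p: "p \<in> ?I" and y: "dotp (catvec p) y = 0"
      show "(\<Sum>k\<in>UNIV. catvec p $ Some k * E l k y) = 0"
      proof (cases p)
        case (Inl q)
        obtain i \<kappa> where q: "q = (i, \<kappa>)" by (cases q)
        then show ?thesis using Inl p y E(2)[of \<kappa> y i l] unfolding Inl q catvec_sum(1)
          by (auto simp: cat_index_def dotp_catvec(1))
      next
        case (Inr q)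
        obtain i j \<epsilon> \<kappa> where q: "q = ((i, j), \<epsilon>, \<kappa>)" by (metis prod.collapse)
        have "i < j" "\<epsilon> = 1 \<or> \<epsilon> = - 1" "\<kappa> \<in> of_int ` {- int m3..int m3}" using p Inr q by (auto simp: cat_index_def)
        moreover from this obtain K where "\<kappa> = of_int K" "\<bar>K\<bar> \<le> int m3" by auto
        ultimately have "E l i y - \<epsilon> * E l j y = 0" using y Inr q by (intro pair) auto
        then show ?thesis unfolding Inr q using \<open>i < j\<close> by (subst catvec_sum(2)) auto
      qed
    qed
    show "(\<Sum>l\<in>UNIV. d + 2 * rk l) = card ?I"
    proof -
      have "(\<Sum>l\<in>UNIV. rk l) = (\<Sum>r<?N. r)"
        by (rule sum.reindex_bij_betw[OF rk])
      moreover have "2 * (\<Sum>r<n. r) = n * (n - 1)" for n :: nat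
      proof (induction n)
        case (Suc n)
        then show ?case by (cases n) (auto simp: algebra_simps)
      qed simp
      ultimately have "(\<Sum>l\<in>UNIV. d + 2 * rk l) = ?N * d + ?N * (?N - 1)"
        by (simp add: sum.distrib sum_distrib_left[symmetric])
      also have "\<dots> = card ?I"
      proof -
        obtain N' where "?N = Suc N'" using N1 by (metis Suc_le_D One_nat_def)
        then show ?thesis
          unfolding card_cat_index d_def by (simp add: algebra_simps)
      qed
      finally show ?thesis .
    qed
    have "\<exists>F. antidiff m3 (\<lambda>t. weight m3 m1 m2 t * poly (monom 1 (rk l)) (t\<^sup>2)) y0 F \<and>
             (\<forall>i. E l i y0 = F (y0 $ Some i + of_nat m3 / 2))" for l
    proof -
      have "y0 $ Some k \<in> ?S" if "2 * y0 $ Some k \<in> \<int>" for k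
        using real_half_int[OF that] im[of k] by simp
      from E(3)[OF y0(1) this, of l] im show ?thesis by blast
    qed
    then obtain F where F: "\<And>l. antidiff m3 (\<lambda>t. weight m3 m1 m2 t * poly (monom 1 (rk l)) (t\<^sup>2)) y0 (F l)"
      "\<And>l i. E l i y0 = F l (y0 $ Some i + of_nat m3 / 2)" by metis
    show "det (\<chi> l k. E l k y0) \<noteq> 0"
    proof -
      let ?M = "transpose (\<chi> l k. E l k y0)"
      have "x = 0" if x: "?M *v x = 0" for x
      proof -
        \<comment> \<open>A linear relation between the rows at \<open>y0\<close> says that the
          derivation belonging to \<open>C\<close> vanishes there. The ranks are distinct and below
          N, so \<open>C\<close> has admissible degree and its coefficients are those of the
          relation.\<close>
        define C where "C = (\<Sum>l\<in>UNIV. monom (x $ l) (rk l))"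
        have "degree C < ?N"
        proof -
          have "degree C \<le> ?N - 1"
            unfolding C_def
          proof (rule degree_sum_le)
            show "degree (monom (x $ l) (rk l)) \<le> ?N - 1" for l
              using degree_monom_le[of "x $ l" "rk l"] rkN[of l] by linarith
          qed simp
          then show ?thesis using N1 by linarith
        qed
        moreover have "antidiff m3 (\<lambda>t. weight m3 m1 m2 t * poly C (t\<^sup>2)) y0 (\<lambda>t. \<Sum>l\<in>UNIV. x $ l * F l t)"
          by (rule antidiff_cong[OF antidiff_sum[OF _ F(1)]])
             (simp_all add: C_def poly_sum poly_monom sum_distrib_left mult_ac)
        moreover have "(\<Sum>l\<in>UNIV. x $ l * F l (y0 $ Some i + of_nat m3 / 2)) = 0" for i
          using arg_cong[OF x, of "\<lambda>v. v $ i"]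
          by (simp add: matrix_vector_mult_def transpose_def F(2) mult.commute)
        ultimately have "C = 0"
          by (rule nondegenerateD[OF nondegenerate_weight[OF inj y0]])
        have "x $ l = 0" for l
        proof -
          have "coeff C (rk l) = (\<Sum>l'\<in>UNIV. if l' = l then x $ l' else 0)"
            unfolding C_def coeff_sum using inj by (intro sum.cong) (auto simp: inj_eq)
          then show ?thesis using \<open>C = 0\<close> by simp
        qed
        then show ?thesis by (simp add: vec_eq_iff)
      qed
      then obtain B where "B ** ?M = mat 1" using matrix_left_invertible_ker[of ?M] by blast
      then have "invertible ?M" unfolding invertible_left_inverse by blast
      then have "det ?M \<noteq> 0" by (simp add: invertible_det_nz)
      then show ?thesis by (simp add: det_transpose)
    qed
  qed
qed

end
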